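(* Let $K$ be a compact connected Lie group, with maximal torus $T$, $\mathfrak{t}=\mathrm{Lie}(T)$, positive root system $\Delta^+\subset\mathfrak{t}^*$ and closed positive Weyl chamber $\mathfrak{t}^*_{\geq 0}$. Let $\lambda\in\rho^K+\mathfrak{t}^*_{\geq 0}$ and $\mu\in\mathfrak{t}^*$. (i) One has $$\|\lambda-\mu\|^2\;\geq\;\frac12\sum_{\alpha\in\Delta^+,\,(\alpha,\mu)=0}(\lambda,\alpha).$$ (ii) One has $$\frac12\sum_{\alpha\in\Delta^+,\,(\alpha,\mu)=0}(\lambda,\alpha)\;\geq\;\|\rho^{K_\mu}\|^2.$$ (iii) If one of the inequalities in (i) or (ii) is an equality, then $\mu$ belongs to $\mathfrak{t}^*_{\geq 0}$, and $\lambda=\mu+\rho^{K_\sigma}$, where $\sigma$ is the stratum (relative interior of a face) of $\mathfrak{t}^*_{\geq 0}$ containing $\mu$. Thus both inequalities in (i) and (ii) are equalities. In particular, $\lambda-\rho(\lambda)=\mu-\rho(\mu)$.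
   Context: Fix a $K$-invariant Euclidean inner product on $\mathfrak{k}=\mathrm{Lie}(K)$, used to identify $\mathfrak{k}\simeq\mathfrak{k}^*$; $(\cdot,\cdot)$ and $\|\cdot\|$ denote the inner product and norm on $\mathfrak{k}^*$. The space $\mathfrak{t}^*$ is embedded in $\mathfrak{k}^*$ as the $T$-invariant elements. Roots are elements $\alpha\in\mathfrak{t}^*$ (the character of $T$ is $e^{i\alpha}$), $\Delta$ is the root system, $\Delta^+$ a positive system, $H_\alpha\in\mathfrak{t}$ the coroot ($\langle\alpha,H_\alpha\rangle=2$), and $\mathfrak{t}^*_{\geq0}=\{\xi\in\mathfrak{t}^*:\langle\xi,H_\alpha\rangle\geq0\ \forall\alpha\in\Delta^+\}$. $\rho^K=\frac12\sum_{\alpha\in\Delta^+}\alpha$. For $\mu\in\mathfrak{t}^*$: $K_\mu$ is the stabilizer of $\mu$ in $K$; $\rho^{K_\mu}=\frac12\sum_{\alpha\in\Delta^+,(\alpha,\mu)=0}\alpha$ (the $\rho$-element of $K_\mu$ for the induced positive system); $\rho(\mu)=\frac12\sum_{\alpha\in\Delta,(\alpha,\mu)>0}\alpha$. $\mathfrak{t}^*_{\geq0}$ is the disjoint union of the relative interiors $\sigma$ of its faces (strata); for such $\sigma$, $K_\sigma$ denotes the common stabilizer $K_\xi$ of the points $\xi\in\sigma$, and $\rho^{K_\sigma}=\frac12\sum_{\alpha\in\Delta^+,(\alpha,\sigma)=0}\alpha$.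
   Formalization: In (iii), equality in (ii) alone does not suffice (e.g. K a torus, λ ≠ μ); the hypothesis proved is equality in (i), or equality ‖λ−μ‖² = ‖ρ^{K_μ}‖² in the bound obtained by combining (i) and (ii). *)

theory Defs
  imports "HOL-Analysis.Analysis" "HOL-Algebra.Group"
begin

text \<open>
  Smoothness on a relatively open subset \<open>S\<close> of a linear model space \<open>E\<close>: the iterated directional
  derivatives along \<open>E\<close> of every order exist and are continuous.
\<close>

primrec Ck_on ::
  "nat \<Rightarrow> 'a::real_normed_vector set \<Rightarrow> 'a set \<Rightarrow> ('a \<Rightarrow> 'b::real_normed_vector) \<Rightarrow> bool"
where
  "Ck_on 0 E S f \<longleftrightarrow> continuous_on S f"
| "Ck_on (Suc n) E S f \<longleftrightarrow>
     (\<exists>f'. (\<forall>x\<in>S. (f has_derivative f' x) (at x within S)) \<and>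
           (\<forall>v\<in>E. Ck_on n E S (\<lambda>x. f' x v)))"

definition smooth_on ::
  "'a::real_normed_vector set \<Rightarrow> 'a set \<Rightarrow> ('a \<Rightarrow> 'b::real_normed_vector) \<Rightarrow> bool"
where "smooth_on E S f \<longleftrightarrow> (\<forall>n. Ck_on n E S f)"


section \<open>Lie groups\<close>

text \<open>
  The model space \<open>E\<close> is the whole Euclidean space \<open>'e\<close>, or \<open>{0}\<close>: types of class
  \<open>euclidean_space\<close> have positive dimension, so the second case is needed for \<open>0\<close>-dimensional groups.
\<close>

type_synonym ('k, 'e) chart = "'k set \<times> ('k \<Rightarrow> 'e)"

abbreviation chart_dom :: "('k, 'e) chart \<Rightarrow> 'k set"
  where "chart_dom c \<equiv> fst c"

abbreviation chart_map :: "('k, 'e) chart \<Rightarrow> 'k \<Rightarrow> 'e"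
  where "chart_map c \<equiv> snd c"

definition chart_inv :: "('k, 'e) chart \<Rightarrow> 'e \<Rightarrow> 'k"
  where "chart_inv c = inv_into (chart_dom c) (chart_map c)"

definition smooth_atlas ::
  "'e::euclidean_space set \<Rightarrow> ('k::t2_space, 'e) chart set \<Rightarrow> bool"
where
  "smooth_atlas E A \<longleftrightarrow>
     (E = UNIV \<or> E = {0}) \<and>
     (\<Union>c\<in>A. chart_dom c) = UNIV \<and>
     (\<forall>c\<in>A. open (chart_dom c) \<and>
        openin (top_of_set E) (chart_map c ` chart_dom c) \<and>
        homeomorphism (chart_dom c) (chart_map c ` chart_dom c) (chart_map c) (chart_inv c)) \<and>
     (\<forall>c\<in>A. \<forall>d\<in>A.
        smooth_on E (chart_map c ` (chart_dom c \<inter> chart_dom d)) (chart_map d \<circ> chart_inv c))"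

definition lie_group ::
  "('k::t2_space) monoid \<Rightarrow> 'e::euclidean_space set \<Rightarrow> ('k, 'e) chart set \<Rightarrow> bool"
where
  "lie_group G E A \<longleftrightarrow>
     group G \<and> carrier G = UNIV \<and>
     smooth_atlas E A \<and>
     continuous_on UNIV (\<lambda>(g, h). g \<otimes>\<^bsub>G\<^esub> h) \<and>
     continuous_on UNIV (\<lambda>g. inv\<^bsub>G\<^esub> g) \<and>
     (\<forall>a\<in>A. \<forall>b\<in>A. \<forall>c\<in>A.
        smooth_on (E \<times> E)
          {(chart_map a g, chart_map b h) | g h.
             g \<in> chart_dom a \<and> h \<in> chart_dom b \<and> g \<otimes>\<^bsub>G\<^esub> h \<in> chart_dom c}
          (\<lambda>(x, y). chart_map c (chart_inv a x \<otimes>\<^bsub>G\<^esub> chart_inv b y))) \<and>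
     (\<forall>a\<in>A. \<forall>b\<in>A.
        smooth_on E
          {chart_map a g | g. g \<in> chart_dom a \<and> inv\<^bsub>G\<^esub> g \<in> chart_dom b}
          (\<lambda>x. chart_map b (inv\<^bsub>G\<^esub> (chart_inv a x))))"

text \<open>
  From here on \<open>c\<close> is a chart around the unit of \<open>G\<close>; its differential identifies the Lie algebra of
  \<open>G\<close>, i.e. the tangent space at the unit, with the model space \<open>E\<close>. The adjoint action is the
  derivative of conjugation at the unit.
\<close>

definition Ad ::
  "('k::t2_space) monoid \<Rightarrow> 'e::euclidean_space set \<Rightarrow> ('k, 'e) chart \<Rightarrow> 'k \<Rightarrow> 'e \<Rightarrow> 'e"
where
  "Ad G E c g =
     frechet_derivative (\<lambda>x. chart_map c (g \<otimes>\<^bsub>G\<^esub> chart_inv c x \<otimes>\<^bsub>G\<^esub> inv\<^bsub>G\<^esub> g))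
       (at (chart_map c \<one>\<^bsub>G\<^esub>) within E)"

text \<open>\<open>one_param G c X \<gamma>\<close>: \<open>\<gamma>\<close> is the one-parameter subgroup \<open>s \<mapsto> exp (s X)\<close>.\<close>

definition one_param ::
  "('k::t2_space) monoid \<Rightarrow> ('k, 'e::euclidean_space) chart \<Rightarrow> 'e \<Rightarrow> (real \<Rightarrow> 'k) \<Rightarrow> bool"
where
  "one_param G c X \<gamma> \<longleftrightarrow>
     continuous_on UNIV \<gamma> \<and> (\<forall>s t. \<gamma> (s + t) = \<gamma> s \<otimes>\<^bsub>G\<^esub> \<gamma> t) \<and>
     ((\<lambda>s. chart_map c (\<gamma> s)) has_vector_derivative X) (at 0)"

text \<open>
  Compact subgroups of a Hausdorff group are closed, so for a Lie group the following are precisely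
  the compact connected abelian Lie subgroups.
\<close>

definition torus_in :: "('k::t2_space) monoid \<Rightarrow> 'k set \<Rightarrow> bool"
where
  "torus_in G T \<longleftrightarrow>
     subgroup T G \<and> compact T \<and> connected T \<and>
     (\<forall>g\<in>T. \<forall>h\<in>T. g \<otimes>\<^bsub>G\<^esub> h = h \<otimes>\<^bsub>G\<^esub> g)"

definition maximal_torus :: "('k::t2_space) monoid \<Rightarrow> 'k set \<Rightarrow> bool"
where
  "maximal_torus G T \<longleftrightarrow> torus_in G T \<and> (\<forall>T'. torus_in G T' \<and> T \<subseteq> T' \<longrightarrow> T' = T)"


section \<open>Invariant inner product, roots\<close>

text \<open>
  The inner product \<open>B\<close> identifies the Lie algebra with its dual. Hence elements of the dual
  (weights and roots) are vectors of \<open>E\<close>, and the pairing of \<open>\<xi>\<close> with \<open>X\<close> is \<open>B \<xi> X\<close>.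
\<close>

definition invariant_inner_product ::
  "('k::t2_space) monoid \<Rightarrow> 'e::euclidean_space set \<Rightarrow> ('k, 'e) chart \<Rightarrow> ('e \<Rightarrow> 'e \<Rightarrow> real) \<Rightarrow> bool"
where
  "invariant_inner_product G E c B \<longleftrightarrow>
     bilinear B \<and> (\<forall>X Y. B X Y = B Y X) \<and> (\<forall>X. X \<noteq> 0 \<longrightarrow> B X X > 0) \<and>
     (\<forall>g. \<forall>X\<in>E. \<forall>Y\<in>E. B (Ad G E c g X) (Ad G E c g Y) = B X Y)"

definition norm_wrt :: "('e \<Rightarrow> 'e \<Rightarrow> real) \<Rightarrow> 'e \<Rightarrow> real"
  where "norm_wrt B X = sqrt (B X X)"

text \<open>The dual of the Lie algebra of \<open>T\<close>, embedded as the \<open>T\<close>-invariant elements.\<close>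

definition torus_dual ::
  "('k::t2_space) monoid \<Rightarrow> 'e::euclidean_space set \<Rightarrow> ('k, 'e) chart \<Rightarrow> 'k set \<Rightarrow> 'e set"
where "torus_dual G E c T = {\<xi>\<in>E. \<forall>s\<in>T. Ad G E c s \<xi> = \<xi>}"

text \<open>
  A pair \<open>(U, V)\<close> stands for the vector \<open>Z = U + i V\<close> of the complexified Lie algebra. The condition
  says that \<open>T\<close> acts on \<open>Z\<close> through the character \<open>exp X \<mapsto> e\<^bsup>i\<langle>\<alpha>,X\<rangle>\<^esup>\<close>, for \<open>X\<close> in the Lie algebra of
  \<open>T\<close> (the velocities of the one-parameter subgroups contained in \<open>T\<close>).
\<close>

definition roots ::
  "('k::t2_space) monoid \<Rightarrow> 'e::euclidean_space set \<Rightarrow> ('k, 'e) chart \<Rightarrow> ('e \<Rightarrow> 'e \<Rightarrow> real)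
    \<Rightarrow> 'k set \<Rightarrow> 'e set"
where
  "roots G E c B T =
     {\<alpha> \<in> torus_dual G E c T. \<alpha> \<noteq> 0 \<and>
       (\<exists>U\<in>E. \<exists>V\<in>E. (U, V) \<noteq> (0, 0) \<and>
         (\<forall>X \<gamma>. one_param G c X \<gamma> \<and> range \<gamma> \<subseteq> T \<longrightarrow>
            Ad G E c (\<gamma> 1) U = cos (B \<alpha> X) *\<^sub>R U - sin (B \<alpha> X) *\<^sub>R V \<and>
            Ad G E c (\<gamma> 1) V = sin (B \<alpha> X) *\<^sub>R U + cos (B \<alpha> X) *\<^sub>R V))}"

text \<open>\<open>\<t>\<close> is the ambient dual space of the torus, \<open>\<Delta>\<close> the roots, \<open>P\<close> the positive roots.\<close>

definition positive_system ::
  "('e::euclidean_space \<Rightarrow> 'e \<Rightarrow> real) \<Rightarrow> 'e set \<Rightarrow> 'e set \<Rightarrow> 'e set \<Rightarrow> bool"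
where
  "positive_system B \<t> \<Delta> P \<longleftrightarrow>
     (\<exists>\<zeta>\<in>\<t>. (\<forall>\<alpha>\<in>\<Delta>. B \<alpha> \<zeta> \<noteq> 0) \<and> P = {\<alpha>\<in>\<Delta>. B \<alpha> \<zeta> > 0})"

definition coroot :: "('e::euclidean_space \<Rightarrow> 'e \<Rightarrow> real) \<Rightarrow> 'e \<Rightarrow> 'e"
  where "coroot B \<alpha> = (2 / B \<alpha> \<alpha>) *\<^sub>R \<alpha>"

definition weyl_chamber ::
  "('e::euclidean_space \<Rightarrow> 'e \<Rightarrow> real) \<Rightarrow> 'e set \<Rightarrow> 'e set \<Rightarrow> 'e set"
where "weyl_chamber B \<t> P = {\<xi>\<in>\<t>. \<forall>\<alpha>\<in>P. B \<xi> (coroot B \<alpha>) \<ge> 0}"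

definition strata ::
  "('e::euclidean_space \<Rightarrow> 'e \<Rightarrow> real) \<Rightarrow> 'e set \<Rightarrow> 'e set \<Rightarrow> 'e set set"
where
  "strata B \<t> P = {rel_interior F | F. F face_of weyl_chamber B \<t> P \<and> F \<noteq> {}}"

definition rhoK :: "'e::euclidean_space set \<Rightarrow> 'e"
  where "rhoK P = (1/2) *\<^sub>R (\<Sum>\<alpha>\<in>P. \<alpha>)"

text \<open>The \<open>\<rho>\<close>-elements of the stabilizers of a point \<open>\<mu>\<close> and of a stratum \<open>\<sigma>\<close>.\<close>

definition rhoK_point ::
  "('e::euclidean_space \<Rightarrow> 'e \<Rightarrow> real) \<Rightarrow> 'e set \<Rightarrow> 'e \<Rightarrow> 'e"
where "rhoK_point B P \<mu> = (1/2) *\<^sub>R (\<Sum>\<alpha>\<in>{\<alpha>\<in>P. B \<alpha> \<mu> = 0}. \<alpha>)"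

definition rhoK_stratum ::
  "('e::euclidean_space \<Rightarrow> 'e \<Rightarrow> real) \<Rightarrow> 'e set \<Rightarrow> 'e set \<Rightarrow> 'e"
where "rhoK_stratum B P \<sigma> = (1/2) *\<^sub>R (\<Sum>\<alpha>\<in>{\<alpha>\<in>P. \<forall>\<xi>\<in>\<sigma>. B \<alpha> \<xi> = 0}. \<alpha>)"

text \<open>Unlike the preceding ones, this sum ranges over all roots.\<close>

definition rho_at ::
  "('e::euclidean_space \<Rightarrow> 'e \<Rightarrow> real) \<Rightarrow> 'e set \<Rightarrow> 'e \<Rightarrow> 'e"
where "rho_at B \<Delta> \<mu> = (1/2) *\<^sub>R (\<Sum>\<alpha>\<in>{\<alpha>\<in>\<Delta>. B \<alpha> \<mu> > 0}. \<alpha>)"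

text \<open>
  The equality case of the inequalities
  \<open>\<parallel>\<lambda> - \<mu>\<parallel>\<^sup>2 \<ge> (1/2) (\<Sum>\<alpha>\<in>P, (\<alpha>,\<mu>) = 0. (\<lambda>,\<alpha>)) \<ge> \<parallel>\<rho>\<parallel>\<^sup>2\<close>, with \<open>\<rho>\<close> the element for the stabilizer of \<open>\<mu>\<close>,
  assumes that \<open>\<parallel>\<lambda> - \<mu>\<parallel>\<^sup>2\<close> equals the middle or the last term. Equality of the last two terms
  alone does not determine \<open>\<lambda>\<close> or make \<open>\<mu>\<close> dominant: if \<open>\<mu>\<close> is regular, both are \<open>0\<close> for every
  \<open>\<lambda>\<close>.
\<close>

end

theory Submission
  imports Defs
begin

text \<open>
  Let \<open>r\<close> be half the sum of the positive roots orthogonal to \<open>\<mu>\<close>. The middle term is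
  \<open>(\<lambda>, r) = (\<lambda> - \<mu>, r)\<close>, so (i) follows from (ii) by Cauchy--Schwarz, with equality only for \<open>\<lambda> - \<mu> = r\<close>.
  For (ii), \<open>\<rho> - r\<close> is half the sum of the positive roots off the wall of \<open>\<mu>\<close>; under the reflection in a
  positive root \<open>\<beta>\<close> orthogonal to \<open>\<mu>\<close> these are permuted up to sign, and those which become negative
  pair positively with \<open>\<beta>\<close>. Hence only finiteness and reflection invariance of the root system are
  needed, not integrality, reducedness or simple roots.

  Finiteness holds because root vectors for distinct roots are orthogonal, \<open>T\<close> containing the
  one-parameter subgroup of every vector of \<open>\<t>\<close> by maximality. For the reflection in \<open>\<alpha>\<close>, a
  root vector \<open>U + i V\<close> that is a joint eigenvector of \<open>T\<close> satisfies \<open>[U, V] \<in> \<real> \<alpha>\<close>, and the one-parameter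
  subgroup of \<open>U\<close> contains an element acting on \<open>\<t>\<close> as the reflection. One-parameter subgroups come
  from Picard's theorem in a chart; the bracket is the derivative of \<open>Ad\<close> at the unit.
\<close>

section \<open>Reflection-stable sets of vectors\<close>

text \<open>In the equality case every term of the sum over the wall vanishes separately, so the
  positive roots off the wall are stable under the reflections in the wall. Then
  \<open>rhoK P - r\<close> is itself dominant, and with \<open>lam = rhoK P + \<xi>\<close> so is
  \<open>\<mu> = \<xi> + (rhoK P - r)\<close>. On the group side the obstacle is that
  \<open>Ad\<close> is only a pointwise derivative, with no regularity in the group element built
  in. That regularity is extracted from the smooth group law, and invariance of \<open>B\<close>
  supplies the a priori bound for it. A second obstacle is that a root is defined through
  exponentials in \<open>T\<close>, while \<open>\<t>\<close> is defined through all of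
  \<open>T\<close>: to place \<open>[U, V]\<close> in \<open>\<t>\<close>, the action of every
  element of \<open>T\<close> on \<open>U\<close> and \<open>V\<close> must be known, which is why a
  joint eigenvector has to be produced.\<close>

locale inner_form =
  fixes B :: "'e::euclidean_space \<Rightarrow> 'e \<Rightarrow> real"
  assumes bilinear: "bilinear B"
    and sym: "B x y = B y x"
    and pos: "x \<noteq> 0 \<Longrightarrow> B x x > 0"
begin

sublocale bounded_bilinear B
  using bilinear by (simp add: bilinear_conv_bounded_bilinear)

lemmas form_simps = add_left add_right diff_left diff_right minus_left minus_right
  scaleR_left scaleR_right zero_left zero_right

lemma nonneg: "B x x \<ge> 0"
  using pos[of x] by (cases "x = 0") (auto simp: zero_left)

lemma eq_0_iff [simp]: "B x x = 0 \<longleftrightarrow> x = 0"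
  using pos[of x] by (metis less_irrefl zero_left)

lemma norm_wrt_power2: "(norm_wrt B x)\<^sup>2 = B x x"
  by (simp add: norm_wrt_def nonneg)

definition reflect :: "'e \<Rightarrow> 'e \<Rightarrow> 'e"
  where "reflect \<alpha> x = x - (2 * B x \<alpha> / B \<alpha> \<alpha>) *\<^sub>R \<alpha>"

lemma reflect_form: "\<alpha> \<noteq> 0 \<Longrightarrow> B (reflect \<alpha> x) \<alpha> = - B x \<alpha>"
  by (simp add: reflect_def form_simps)

lemma reflect_reflect: "\<alpha> \<noteq> 0 \<Longrightarrow> reflect \<alpha> (reflect \<alpha> x) = x"
  unfolding reflect_def[of \<alpha> "reflect \<alpha> x"] reflect_form by (simp add: reflect_def)

lemma reflect_self: "\<alpha> \<noteq> 0 \<Longrightarrow> reflect \<alpha> \<alpha> = - \<alpha>"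
  by (simp add: reflect_def) (simp add: scaleR_2)

lemma reflect_add: "reflect \<alpha> (x + y) = reflect \<alpha> x + reflect \<alpha> y"
  by (simp add: reflect_def form_simps add_divide_distrib algebra_simps)

lemma reflect_scaleR: "reflect \<alpha> (k *\<^sub>R x) = k *\<^sub>R reflect \<alpha> x"
  by (simp add: reflect_def form_simps algebra_simps)

text \<open>The elements of \<open>N\<close> that stay in \<open>N\<close> under the reflection cancel in pairs.\<close>

lemma sum_reflect_cancel:
  assumes "finite N" and "\<beta> \<noteq> 0"
  shows "(\<Sum>\<gamma>\<in>N. B \<gamma> \<beta>) = (\<Sum>\<gamma>\<in>{\<gamma>\<in>N. reflect \<beta> \<gamma> \<notin> N}. B \<gamma> \<beta>)"
proof -
  let ?M = "{\<gamma>\<in>N. reflect \<beta> \<gamma> \<in> N}"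
  have "(\<Sum>\<gamma>\<in>?M. B \<gamma> \<beta>) = (\<Sum>\<gamma>\<in>?M. B (reflect \<beta> \<gamma>) \<beta>)"
    by (rule sum.reindex_bij_witness[of _ "reflect \<beta>" "reflect \<beta>"])
      (auto simp: reflect_reflect assms)
  also have "\<dots> = - (\<Sum>\<gamma>\<in>?M. B \<gamma> \<beta>)"
    by (simp add: reflect_form assms sum_negf)
  finally have M: "(\<Sum>\<gamma>\<in>?M. B \<gamma> \<beta>) = 0"
    by simp
  have "N = ?M \<union> {\<gamma>\<in>N. reflect \<beta> \<gamma> \<notin> N}"
    by auto
  then have "(\<Sum>\<gamma>\<in>N. B \<gamma> \<beta>) = (\<Sum>\<gamma>\<in>?M \<union> {\<gamma>\<in>N. reflect \<beta> \<gamma> \<notin> N}. B \<gamma> \<beta>)"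
    by simp
  also have "\<dots> = (\<Sum>\<gamma>\<in>?M. B \<gamma> \<beta>) + (\<Sum>\<gamma>\<in>{\<gamma>\<in>N. reflect \<beta> \<gamma> \<notin> N}. B \<gamma> \<beta>)"
    using assms by (intro sum.union_disjoint) auto
  finally show ?thesis
    using M by simp
qed

lemma sum_reflect_nonneg:
  assumes "finite N" and "\<beta> \<noteq> 0"
    and "\<And>\<gamma>. \<gamma> \<in> N \<Longrightarrow> reflect \<beta> \<gamma> \<notin> N \<Longrightarrow> B \<gamma> \<beta> \<ge> 0"
  shows "(\<Sum>\<gamma>\<in>N. B \<gamma> \<beta>) \<ge> 0"
  unfolding sum_reflect_cancel[OF assms(1,2)] by (rule sum_nonneg) (use assms in auto)

text \<open>Only the terms that leave \<open>N\<close> survive the cancellation, and each is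
  strictly positive, so a vanishing sum has none of them.\<close>

lemma sum_reflect_eq_0D:
  assumes "finite N" and "\<beta> \<noteq> 0"
    and "\<And>\<gamma>. \<gamma> \<in> N \<Longrightarrow> reflect \<beta> \<gamma> \<notin> N \<Longrightarrow> B \<gamma> \<beta> > 0"
    and "(\<Sum>\<gamma>\<in>N. B \<gamma> \<beta>) = 0" and "\<gamma> \<in> N"
  shows "reflect \<beta> \<gamma> \<in> N"
proof (rule ccontr)
  assume *: "reflect \<beta> \<gamma> \<notin> N"
  have "(\<Sum>\<gamma>\<in>{\<gamma>\<in>N. reflect \<beta> \<gamma> \<notin> N}. B \<gamma> \<beta>) > 0"
  proof (rule sum_pos2[of _ \<gamma>])
    show "B x \<beta> \<ge> 0" if "x \<in> {\<gamma>\<in>N. reflect \<beta> \<gamma> \<notin> N}" for x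
      using assms(3)[of x] that by simp
  qed (use assms(1,5) assms(3)[OF assms(5) *] * in auto)
  with assms(4) sum_reflect_cancel[OF assms(1,2)] show False
    by simp
qed

end

section \<open>Positive systems and positivity of rho\<close>

locale reflection_system = inner_form B
  for B :: "'e::euclidean_space \<Rightarrow> 'e \<Rightarrow> real" +
  fixes \<t> \<Delta> P :: "'e set"
    and \<zeta> :: 'e
  assumes subspace: "subspace \<t>"
    and roots_sub: "\<Delta> \<subseteq> \<t>"
    and finite: "finite \<Delta>"
    and nonzero: "\<alpha> \<in> \<Delta> \<Longrightarrow> \<alpha> \<noteq> 0"
    and uminus: "\<alpha> \<in> \<Delta> \<Longrightarrow> - \<alpha> \<in> \<Delta>"
    and reflect: "\<alpha> \<in> \<Delta> \<Longrightarrow> \<beta> \<in> \<Delta> \<Longrightarrow> reflect \<alpha> \<beta> \<in> \<Delta>"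
    and zeta_nonzero: "\<alpha> \<in> \<Delta> \<Longrightarrow> B \<alpha> \<zeta> \<noteq> 0"
    and P_eq: "P = {\<alpha>\<in>\<Delta>. B \<alpha> \<zeta> > 0}"
begin

lemma finite_P: "finite P"
  using finite by (simp add: P_eq)

lemma P_D: "\<alpha> \<in> P \<Longrightarrow> \<alpha> \<in> \<Delta>" "\<alpha> \<in> P \<Longrightarrow> B \<alpha> \<zeta> > 0" "\<alpha> \<in> P \<Longrightarrow> \<alpha> \<noteq> 0"
  using nonzero by (auto simp: P_eq)

lemma not_P: "\<alpha> \<in> \<Delta> \<Longrightarrow> \<alpha> \<notin> P \<Longrightarrow> B \<alpha> \<zeta> < 0"
  using zeta_nonzero[of \<alpha>] by (auto simp: P_eq)

lemma P_or_uminus: "\<alpha> \<in> \<Delta> \<Longrightarrow> \<alpha> \<in> P \<or> - \<alpha> \<in> P"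
  using zeta_nonzero[of \<alpha>] uminus by (auto simp: P_eq form_simps)

lemma weyl_chamber_iff: "\<xi> \<in> weyl_chamber B \<t> P \<longleftrightarrow> \<xi> \<in> \<t> \<and> (\<forall>\<alpha>\<in>P. B \<xi> \<alpha> \<ge> 0)"
proof -
  have "B \<xi> (coroot B \<alpha>) \<ge> 0 \<longleftrightarrow> B \<xi> \<alpha> \<ge> 0" if "\<alpha> \<in> P" for \<alpha>
    using pos[OF P_D(3)[OF that]] by (simp add: coroot_def form_simps zero_le_divide_iff)
  then show ?thesis
    by (simp add: weyl_chamber_def)
qed

text \<open>Were the pairing nonpositive, the reflection would add a nonnegative multiple of
  \<open>\<beta>\<close> to \<open>\<gamma>\<close>, and the value on \<open>\<zeta>\<close> would
  stay positive.\<close>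

lemma reflect_negative:
  assumes "\<gamma> \<in> P" "\<beta> \<in> P" "reflect \<beta> \<gamma> \<notin> P"
  shows "B \<gamma> \<beta> > 0"
proof (rule ccontr)
  assume "\<not> B \<gamma> \<beta> > 0"
  moreover have "B \<beta> \<beta> > 0" "B \<beta> \<zeta> > 0" "B \<gamma> \<zeta> > 0"
    using assms P_D pos by auto
  ultimately have "2 * B \<gamma> \<beta> / B \<beta> \<beta> * B \<beta> \<zeta> \<le> 0"
    by (intro mult_nonpos_nonneg) (auto simp: divide_le_0_iff)
  moreover have "B (reflect \<beta> \<gamma>) \<zeta> = B \<gamma> \<zeta> - 2 * B \<gamma> \<beta> / B \<beta> \<beta> * B \<beta> \<zeta>"
    by (simp add: reflect_def form_simps)
  moreover have "B (reflect \<beta> \<gamma>) \<zeta> < 0"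
    using assms P_D reflect by (intro not_P) auto
  ultimately show False
    using \<open>B \<gamma> \<zeta> > 0\<close> by linarith
qed

text \<open>The reflection in \<open>\<alpha>\<close> takes \<open>\<alpha>\<close> itself out of
  \<open>P\<close>, so the uncancelled part of the sum is not empty. This strict positivity later
  makes \<open>lam\<close> regular and determines \<open>rho_at B \<Delta> lam\<close>.\<close>

lemma rhoK_pos:
  assumes "\<alpha> \<in> P"
  shows "B (rhoK P) \<alpha> > 0"
proof -
  have ge: "(\<Sum>\<gamma>\<in>P. B \<gamma> \<alpha>) \<ge> 0"
    using assms reflect_negative[THEN less_imp_le] P_D
    by (intro sum_reflect_nonneg) (auto simp: finite_P)
  have "(\<Sum>\<gamma>\<in>P. B \<gamma> \<alpha>) \<noteq> 0"
  proof
    assume "(\<Sum>\<gamma>\<in>P. B \<gamma> \<alpha>) = 0"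
    then have "reflect \<alpha> \<alpha> \<in> P"
      using assms reflect_negative P_D finite_P by (intro sum_reflect_eq_0D) auto
    then show False
      using assms P_D(2)[of \<alpha>] P_D(2)[of "- \<alpha>"] P_D(3) by (simp add: reflect_self form_simps)
  qed
  with ge show ?thesis
    by (simp add: rhoK_def form_simps sum_left)
qed

section \<open>Positive roots on and off the wall of a point\<close>

context
  fixes \<mu> :: 'e
begin

text \<open>These are the positive roots of the stabilizer of \<open>\<mu>\<close>.\<close>

definition wall :: "'e set"
  where "wall = {\<alpha>\<in>P. B \<alpha> \<mu> = 0}"

definition off_wall :: "'e set"
  where "off_wall = {\<alpha>\<in>P. B \<alpha> \<mu> \<noteq> 0}"

lemma finite_wall: "finite wall" "finite off_wall"
  using finite_P by (auto simp: wall_def off_wall_def)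

lemma wall_D: "\<beta> \<in> wall \<Longrightarrow> \<beta> \<in> P" "\<beta> \<in> wall \<Longrightarrow> B \<beta> \<mu> = 0" "\<beta> \<in> wall \<Longrightarrow> \<beta> \<noteq> 0"
  using P_D by (auto simp: wall_def)

text \<open>A reflection in \<open>wall\<close> preserves the pairing with \<open>\<mu>\<close>, so
  a root can leave \<open>off_wall\<close> only by becoming negative.\<close>

lemma reflect_off_wall:
  assumes "\<beta> \<in> wall" "\<gamma> \<in> off_wall" "reflect \<beta> \<gamma> \<notin> off_wall"
  shows "B \<gamma> \<beta> > 0"
proof -
  have "B (reflect \<beta> \<gamma>) \<mu> = B \<gamma> \<mu>"
    using assms by (simp add: reflect_def form_simps wall_def)
  then show ?thesis
    using assms reflect_negative by (auto simp: wall_def off_wall_def)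
qed

lemma rhoK_point_eq: "rhoK_point B P \<mu> = (1/2) *\<^sub>R (\<Sum>\<alpha>\<in>wall. \<alpha>)"
  by (simp add: rhoK_point_def wall_def)

lemma rhoK_minus_rhoK_point: "rhoK P - rhoK_point B P \<mu> = (1/2) *\<^sub>R (\<Sum>\<alpha>\<in>off_wall. \<alpha>)"
proof -
  have "wall \<union> off_wall = P" "wall \<inter> off_wall = {}"
    by (auto simp: wall_def off_wall_def)
  then have "(\<Sum>\<alpha>\<in>P. \<alpha>) = (\<Sum>\<alpha>\<in>wall. \<alpha>) + (\<Sum>\<alpha>\<in>off_wall. \<alpha>)"
    using sum.union_disjoint[OF finite_wall, of "\<lambda>\<alpha>. \<alpha>"] by simp
  then show ?thesis
    by (simp add: rhoK_def rhoK_point_eq algebra_simps flip: scaleR_right_diff_distrib)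
qed

lemma off_wall_nonneg: "\<beta> \<in> wall \<Longrightarrow> (\<Sum>\<gamma>\<in>off_wall. B \<gamma> \<beta>) \<ge> 0"
  using reflect_off_wall[THEN less_imp_le] wall_D finite_wall
  by (intro sum_reflect_nonneg) auto

text \<open>
  If \<open>off_wall\<close> is stable under the reflections in \<open>wall\<close>, then no \<open>\<gamma> + k \<alpha>\<close> with \<open>k \<ge> 0\<close> and
  \<open>\<alpha>, \<gamma>\<close> in \<open>off_wall\<close> lies on the wall: its reflection in itself would be a negative root and a
  nonnegative combination of positive ones.
\<close>

lemma off_wall_dominant:
  assumes stable: "\<And>\<beta> \<gamma>. \<beta> \<in> wall \<Longrightarrow> \<gamma> \<in> off_wall \<Longrightarrow> reflect \<beta> \<gamma> \<in> off_wall"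
    and "\<alpha> \<in> off_wall"
  shows "(\<Sum>\<gamma>\<in>off_wall. B \<gamma> \<alpha>) \<ge> 0"
proof (rule sum_reflect_nonneg)
  show "\<alpha> \<noteq> 0" "finite off_wall"
    using assms P_D finite_wall by (auto simp: off_wall_def)
  fix \<gamma>
  assume \<gamma>: "\<gamma> \<in> off_wall" and n: "reflect \<alpha> \<gamma> \<notin> off_wall"
  show "B \<gamma> \<alpha> \<ge> 0"
  proof (cases "reflect \<alpha> \<gamma> \<in> P")
    case False
    then show ?thesis
      using reflect_negative[of \<gamma> \<alpha>] \<gamma> assms by (auto simp: off_wall_def)
  next
    case True
    then have \<delta>: "reflect \<alpha> \<gamma> \<in> wall" (is "?\<delta> \<in> _")
      using n by (auto simp: wall_def off_wall_def)
    show ?thesis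
    proof (rule ccontr)
      assume neg: "\<not> B \<gamma> \<alpha> \<ge> 0"
      define k where "k = - (2 * B \<gamma> \<alpha> / B \<alpha> \<alpha>)"
      have "k \<ge> 0"
        using neg nonneg[of \<alpha>] by (simp add: k_def divide_nonpos_nonneg)
      have "?\<delta> = \<gamma> + k *\<^sub>R \<alpha>"
        by (simp add: k_def reflect_def)
      then have "reflect ?\<delta> ?\<delta> = reflect ?\<delta> \<gamma> + k *\<^sub>R reflect ?\<delta> \<alpha>"
        by (simp add: reflect_add reflect_scaleR)
      then have "- ?\<delta> = reflect ?\<delta> \<gamma> + k *\<^sub>R reflect ?\<delta> \<alpha>"
        using \<delta> wall_D by (simp add: reflect_self)
      then have "- B ?\<delta> \<zeta> = B (reflect ?\<delta> \<gamma>) \<zeta> + k * B (reflect ?\<delta> \<alpha>) \<zeta>"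
        using minus_left[of ?\<delta> \<zeta>] by (simp add: form_simps)
      moreover have "B ?\<delta> \<zeta> > 0" "B (reflect ?\<delta> \<gamma>) \<zeta> > 0" "B (reflect ?\<delta> \<alpha>) \<zeta> > 0"
        using \<delta> \<gamma> assms P_D wall_D by (auto simp: off_wall_def)
      ultimately show False
        using \<open>k \<ge> 0\<close> by (smt (verit) mult_nonneg_nonneg)
    qed
  qed
qed

lemma rhoK_off_wall: "B (rhoK P - rhoK_point B P \<mu>) x = (1/2) * (\<Sum>\<gamma>\<in>off_wall. B \<gamma> x)"
  by (simp add: rhoK_minus_rhoK_point form_simps sum_left)

lemma form_rhoK_point: "B x (rhoK_point B P \<mu>) = (1/2) * (\<Sum>\<beta>\<in>wall. B x \<beta>)"
  by (simp add: rhoK_point_eq form_simps sum_right)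

lemma form_mu_rhoK_point: "B \<mu> (rhoK_point B P \<mu>) = 0"
  unfolding form_rhoK_point using sym by (simp add: wall_def)

end

text \<open>The face is cut out of the chamber by the roots in \<open>wall \<mu>\<close>. Uniqueness
  holds because faces whose relative interiors meet coincide.\<close>

lemma mem_strata:
  assumes "\<mu> \<in> weyl_chamber B \<t> P"
  shows "\<exists>!\<sigma>. \<sigma> \<in> strata B \<t> P \<and> \<mu> \<in> \<sigma>"
proof -
  let ?W = "weyl_chamber B \<t> P"
  have cW: "convex ?W"
    using subspace
    by (auto simp: convex_def weyl_chamber_iff form_simps subspace_add subspace_scale)
  define F where "F = {\<xi> \<in> ?W. \<forall>\<alpha>\<in>wall \<mu>. B \<xi> \<alpha> = 0}"
  have cF: "convex F"
    using cW by (auto simp: convex_def F_def form_simps)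
  have \<mu>F: "\<mu> \<in> F"
    using assms sym by (auto simp: F_def wall_def)
  have face: "F face_of ?W"
    unfolding face_of_def
  proof (intro conjI ballI impI cF)
    show "F \<subseteq> ?W"
      by (auto simp: F_def)
    fix a b x
    assume a: "a \<in> ?W" and b: "b \<in> ?W" and x: "x \<in> F" and "x \<in> open_segment a b"
    then obtain u where u: "0 < u" "u < 1" "x = (1 - u) *\<^sub>R a + u *\<^sub>R b"
      by (auto simp: in_segment)
    have "B a \<alpha> = 0 \<and> B b \<alpha> = 0" if "\<alpha> \<in> wall \<mu>" for \<alpha>
    proof -
      have "(1 - u) * B a \<alpha> + u * B b \<alpha> = 0"
        using x that u by (simp add: F_def form_simps)
      moreover have "B a \<alpha> \<ge> 0" "B b \<alpha> \<ge> 0"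
        using a b that by (auto simp: weyl_chamber_iff wall_def)
      ultimately show ?thesis
        using u by (simp add: add_nonneg_eq_0_iff)
    qed
    then show "a \<in> F" "b \<in> F"
      using a b by (auto simp: F_def)
  qed
  have ri: "\<mu> \<in> rel_interior F"
  proof -
    \<comment> \<open>Criterion for the relative interior: every segment from \<open>x\<close> to
      \<open>\<mu>\<close> extends beyond \<open>\<mu>\<close> inside \<open>F\<close>. Roots on the
      wall vanish at both points; the finitely many others are positive at \<open>\<mu>\<close> and
      stay so for \<open>e\<close> slightly above 1.\<close>
    have "\<exists>e>1. (1 - e) *\<^sub>R x + e *\<^sub>R \<mu> \<in> F" if x: "x \<in> F" for x
    proof -
      have ev: "eventually (\<lambda>e. B ((1 - e) *\<^sub>R x + e *\<^sub>R \<mu>) \<alpha> \<ge> 0) (at_right 1)"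
        if "\<alpha> \<in> P" for \<alpha>
      proof (cases "\<alpha> \<in> wall \<mu>")
        case True
        then show ?thesis
          using x \<mu>F by (simp add: F_def form_simps)
      next
        case False
        then have "B \<mu> \<alpha> > 0"
          using that assms sym[of \<mu> \<alpha>] by (auto simp: weyl_chamber_iff wall_def less_le)
        moreover have "((\<lambda>e. (1 - e) * B x \<alpha> + e * B \<mu> \<alpha>)
            \<longlongrightarrow> (1 - 1) * B x \<alpha> + 1 * B \<mu> \<alpha>) (at_right 1)"
          by (intro tendsto_intros)
        ultimately have "eventually (\<lambda>e. (1 - e) * B x \<alpha> + e * B \<mu> \<alpha> > 0) (at_right 1)"
          by (intro order_tendstoD(1)) auto
        then show ?thesis
          by eventually_elim (simp add: form_simps)
      qed
      have "eventually (\<lambda>e. \<forall>\<alpha>\<in>P. B ((1 - e) *\<^sub>R x + e *\<^sub>R \<mu>) \<alpha> \<ge> 0) (at_right 1)"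
        using finite_P ev by (simp add: eventually_ball_finite)
      then have "eventually (\<lambda>e::real. e > 1 \<and> (\<forall>\<alpha>\<in>P. B ((1 - e) *\<^sub>R x + e *\<^sub>R \<mu>) \<alpha> \<ge> 0)) (at_right 1)"
        by (intro eventually_conj eventually_at_right_less)
      then obtain e :: real where e: "e > 1" "\<forall>\<alpha>\<in>P. B ((1 - e) *\<^sub>R x + e *\<^sub>R \<mu>) \<alpha> \<ge> 0"
        using eventually_happens trivial_limit_at_right_real by blast
      have "(1 - e) *\<^sub>R x + e *\<^sub>R \<mu> \<in> F"
        using x \<mu>F e subspace
        by (auto simp: F_def weyl_chamber_iff form_simps subspace_add subspace_scale)
      with e show ?thesis by auto
    qed
    then show ?thesis
      using convex_rel_interior_iff[OF cF] \<mu>F by auto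
  qed
  show ?thesis
  proof (rule ex1I)
    show "rel_interior F \<in> strata B \<t> P \<and> \<mu> \<in> rel_interior F"
      using face ri \<mu>F by (auto simp: strata_def)
  next
    fix \<sigma>
    assume \<sigma>: "\<sigma> \<in> strata B \<t> P \<and> \<mu> \<in> \<sigma>"
    then obtain F' where F': "\<sigma> = rel_interior F'" "F' face_of ?W"
      by (auto simp: strata_def)
    with \<sigma> ri have "rel_interior F' \<inter> rel_interior F \<noteq> {}"
      by auto
    then have "F' = F"
      by (rule face_of_eq[OF F'(2) face])
    with F' show "\<sigma> = rel_interior F"
      by simp
  qed
qed

text \<open>
  A positive root is nonnegative on a face; if it vanishes at a point of the relative interior,
  then it vanishes on the whole face.
\<close>

lemma rhoK_stratum_eq:
  assumes \<sigma>: "\<sigma> \<in> strata B \<t> P" "\<mu> \<in> \<sigma>"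
  shows "rhoK_stratum B P \<sigma> = rhoK_point B P \<mu>"
proof -
  obtain F where F: "\<sigma> = rel_interior F" "F face_of weyl_chamber B \<t> P"
    using \<sigma> by (auto simp: strata_def)
  then have cF: "convex F" and FW: "F \<subseteq> weyl_chamber B \<t> P"
    by (auto simp: face_of_def)
  have "B \<alpha> \<xi> = 0" if "\<alpha> \<in> P" "B \<alpha> \<mu> = 0" "\<xi> \<in> \<sigma>" for \<alpha> \<xi>
  proof -
    have \<xi>: "\<xi> \<in> F"
      using that F rel_interior_subset by blast
    then obtain e where e: "e > 1" "(1 - e) *\<^sub>R \<xi> + e *\<^sub>R \<mu> \<in> F"
      using convex_rel_interior_iff[OF cF] F \<sigma> by blast
    have "B \<xi> \<alpha> \<ge> 0" "B ((1 - e) *\<^sub>R \<xi> + e *\<^sub>R \<mu>) \<alpha> \<ge> 0"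
      using \<xi> e FW that by (auto simp: weyl_chamber_iff)
    \<comment> \<open>As \<open>1 - e\<close> is negative, the extension beyond \<open>\<mu>\<close>
      gives the opposite sign.\<close>
    then have "B \<xi> \<alpha> \<ge> 0" "(1 - e) * B \<xi> \<alpha> \<ge> 0"
      using that sym[of \<mu> \<alpha>] by (auto simp: form_simps)
    with e show ?thesis
      by (simp add: sym[of \<alpha>] zero_le_mult_iff)
  qed
  then have "{\<alpha>\<in>P. \<forall>\<xi>\<in>\<sigma>. B \<alpha> \<xi> = 0} = {\<alpha>\<in>P. B \<alpha> \<mu> = 0}"
    using \<sigma> by auto
  then show ?thesis
    by (simp add: rhoK_stratum_def rhoK_point_def)
qed

lemma norm_inequalities:
  assumes "lam \<in> (\<lambda>\<xi>. rhoK P + \<xi>) ` weyl_chamber B \<t> P"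
    and "\<mu> \<in> \<t>"
  shows
    "(norm_wrt B (lam - \<mu>))\<^sup>2 \<ge> (1/2) * (\<Sum>\<alpha>\<in>{\<alpha>\<in>P. B \<alpha> \<mu> = 0}. B lam \<alpha>) \<and>
     (1/2) * (\<Sum>\<alpha>\<in>{\<alpha>\<in>P. B \<alpha> \<mu> = 0}. B lam \<alpha>) \<ge> (norm_wrt B (rhoK_point B P \<mu>))\<^sup>2 \<and>
     ((norm_wrt B (lam - \<mu>))\<^sup>2 = (1/2) * (\<Sum>\<alpha>\<in>{\<alpha>\<in>P. B \<alpha> \<mu> = 0}. B lam \<alpha>) \<or>
      (norm_wrt B (lam - \<mu>))\<^sup>2 = (norm_wrt B (rhoK_point B P \<mu>))\<^sup>2
      \<longrightarrow>
        \<mu> \<in> weyl_chamber B \<t> P \<and>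
        (\<exists>!\<sigma>. \<sigma> \<in> strata B \<t> P \<and> \<mu> \<in> \<sigma>) \<and>
        (\<forall>\<sigma>\<in>strata B \<t> P. \<mu> \<in> \<sigma> \<longrightarrow> lam = \<mu> + rhoK_stratum B P \<sigma>) \<and>
        (norm_wrt B (lam - \<mu>))\<^sup>2 = (1/2) * (\<Sum>\<alpha>\<in>{\<alpha>\<in>P. B \<alpha> \<mu> = 0}. B lam \<alpha>) \<and>
        (1/2) * (\<Sum>\<alpha>\<in>{\<alpha>\<in>P. B \<alpha> \<mu> = 0}. B lam \<alpha>) = (norm_wrt B (rhoK_point B P \<mu>))\<^sup>2 \<and>
        lam - rho_at B \<Delta> lam = \<mu> - rho_at B \<Delta> \<mu>)"
proof -
  define r where "r = rhoK_point B P \<mu>"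
  define a where "a = B (lam - \<mu>) (lam - \<mu>)"
  obtain \<xi> where lam: "lam = rhoK P + \<xi>" and \<xi>: "\<xi> \<in> weyl_chamber B \<t> P"
    using assms by auto
  have m: "(1/2) * (\<Sum>\<alpha>\<in>{\<alpha>\<in>P. B \<alpha> \<mu> = 0}. B lam \<alpha>) = B lam r"
    by (simp add: r_def form_rhoK_point wall_def)
  have m': "B (lam - \<mu>) r = B lam r"
    using form_mu_rhoK_point by (simp add: r_def form_simps)
  have off: "B (rhoK P - r) \<beta> \<ge> 0" if "\<beta> \<in> wall \<mu>" for \<beta>
    using off_wall_nonneg[OF that] by (simp add: r_def rhoK_off_wall)
  have \<xi>\<beta>: "B \<xi> \<beta> \<ge> 0" if "\<beta> \<in> wall \<mu>" for \<beta>
    using \<xi> that by (auto simp: weyl_chamber_iff wall_def)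
  \<comment> \<open>The gap in (ii) is split root by root into nonnegative terms, so that equality
    will force each of them to vanish.\<close>
  have diff: "B lam r - B r r = (1/2) * (\<Sum>\<beta>\<in>wall \<mu>. B \<xi> \<beta> + B (rhoK P - r) \<beta>)"
  proof -
    have "B lam r - B r r = B \<xi> r + B (rhoK P - r) r"
      by (simp add: lam form_simps)
    also have "\<dots> = (1/2) * (\<Sum>\<beta>\<in>wall \<mu>. B \<xi> \<beta>) + (1/2) * (\<Sum>\<beta>\<in>wall \<mu>. B (rhoK P - r) \<beta>)"
      unfolding r_def form_rhoK_point ..
    finally show ?thesis
      by (simp add: sum.distrib)
  qed
  have ii: "B r r \<le> B lam r"
    using diff sum_nonneg[of "wall \<mu>" "\<lambda>\<beta>. B \<xi> \<beta> + B (rhoK P - r) \<beta>"] off \<xi>\<beta> by force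
  \<comment> \<open>Since this square is nonnegative, \<open>a \<ge> 2 * B lam r - B r r\<close>,
    and by (ii) the right side is at least \<open>B lam r\<close>.\<close>
  have dist: "B (lam - \<mu> - r) (lam - \<mu> - r) = a - 2 * B lam r + B r r"
    unfolding a_def m'[symmetric] by (simp add: form_simps sym)
  have i: "B lam r \<le> a"
    using dist ii nonneg[of "lam - \<mu> - r"] by linarith
  have iii: "\<mu> \<in> weyl_chamber B \<t> P \<and> lam = \<mu> + r \<and> a = B lam r \<and> B lam r = B r r \<and>
      lam - rho_at B \<Delta> lam = \<mu> - rho_at B \<Delta> \<mu>"
    if "a = B lam r \<or> a = B r r"
  proof -
    \<comment> \<open>If \<open>a = B lam r\<close>, the square equals
      \<open>B r r - B lam r\<close>, which (ii) makes nonpositive. If \<open>a = B r r\<close>, the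
      chain \<open>a \<ge> B lam r \<ge> B r r\<close> collapses and the square is 0.\<close>
    have "B (lam - \<mu> - r) (lam - \<mu> - r) \<le> 0"
      using that dist ii i by auto
    then have "lam - \<mu> - r = 0"
      using nonneg[of "lam - \<mu> - r"] by (metis eq_0_iff order_antisym)
    then have lam': "lam = \<mu> + r"
      by (simp add: algebra_simps)
    then have a: "a = B r r"
      by (simp add: a_def)
    with ii i have eq: "B lam r = B r r"
      by simp
    have "(\<Sum>\<beta>\<in>wall \<mu>. B \<xi> \<beta> + B (rhoK P - r) \<beta>) = 0"
      using diff eq by simp
    then have "\<forall>\<beta>\<in>wall \<mu>. B \<xi> \<beta> + B (rhoK P - r) \<beta> = 0"
      using off \<xi>\<beta> finite_wall by (subst (asm) sum_nonneg_eq_0_iff) auto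
    then have "B (rhoK P - r) \<beta> = 0" if "\<beta> \<in> wall \<mu>" for \<beta>
      using off \<xi>\<beta> that by (smt (verit))
    then have "(\<Sum>\<gamma>\<in>off_wall \<mu>. B \<gamma> \<beta>) = 0" if "\<beta> \<in> wall \<mu>" for \<beta>
      using that rhoK_off_wall[of \<mu> \<beta>] by (simp add: r_def)
    then have stable: "reflect \<beta> \<gamma> \<in> off_wall \<mu>" if "\<beta> \<in> wall \<mu>" "\<gamma> \<in> off_wall \<mu>" for \<beta> \<gamma>
      using that reflect_off_wall wall_D finite_wall by (intro sum_reflect_eq_0D) auto
    \<comment> \<open>Both summands pair nonnegatively with the positive roots off the wall, the
      second one by the stability just shown.\<close>
    have \<mu>_eq: "\<mu> = \<xi> + (rhoK P - r)"
      using lam lam' by (simp add: algebra_simps)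
    have "B \<mu> \<alpha> \<ge> 0" if "\<alpha> \<in> P" for \<alpha>
    proof (cases "\<alpha> \<in> wall \<mu>")
      case True
      then show ?thesis
        using wall_D sym[of \<mu> \<alpha>] by simp
    next
      case False
      then have "\<alpha> \<in> off_wall \<mu>"
        using that by (auto simp: wall_def off_wall_def)
      then have "B (rhoK P - r) \<alpha> \<ge> 0"
        using off_wall_dominant[OF stable] by (simp add: r_def rhoK_off_wall)
      moreover have "B \<xi> \<alpha> \<ge> 0"
        using that \<xi> by (auto simp: weyl_chamber_iff)
      ultimately show ?thesis
        by (subst \<mu>_eq) (simp add: form_simps)
    qed
    then have dom: "\<mu> \<in> weyl_chamber B \<t> P"
      using assms by (auto simp: weyl_chamber_iff)
    have "B \<alpha> lam > 0" if "\<alpha> \<in> P" for \<alpha>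
      using rhoK_pos[OF that] \<xi> that
      by (simp add: lam form_simps weyl_chamber_iff sym[of \<alpha>] add_pos_nonneg)
    then have "B \<alpha> lam > 0 \<longleftrightarrow> \<alpha> \<in> P" if "\<alpha> \<in> \<Delta>" for \<alpha>
      using P_or_uminus[OF that] minus_left[of \<alpha> lam] by fastforce
    then have "{\<alpha>\<in>\<Delta>. B \<alpha> lam > 0} = P"
      using P_D(1) by blast
    then have lam_rho: "rho_at B \<Delta> lam = rhoK P"
      by (simp add: rho_at_def rhoK_def)
    have "{\<alpha>\<in>\<Delta>. B \<alpha> \<mu> > 0} = off_wall \<mu>"
    proof (rule Set.set_eqI, rule iffI)
      fix \<alpha>
      assume "\<alpha> \<in> {\<alpha>\<in>\<Delta>. B \<alpha> \<mu> > 0}"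
      then have \<alpha>: "\<alpha> \<in> \<Delta>" "B \<alpha> \<mu> > 0"
        by auto
      have "- \<alpha> \<notin> P"
        using \<alpha> dom sym[of \<mu> \<alpha>] by (force simp: weyl_chamber_iff form_simps)
      then show "\<alpha> \<in> off_wall \<mu>"
        using \<alpha> P_or_uminus by (auto simp: off_wall_def)
    next
      fix \<alpha>
      assume "\<alpha> \<in> off_wall \<mu>"
      then show "\<alpha> \<in> {\<alpha>\<in>\<Delta>. B \<alpha> \<mu> > 0}"
        using dom sym[of \<mu> \<alpha>] P_D by (auto simp: off_wall_def weyl_chamber_iff less_le)
    qed
    then have "rho_at B \<Delta> \<mu> = rhoK P - r"
      by (simp add: rho_at_def r_def rhoK_minus_rhoK_point)
    then show ?thesis
      using dom lam' a eq lam_rho by simp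
  qed
  show ?thesis
    unfolding m norm_wrt_power2 a_def[symmetric] r_def[symmetric]
    using i ii iii mem_strata[of \<mu>] rhoK_stratum_eq[of _ \<mu>] by (auto simp: r_def)
qed

end

section \<open>Ordinary differential equations\<close>

lemma has_vector_derivative_bound:
  fixes f :: "real \<Rightarrow> 'a::real_normed_vector"
  assumes "\<And>x. x \<in> {a..b} \<Longrightarrow> (f has_vector_derivative f' x) (at x within {a..b})"
    and "\<And>x. x \<in> {a..b} \<Longrightarrow> norm (f' x) \<le> M"
    and "s \<in> {a..b}" "t \<in> {a..b}"
  shows "norm (f s - f t) \<le> M * \<bar>s - t\<bar>"
proof -
  have "norm (f s - f t) \<le> M * norm (s - t)"
  proof (rule differentiable_bound[where S="{a..b}" and f'="\<lambda>x h. h *\<^sub>R f' x"])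
    fix x assume x: "x \<in> {a..b}"
    show "(f has_derivative (\<lambda>h. h *\<^sub>R f' x)) (at x within {a..b})"
      using assms(1)[OF x] by (simp add: has_vector_derivative_def)
    show "onorm (\<lambda>h. h *\<^sub>R f' x) \<le> M"
    proof (rule onorm_le)
      show "norm (h *\<^sub>R f' x) \<le> M * norm h" for h
        using mult_right_mono[OF assms(2)[OF x], of "\<bar>h\<bar>"] by (simp add: mult.commute)
    qed
  qed (use assms in auto)
  then show ?thesis
    by simp
qed

text \<open>Where \<open>norm (u t - v t)\<close> attains its maximum \<open>M\<close>, the mean
  value bound gives \<open>M \<le> L * M * (b - a)\<close>; on an interval this short,
  \<open>M\<close> must be 0.\<close>

lemma ode_unique:
  fixes u v :: "real \<Rightarrow> 'a::real_normed_vector"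
  assumes u: "\<And>t. t \<in> {a..b} \<Longrightarrow> (u has_vector_derivative F (u t)) (at t within {a..b})"
    and v: "\<And>t. t \<in> {a..b} \<Longrightarrow> (v has_vector_derivative F (v t)) (at t within {a..b})"
    and S: "\<And>t. t \<in> {a..b} \<Longrightarrow> u t \<in> S" "\<And>t. t \<in> {a..b} \<Longrightarrow> v t \<in> S"
    and F: "L-lipschitz_on S F"
    and eq: "u t0 = v t0" and t0: "t0 \<in> {a..b}"
    and small: "L * (b - a) < 1"
    and t: "t \<in> {a..b}"
  shows "u t = v t"
proof -
  have "continuous_on {a..b} u" "continuous_on {a..b} v"
    unfolding continuous_on_eq_continuous_within
    using has_vector_derivative_continuous u v by blast+
  then have "continuous_on {a..b} (\<lambda>t. norm (u t - v t))"
    by (intro continuous_intros)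
  then obtain s where s: "s \<in> {a..b}"
    and max: "\<And>t. t \<in> {a..b} \<Longrightarrow> norm (u t - v t) \<le> norm (u s - v s)"
    using continuous_attains_sup[of "{a..b}" "\<lambda>t. norm (u t - v t)"] t by (auto intro: compact_Icc)
  define M where "M = norm (u s - v s)"
  have L: "L \<ge> 0"
    using F lipschitz_on_nonneg by blast
  have "norm ((\<lambda>t. u t - v t) s - (\<lambda>t. u t - v t) t0) \<le> L * M * \<bar>s - t0\<bar>"
  proof (rule has_vector_derivative_bound)
    fix x assume x: "x \<in> {a..b}"
    show "((\<lambda>t. u t - v t) has_vector_derivative F (u x) - F (v x)) (at x within {a..b})"
      by (intro has_vector_derivative_diff u v x)
    have "norm (F (u x) - F (v x)) \<le> L * norm (u x - v x)"
      using lipschitz_on_normD[OF F S(1)[OF x] S(2)[OF x]] .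
    also have "\<dots> \<le> L * M"
      using max[OF x] L by (simp add: M_def mult_left_mono)
    finally show "norm (F (u x) - F (v x)) \<le> L * M" .
  qed (use s t0 in auto)
  then have "M \<le> L * M * \<bar>s - t0\<bar>"
    by (simp add: M_def eq)
  also have "\<dots> \<le> L * M * (b - a)"
    using s t0 L by (intro mult_left_mono) (auto simp: M_def)
  finally have "M * (1 - L * (b - a)) \<le> 0"
    by (simp add: algebra_simps)
  then have "M \<le> 0"
    using small by (simp add: mult_le_0_iff)
  then show ?thesis
    using max[OF t] by (simp add: M_def)
qed

lemma picard_lindelof:
  fixes F :: "'a::euclidean_space \<Rightarrow> 'a"
  assumes F: "L-lipschitz_on UNIV F" and "\<epsilon> > 0" and small: "3 * \<epsilon> * L < 1"
  obtains y where "y 0 = x0"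
    and "\<And>t. t \<in> {-\<epsilon>..\<epsilon>} \<Longrightarrow> (y has_vector_derivative F (y t)) (at t within {-\<epsilon>..\<epsilon>})"
proof -
  have L: "L \<ge> 0"
    using F lipschitz_on_nonneg by blast
  have contF: "continuous_on UNIV F"
    using F lipschitz_on_continuous_on by blast
  \<comment> \<open>Freezing time outside the interval lets the integral operator act on the bounded
    continuous functions on the whole line, a complete space.\<close>
  define cl where "cl t = max (-\<epsilon>) (min \<epsilon> t)" for t :: real
  have cl: "cl t \<in> {-\<epsilon>..\<epsilon>}" "continuous_on UNIV cl" for t
    using \<open>\<epsilon> > 0\<close> by (auto simp: cl_def intro!: continuous_intros)
  \<comment> \<open>The integral from 0 to \<open>cl t\<close> is a difference of integrals from
    \<open>-\<epsilon>\<close>, which covers negative times too. Their lengths, at most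
    \<open>2 * \<epsilon>\<close> and \<open>\<epsilon>\<close>, add up to the contraction constant
    \<open>3 * \<epsilon> * L\<close>.\<close>
  define P where "P y t = x0 + (integral {-\<epsilon>..cl t} (\<lambda>s. F (y s)) - integral {-\<epsilon>..0} (\<lambda>s. F (y s)))"
    for y :: "real \<Rightarrow> 'a" and t
  have contFy: "continuous_on S (\<lambda>s. F (apply_bcontfun y s))" for S and y :: "real \<Rightarrow>\<^sub>C 'a"
    by (intro continuous_on_compose2[OF contF]) auto
  have P_bc: "P (apply_bcontfun y) \<in> bcontfun" for y
  proof -
    let ?I = "\<lambda>t. integral {-\<epsilon>..t} (\<lambda>s. F (apply_bcontfun y s))"
    have I: "continuous_on {-\<epsilon>..\<epsilon>} ?I"
      by (intro indefinite_integral_continuous_1 integrable_continuous_real contFy)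
    have "continuous_on UNIV (\<lambda>t. ?I (cl t))"
      by (rule continuous_on_compose2[OF I cl(2)]) (use cl in auto)
    then have "continuous_on UNIV (P y)"
      unfolding P_def by (intro continuous_intros)
    moreover have "bounded (range (P y))"
    proof (rule bounded_subset)
      show "bounded ((\<lambda>t. x0 + (?I t - ?I 0)) ` {-\<epsilon>..\<epsilon>})"
        by (intro compact_imp_bounded compact_continuous_image continuous_intros I compact_Icc)
      show "range (P y) \<subseteq> (\<lambda>t. x0 + (?I t - ?I 0)) ` {-\<epsilon>..\<epsilon>}"
        using cl by (auto simp: P_def)
    qed
    ultimately show ?thesis
      by (simp add: bcontfun_def)
  qed
  define \<Phi> where "\<Phi> y = Bcontfun (P (apply_bcontfun y))" for y
  have \<Phi>: "apply_bcontfun (\<Phi> y) = P (apply_bcontfun y)" for y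
    using P_bc by (simp add: \<Phi>_def Bcontfun_inverse)
  have "dist (\<Phi> y) (\<Phi> z) \<le> 3 * \<epsilon> * L * dist y z" for y z
  proof (rule dist_bound)
    fix t
    let ?d = "\<lambda>s. F (apply_bcontfun y s) - F (apply_bcontfun z s)"
    have int: "(\<lambda>s. F (apply_bcontfun y s)) integrable_on {-\<epsilon>..r}" for r y
      by (intro integrable_continuous_real contFy)
    have bd: "norm (integral {-\<epsilon>..r} ?d) \<le> L * dist y z * (r - (-\<epsilon>))" if "r \<ge> -\<epsilon>" for r
    proof (rule integral_bound)
      show "-\<epsilon> \<le> r" by fact
      show "continuous_on {-\<epsilon>..r} ?d"
        by (intro continuous_intros contFy)
      fix s
      have "norm (?d s) \<le> L * dist (apply_bcontfun y s) (apply_bcontfun z s)"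
        using lipschitz_onD[OF F] by (simp add: dist_norm)
      also have "\<dots> \<le> L * dist y z"
        by (intro mult_left_mono dist_bounded L)
      finally show "norm (?d s) \<le> L * dist y z" .
    qed
    have "\<Phi> y t - \<Phi> z t = integral {-\<epsilon>..cl t} ?d - integral {-\<epsilon>..0} ?d"
      by (simp add: \<Phi> P_def integral_diff int)
    then have "dist (\<Phi> y t) (\<Phi> z t) \<le> norm (integral {-\<epsilon>..cl t} ?d) + norm (integral {-\<epsilon>..0} ?d)"
      by (simp add: dist_norm norm_triangle_ineq4)
    also have "\<dots> \<le> L * dist y z * (cl t - (-\<epsilon>)) + L * dist y z * (0 - (-\<epsilon>))"
      using cl(1)[of t] \<open>\<epsilon> > 0\<close> by (intro add_mono bd) auto
    also have "\<dots> \<le> L * dist y z * (2 * \<epsilon>) + L * dist y z * \<epsilon>"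
      using cl(1)[of t] L by (intro add_mono mult_left_mono) auto
    finally show "dist (\<Phi> y t) (\<Phi> z t) \<le> 3 * \<epsilon> * L * dist y z"
      by (simp add: algebra_simps)
  qed
  then have "\<exists>!y. \<Phi> y = y"
    using L \<open>\<epsilon> > 0\<close> small by (intro banach_fix_type[of "3 * \<epsilon> * L"]) auto
  then obtain y where "\<Phi> y = y"
    by auto
  then have y: "apply_bcontfun y = P (apply_bcontfun y)"
    using \<Phi>[of y] by simp
  show thesis
  proof
    have "cl 0 = 0"
      using \<open>\<epsilon> > 0\<close> by (simp add: cl_def)
    then show "apply_bcontfun y 0 = x0"
      by (subst y) (simp add: P_def)
    fix t
    assume t: "t \<in> {-\<epsilon>..\<epsilon>}"
    have "((\<lambda>t. x0 + (integral {-\<epsilon>..t} (\<lambda>s. F (apply_bcontfun y s)) -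
        integral {-\<epsilon>..0} (\<lambda>s. F (apply_bcontfun y s))))
      has_vector_derivative 0 + (F (apply_bcontfun y t) - 0)) (at t within {-\<epsilon>..\<epsilon>})"
      using t contFy
      by (intro has_vector_derivative_add has_vector_derivative_diff has_vector_derivative_const
          integral_has_vector_derivative)
    moreover have "P (apply_bcontfun y) s = x0 + (integral {-\<epsilon>..s} (\<lambda>s. F (apply_bcontfun y s)) -
        integral {-\<epsilon>..0} (\<lambda>s. F (apply_bcontfun y s)))" if "s \<in> {-\<epsilon>..\<epsilon>}" for s
      using that by (simp add: P_def cl_def)
    ultimately have "(P (apply_bcontfun y) has_vector_derivative 0 + (F (apply_bcontfun y t) - 0))
        (at t within {-\<epsilon>..\<epsilon>})"
      by (metis (no_types, lifting) has_vector_derivative_transform t)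
    then show "(apply_bcontfun y has_vector_derivative F (apply_bcontfun y t))
        (at t within {-\<epsilon>..\<epsilon>})"
      using y by simp
  qed
qed

text \<open>Composing \<open>F\<close> with the nearest-point projection onto the ball, which is
  1-Lipschitz, gives a globally Lipschitz field. Its solution solves the original equation as long
  as it stays in the ball.\<close>

lemma ode_local_solution:
  fixes F :: "'a::euclidean_space \<Rightarrow> 'a"
  assumes F: "L-lipschitz_on (cball x0 r) F" and "r > 0"
  obtains y \<epsilon> where "\<epsilon> > 0" "2 * \<epsilon> * L < 1" "y 0 = x0"
    and "\<And>t. t \<in> {-\<epsilon>..\<epsilon>} \<Longrightarrow> y t \<in> cball x0 r"
    and "\<And>t. t \<in> {-\<epsilon>..\<epsilon>} \<Longrightarrow> (y has_vector_derivative F (y t)) (at t within {-\<epsilon>..\<epsilon>})"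
proof -
  let ?p = "closest_point (cball x0 r)"
  have ne: "cball x0 r \<noteq> {}"
    using \<open>r > 0\<close> by simp
  have p: "?p x \<in> cball x0 r" for x
    using closest_point_in_set[OF closed_cball ne] .
  have lip: "L-lipschitz_on UNIV (\<lambda>x. F (?p x))"
  proof (rule lipschitz_onI)
    show L: "L \<ge> 0"
      using F lipschitz_on_nonneg by blast
    fix x y
    have "dist (F (?p x)) (F (?p y)) \<le> L * dist (?p x) (?p y)"
      by (intro lipschitz_onD[OF F] p)
    also have "\<dots> \<le> L * dist x y"
      by (intro mult_left_mono closest_point_lipschitz closed_cball convex_cball ne L)
    finally show "dist (F (?p x)) (F (?p y)) \<le> L * dist x y" .
  qed
  have "continuous_on (cball x0 r) F"
    using F lipschitz_on_continuous_on by blast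
  then have "bounded (F ` cball x0 r)"
    by (intro compact_imp_bounded compact_continuous_image) auto
  then obtain M where M: "M > 0" "\<And>x. x \<in> cball x0 r \<Longrightarrow> norm (F x) \<le> M"
    by (auto simp: bounded_pos)
  have L: "L \<ge> 0"
    using F lipschitz_on_nonneg by blast
  \<comment> \<open>At speed at most \<open>M\<close> the solution cannot leave the ball before time
    \<open>r / M\<close>. The second bound gives \<open>3 * \<epsilon> * L < 1\<close> and remains
    meaningful for \<open>L = 0\<close>.\<close>
  define \<epsilon> where "\<epsilon> = min (r / M) (1 / (3 * L + 3))"
  have \<epsilon>: "\<epsilon> > 0" "M * \<epsilon> \<le> r" "3 * \<epsilon> * L < 1"
  proof -
    show "\<epsilon> > 0"
      using M \<open>r > 0\<close> L by (simp add: \<epsilon>_def)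
    have "\<epsilon> \<le> r / M" "\<epsilon> \<le> 1 / (3 * L + 3)"
      by (auto simp: \<epsilon>_def)
    then show "M * \<epsilon> \<le> r"
      using M by (simp add: field_simps)
    have "3 * \<epsilon> * L + 3 * \<epsilon> \<le> 1"
      using \<open>\<epsilon> \<le> 1 / (3 * L + 3)\<close> L by (simp add: field_simps)
    then show "3 * \<epsilon> * L < 1"
      using \<open>\<epsilon> > 0\<close> by linarith
  qed
  obtain y where y0: "y 0 = x0" and y: "\<And>t. t \<in> {-\<epsilon>..\<epsilon>} \<Longrightarrow>
      (y has_vector_derivative F (?p (y t))) (at t within {-\<epsilon>..\<epsilon>})"
    using picard_lindelof[OF lip \<epsilon>(1,3)] by blast
  have yr: "y t \<in> cball x0 r" if t: "t \<in> {-\<epsilon>..\<epsilon>}" for t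
  proof -
    have "norm (y t - y 0) \<le> M * \<bar>t - 0\<bar>"
      by (rule has_vector_derivative_bound[OF y]) (use t M p \<epsilon> in auto)
    also have "\<dots> \<le> M * \<epsilon>"
      using t M by (intro mult_left_mono) auto
    finally show ?thesis
      using \<epsilon> by (simp add: y0 dist_norm norm_minus_commute)
  qed
  show thesis
  proof
    show "2 * \<epsilon> * L < 1"
      using \<epsilon> L by (smt (verit) mult_nonneg_nonneg mult_right_mono)
    fix t assume "t \<in> {-\<epsilon>..\<epsilon>}"
    then show "(y has_vector_derivative F (y t)) (at t within {-\<epsilon>..\<epsilon>})"
      using y[of t] yr[of t] by (simp add: closest_point_self)
  qed (use \<epsilon> y0 yr in auto)
qed

text \<open>\<open>Ck_on\<close> provides continuity of the derivative one direction at a time, so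
  its operator norm is bounded through the values on the basis vectors, a continuous function on the
  compact ball.\<close>

lemma C1_lipschitz:
  fixes f :: "'a::euclidean_space \<Rightarrow> 'b::real_normed_vector"
  assumes f: "\<And>x. x \<in> cball x0 r \<Longrightarrow> (f has_derivative f' x) (at x)"
    and f': "\<And>v. continuous_on (cball x0 r) (\<lambda>x. f' x v)"
  obtains L where "L-lipschitz_on (cball x0 r) f"
proof -
  have "continuous_on (cball x0 r) (\<lambda>x. \<Sum>i\<in>Basis. norm (f' x i))"
    by (intro continuous_intros f')
  then have "bounded ((\<lambda>x. \<Sum>i\<in>Basis. norm (f' x i)) ` cball x0 r)"
    by (intro compact_imp_bounded compact_continuous_image) auto
  then obtain L where L: "L > 0" "\<And>x. x \<in> cball x0 r \<Longrightarrow> norm (\<Sum>i\<in>Basis. norm (f' x i)) \<le> L"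
    by (auto simp: bounded_pos)
  have "L-lipschitz_on (cball x0 r) f"
  proof (rule lipschitz_onI)
    fix x y
    assume xy: "x \<in> cball x0 r" "y \<in> cball x0 r"
    have "norm (f x - f y) \<le> L * norm (x - y)"
    proof (rule differentiable_bound[OF convex_cball _ _ xy])
      fix z assume z: "z \<in> cball x0 r"
      show "(f has_derivative f' z) (at z within cball x0 r)"
        using f[OF z] has_derivative_at_withinI by blast
      have "onorm (f' z) \<le> (\<Sum>i\<in>Basis. norm (f' z i))"
        using f[OF z] by (intro onorm_componentwise) (rule has_derivative_bounded_linear)
      also have "\<dots> \<le> L"
        using L(2)[OF z] by simp
      finally show "onorm (f' z) \<le> L" .
    qed
    then show "dist (f x) (f y) \<le> L * dist x y"
      by (simp add: dist_norm)
  qed (use L in auto)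
  then show thesis ..
qed

text \<open>A product rule in which \<open>h\<close> merely has a limit: as \<open>r\<close>
  vanishes at 0, the difference quotient of the product is \<open>h\<close> times that of
  \<open>r\<close>. It is applied with \<open>h\<close> a coordinate of \<open>Ad\<close>, before
  \<open>Ad\<close> is known to be differentiable along a curve.\<close>

lemma has_vector_derivative_scaleR_vanishing:
  fixes r :: "real \<Rightarrow> 'a::real_normed_vector"
  assumes h: "(h \<longlongrightarrow> h0) (at (0::real))" and r: "(r has_vector_derivative r') (at 0)" and r0: "r 0 = 0"
  shows "((\<lambda>s. h s *\<^sub>R r s) has_vector_derivative h0 *\<^sub>R r') (at 0)"
proof -
  have *: "(f has_vector_derivative f') (at 0) \<longleftrightarrow> ((\<lambda>s. inverse s *\<^sub>R (f s - f 0)) \<longlongrightarrow> f') (at 0)"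
    for f :: "real \<Rightarrow> 'a" and f'
  proof -
    have "norm (f s - f 0 - (s - 0) *\<^sub>R f') / norm (s - 0) = norm (inverse s *\<^sub>R (f s - f 0) - f')"
      if "s \<noteq> 0" for s
    proof -
      have "inverse s *\<^sub>R (f s - f 0) - f' = inverse s *\<^sub>R (f s - f 0 - s *\<^sub>R f')"
        using that by (simp add: scaleR_diff_right)
      then show ?thesis
        by (simp add: divide_inverse mult.commute)
    qed
    then have "((\<lambda>s. norm (f s - f 0 - (s - 0) *\<^sub>R f') / norm (s - 0)) \<longlongrightarrow> 0) (at 0) \<longleftrightarrow>
        ((\<lambda>s. norm (inverse s *\<^sub>R (f s - f 0) - f')) \<longlongrightarrow> 0) (at 0)"
      by (intro tendsto_cong) (auto simp: eventually_at_filter)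
    also have "\<dots> \<longleftrightarrow> ((\<lambda>s. inverse s *\<^sub>R (f s - f 0)) \<longlongrightarrow> f') (at 0)"
      unfolding tendsto_norm_zero_iff by (rule Lim_null[symmetric])
    finally show ?thesis
      unfolding has_vector_derivative_def has_derivative_iff_norm
      by (simp add: bounded_linear_scaleR_left)
  qed
  have "((\<lambda>s. h s *\<^sub>R (inverse s *\<^sub>R (r s - r 0))) \<longlongrightarrow> h0 *\<^sub>R r') (at 0)"
    using r[unfolded *] by (intro tendsto_scaleR h)
  then show ?thesis
    unfolding * by (simp add: r0 mult.commute)
qed

section \<open>Lie groups in a chart around the unit\<close>

locale lie_chart =
  fixes G :: "('k::t2_space) monoid" (structure)
    and A :: "('k, 'e::euclidean_space) chart set"
    and c :: "('k, 'e) chart"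
  assumes lie: "lie_group G UNIV A"
    and c: "c \<in> A" "\<one> \<in> chart_dom c"
begin

sublocale group G
  using lie by (simp add: lie_group_def)

lemma carrier [simp]: "carrier G = UNIV"
  using lie by (simp add: lie_group_def)

abbreviation chart_range :: "('k, 'e) chart \<Rightarrow> 'e set"
  where "chart_range a \<equiv> chart_map a ` chart_dom a"

lemma chart:
  assumes "a \<in> A"
  shows "open (chart_dom a)" "open (chart_range a)"
    and "continuous_on (chart_dom a) (chart_map a)" "continuous_on (chart_range a) (chart_inv a)"
    and "g \<in> chart_dom a \<Longrightarrow> chart_inv a (chart_map a g) = g"
    and "x \<in> chart_range a \<Longrightarrow> chart_inv a x \<in> chart_dom a"
    and "x \<in> chart_range a \<Longrightarrow> chart_map a (chart_inv a x) = x"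
proof -
  have "open (chart_dom a) \<and> openin (top_of_set UNIV) (chart_range a) \<and>
      homeomorphism (chart_dom a) (chart_range a) (chart_map a) (chart_inv a)"
    using lie assms by (simp add: lie_group_def smooth_atlas_def)
  then show "open (chart_dom a)" "open (chart_range a)"
    and "continuous_on (chart_dom a) (chart_map a)" "continuous_on (chart_range a) (chart_inv a)"
    and "g \<in> chart_dom a \<Longrightarrow> chart_inv a (chart_map a g) = g"
    and "x \<in> chart_range a \<Longrightarrow> chart_inv a x \<in> chart_dom a"
    and "x \<in> chart_range a \<Longrightarrow> chart_map a (chart_inv a x) = x"
    by (auto simp: homeomorphism_def)
qed

lemma chart_at: obtains a where "a \<in> A" "g \<in> chart_dom a"
proof -
  have "g \<in> (\<Union>a\<in>A. chart_dom a)"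
    using lie by (simp add: lie_group_def smooth_atlas_def)
  then show thesis
    using that by auto
qed

lemma tendsto_chart_inv:
  "a \<in> A \<Longrightarrow> l \<in> chart_range a \<Longrightarrow> (f \<longlongrightarrow> l) F \<Longrightarrow> ((\<lambda>x. chart_inv a (f x)) \<longlongrightarrow> chart_inv a l) F"
  using chart(2,4)[of a] by (metis continuous_on_eq_continuous_at isCont_tendsto_compose)

lemma continuous_on_mult [continuous_intros]:
  assumes "continuous_on S f" "continuous_on S g"
  shows "continuous_on S (\<lambda>x. f x \<otimes> g x)"
proof -
  have "continuous_on UNIV (\<lambda>(g, h). g \<otimes> h)"
    using lie by (simp add: lie_group_def)
  from continuous_on_compose2[OF this continuous_on_Pair[OF assms]] show ?thesis
    by simp
qed

lemma tendsto_mult_group: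
  assumes "(f \<longlongrightarrow> a) F" "(g \<longlongrightarrow> b) F"
  shows "((\<lambda>x. f x \<otimes> g x) \<longlongrightarrow> a \<otimes> b) F"
proof -
  have "continuous_on UNIV (\<lambda>p. fst p \<otimes> snd p)"
    by (intro continuous_intros)
  then have "isCont (\<lambda>p. fst p \<otimes> snd p) (a, b)"
    by (simp add: continuous_on_eq_continuous_at)
  from isCont_tendsto_compose[OF this tendsto_Pair[OF assms]] show ?thesis
    by simp
qed

lemma continuous_on_inv [continuous_intros]:
  "continuous_on S f \<Longrightarrow> continuous_on S (\<lambda>x. inv (f x))"
  using lie continuous_on_compose2[of UNIV "\<lambda>g. inv g" S f] by (simp add: lie_group_def)

definition mult_dom :: "('k, 'e) chart \<Rightarrow> ('k, 'e) chart \<Rightarrow> ('k, 'e) chart \<Rightarrow> ('e \<times> 'e) set"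
  where "mult_dom a b d = {(x, y). x \<in> chart_range a \<and> y \<in> chart_range b \<and>
    chart_inv a x \<otimes> chart_inv b y \<in> chart_dom d}"

lemma open_mult_dom:
  assumes "a \<in> A" "b \<in> A" "d \<in> A"
  shows "open (mult_dom a b d)"
proof -
  let ?f = "\<lambda>p. chart_inv a (fst p) \<otimes> chart_inv b (snd p)"
  have "continuous_on (chart_range a \<times> chart_range b) ?f"
    by (intro continuous_on_mult continuous_on_compose2[OF chart(4)[OF assms(1)]]
        continuous_on_compose2[OF chart(4)[OF assms(2)]] continuous_on_fst continuous_on_snd
        continuous_on_id) auto
  then have "open ((chart_range a \<times> chart_range b) \<inter> ?f -` chart_dom d)"
    using chart(1,2) assms by (intro continuous_open_preimage open_Times) auto
  also have "(chart_range a \<times> chart_range b) \<inter> ?f -` chart_dom d = mult_dom a b d"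
    by (auto simp: mult_dom_def)
  finally show ?thesis .
qed

text \<open>First derivatives give \<open>Ad\<close> and the left-invariant fields; second
  derivatives give the Lipschitz bound for these fields and the bracket. Openness of
  \<open>mult_dom\<close> turns derivatives within it into full ones.\<close>

lemma mult_C2:
  assumes "a \<in> A" "b \<in> A" "d \<in> A"
  obtains f' f'' where
    "\<And>p. p \<in> mult_dom a b d \<Longrightarrow>
      ((\<lambda>(x, y). chart_map d (chart_inv a x \<otimes> chart_inv b y)) has_derivative f' p) (at p)"
    "\<And>p v. p \<in> mult_dom a b d \<Longrightarrow> ((\<lambda>p. f' p v) has_derivative f'' v p) (at p)"
    "\<And>v w. continuous_on (mult_dom a b d) (\<lambda>p. f'' v p w)"
proof -
  let ?m = "\<lambda>(x, y). chart_map d (chart_inv a x \<otimes> chart_inv b y)"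
  have eq: "{(chart_map a g, chart_map b h) | g h.
      g \<in> chart_dom a \<and> h \<in> chart_dom b \<and> g \<otimes> h \<in> chart_dom d} = mult_dom a b d"
    using chart(5)[OF assms(1)] chart(5)[OF assms(2)] by (force simp: mult_dom_def)
  have "smooth_on (UNIV \<times> UNIV) (mult_dom a b d) ?m"
    unfolding eq[symmetric] using lie assms unfolding lie_group_def by blast
  then have "Ck_on (Suc (Suc 0)) UNIV (mult_dom a b d) ?m"
    by (simp only: smooth_on_def UNIV_Times_UNIV)
  then obtain f' where f': "\<forall>x\<in>mult_dom a b d. (?m has_derivative f' x) (at x within mult_dom a b d)"
    and *: "\<forall>v. \<exists>f''. (\<forall>x\<in>mult_dom a b d. ((\<lambda>p. f' p v) has_derivative f'' x) (at x within mult_dom a b d)) \<and>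
       (\<forall>w. continuous_on (mult_dom a b d) (\<lambda>p. f'' p w))"
    unfolding Ck_on.simps by auto
  from choice[OF *] obtain f'' where
    "\<forall>v. (\<forall>x\<in>mult_dom a b d. ((\<lambda>p. f' p v) has_derivative f'' v x) (at x within mult_dom a b d)) \<and>
       (\<forall>w. continuous_on (mult_dom a b d) (\<lambda>p. f'' v p w))"
    by blast
  with f' show thesis
    using at_within_open[OF _ open_mult_dom[OF assms]] by (intro that[of f' f'']) auto
qed

lemma left_mult_differentiable:
  assumes "a \<in> A" "b \<in> A" "h \<in> chart_dom a" "g \<otimes> h \<in> chart_dom b"
  shows "(\<lambda>x. chart_map b (g \<otimes> chart_inv a x)) differentiable at (chart_map a h)"
proof -
  obtain d where d: "d \<in> A" "g \<in> chart_dom d"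
    using chart_at .
  have mem: "(chart_map d g, chart_map a h) \<in> mult_dom d a b"
    using assms d chart(5) by (auto simp: mult_dom_def)
  obtain f' where f': "((\<lambda>(x, y). chart_map b (chart_inv d x \<otimes> chart_inv a y)) has_derivative f')
      (at (chart_map d g, chart_map a h))"
    using mult_C2[OF d(1) assms(1,2)] mem by metis
  have "((\<lambda>y. (chart_map d g, y)) has_derivative (\<lambda>v. (0, v))) (at (chart_map a h))"
    by (auto intro!: derivative_eq_intros)
  from has_derivative_compose[OF this f'] show ?thesis
    using chart(5)[OF d] by (auto simp: differentiable_def)
qed

lemma right_mult_differentiable:
  assumes "a \<in> A" "b \<in> A" "h \<in> chart_dom a" "h \<otimes> g \<in> chart_dom b"
  shows "(\<lambda>x. chart_map b (chart_inv a x \<otimes> g)) differentiable at (chart_map a h)"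
proof -
  obtain d where d: "d \<in> A" "g \<in> chart_dom d"
    using chart_at .
  have mem: "(chart_map a h, chart_map d g) \<in> mult_dom a d b"
    using assms d chart(5) by (auto simp: mult_dom_def)
  obtain f' where f': "((\<lambda>(x, y). chart_map b (chart_inv a x \<otimes> chart_inv d y)) has_derivative f')
      (at (chart_map a h, chart_map d g))"
    using mult_C2[OF assms(1) d(1) assms(2)] mem by metis
  have "((\<lambda>y. (y, chart_map d g)) has_derivative (\<lambda>v. (v, 0))) (at (chart_map a h))"
    by (auto intro!: derivative_eq_intros)
  from has_derivative_compose[OF this f'] show ?thesis
    using chart(5)[OF d] by (auto simp: differentiable_def)
qed

abbreviation \<phi> :: "'k \<Rightarrow> 'e" where "\<phi> \<equiv> chart_map c"
abbreviation \<psi> :: "'e \<Rightarrow> 'k" where "\<psi> \<equiv> chart_inv c"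
abbreviation e :: 'e where "e \<equiv> chart_map c \<one>"

lemma e: "e \<in> chart_range c" "\<psi> e = \<one>"
  using c chart(5) by auto

abbreviation conj_chart :: "'k \<Rightarrow> 'e \<Rightarrow> 'e"
  where "conj_chart g x \<equiv> \<phi> (g \<otimes> \<psi> x \<otimes> inv g)"

lemma conj_chart_e [simp]: "conj_chart g e = e"
  by (simp add: e)

text \<open>Two independent factors cover conjugation, with \<open>k = inv h\<close>, and left
  translation, with \<open>k = \<one>\<close>.\<close>

lemma conj_near_e:
  assumes "d \<in> A" "h \<otimes> k \<in> chart_dom d"
  obtains S where "open S" "e \<in> S" "S \<subseteq> chart_range c" "\<And>x. x \<in> S \<Longrightarrow> h \<otimes> \<psi> x \<otimes> k \<in> chart_dom d"
proof
  let ?S = "chart_range c \<inter> (\<lambda>x. h \<otimes> \<psi> x \<otimes> k) -` chart_dom d"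
  have "continuous_on (chart_range c) (\<lambda>x. h \<otimes> \<psi> x \<otimes> k)"
    using chart(4)[OF c(1)] by (intro continuous_intros)
  then show "open ?S"
    using chart(1)[OF assms(1)] chart(2)[OF c(1)] by (intro continuous_open_preimage)
qed (use assms e in auto)

abbreviation ad_group :: "'k \<Rightarrow> 'e \<Rightarrow> 'e"
  where "ad_group g \<equiv> Ad G UNIV c g"

text \<open>The intermediate product \<open>g \<otimes> \<psi> x\<close> lies near \<open>g\<close>,
  possibly outside the domain of \<open>c\<close>, so conjugation is factored through a chart
  \<open>a\<close> around \<open>g\<close>.\<close>

lemma has_derivative_conj_chart: "(conj_chart g has_derivative ad_group g) (at e)"
proof -
  obtain a where a: "a \<in> A" "g \<in> chart_dom a"
    using chart_at .
  obtain S where S: "open S" "e \<in> S" "S \<subseteq> chart_range c" "\<And>x. x \<in> S \<Longrightarrow> g \<otimes> \<psi> x \<otimes> \<one> \<in> chart_dom a"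
    using conj_near_e[of a g \<one>] a by auto
  have 1: "(\<lambda>x. chart_map a (g \<otimes> \<psi> x)) differentiable at e"
    using a c by (intro left_mult_differentiable) auto
  have 2: "(\<lambda>x. \<phi> (chart_inv a x \<otimes> inv g)) differentiable at (chart_map a (g \<otimes> \<psi> e))"
    using a c e by (intro right_mult_differentiable) auto
  have "(\<lambda>x. \<phi> (chart_inv a (chart_map a (g \<otimes> \<psi> x)) \<otimes> inv g)) differentiable at e"
    using differentiable_chain_at[OF 1 2] by (simp add: o_def)
  then obtain f' where "((\<lambda>x. \<phi> (chart_inv a (chart_map a (g \<otimes> \<psi> x)) \<otimes> inv g)) has_derivative f') (at e)"
    by (auto simp: differentiable_def)
  then have "(conj_chart g has_derivative f') (at e)"
    by (rule has_derivative_transform_within_open[OF _ S(1,2)]) (use S(4) chart(5)[OF a(1)] in auto)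
  then show ?thesis
    unfolding Ad_def using frechet_derivative_works differentiable_def by blast
qed

lemma linear_ad: "linear (ad_group g)"
  using has_derivative_conj_chart has_derivative_linear by blast

lemma bounded_linear_ad: "bounded_linear (ad_group g)"
  using has_derivative_conj_chart has_derivative_bounded_linear by blast

lemma ad_one [simp]: "ad_group \<one> x = x"
proof -
  have "((\<lambda>x. x) has_derivative (\<lambda>x. x)) (at e)"
    by (rule has_derivative_ident)
  then have "(conj_chart \<one> has_derivative (\<lambda>x. x)) (at e)"
    by (rule has_derivative_transform_within_open[OF _ chart(2)[OF c(1)] e(1)])
      (use chart(7)[OF c(1)] in auto)
  then show ?thesis
    using has_derivative_unique[OF has_derivative_conj_chart] by metis
qed

lemma ad_mult: "ad_group (g \<otimes> h) x = ad_group g (ad_group h x)"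
proof -
  obtain S where S: "open S" "e \<in> S" "S \<subseteq> chart_range c"
    "\<And>x. x \<in> S \<Longrightarrow> h \<otimes> \<psi> x \<otimes> inv h \<in> chart_dom c"
    using conj_near_e[of c h "inv h"] c by auto
  have "((\<lambda>x. conj_chart g (conj_chart h x)) has_derivative (\<lambda>x. ad_group g (ad_group h x))) (at e)"
    using has_derivative_compose[OF has_derivative_conj_chart[of h], of "conj_chart g" "ad_group g"]
      has_derivative_conj_chart[of g] by simp
  then have "(conj_chart (g \<otimes> h) has_derivative (\<lambda>x. ad_group g (ad_group h x))) (at e)"
  proof (rule has_derivative_transform_within_open[OF _ S(1,2)])
    fix x assume "x \<in> S"
    then show "conj_chart g (conj_chart h x) = conj_chart (g \<otimes> h) x"
      using S(4)[of x] chart(5)[OF c(1)] by (simp add: m_assoc inv_mult_group)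
  qed
  then show ?thesis
    using has_derivative_unique[OF has_derivative_conj_chart] by metis
qed

lemma ad_inv [simp]: "ad_group (inv g) (ad_group g x) = x" "ad_group g (ad_group (inv g) x) = x"
  by (simp_all flip: ad_mult)

text \<open>A chart map is a total function with arbitrary values off its domain; continuity of
  \<open>\<gamma>\<close> at 0 is therefore a separate condition, which keeps the curve inside the
  chart near 0. Straight lines in the chart qualify as well as one-parameter subgroups.\<close>

definition unit_curve :: "(real \<Rightarrow> 'k) \<Rightarrow> 'e \<Rightarrow> bool"
  where "unit_curve \<gamma> X \<longleftrightarrow> \<gamma> 0 = \<one> \<and> isCont \<gamma> 0 \<and> ((\<lambda>s. \<phi> (\<gamma> s)) has_vector_derivative X) (at 0)"

lemma unit_curve_eventually: "unit_curve \<gamma> X \<Longrightarrow> \<forall>\<^sub>F s in nhds 0. \<gamma> s \<in> chart_dom c"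
  using chart(1)[OF c(1)] c
  by (auto simp: unit_curve_def isCont_def eventually_nhds_conv_at dest: topological_tendstoD)

lemma unit_curve_conj:
  assumes "unit_curve \<gamma> X"
  shows "unit_curve (\<lambda>s. g \<otimes> \<gamma> s \<otimes> inv g) (ad_group g X)"
  unfolding unit_curve_def
proof (intro conjI)
  show "g \<otimes> \<gamma> 0 \<otimes> inv g = \<one>"
    using assms by (simp add: unit_curve_def)
  show "isCont (\<lambda>s. g \<otimes> \<gamma> s \<otimes> inv g) 0"
    using assms unfolding unit_curve_def isCont_def by (intro tendsto_mult_group tendsto_const) auto
  have "((\<lambda>s. \<phi> (\<gamma> s)) has_derivative (\<lambda>h. h *\<^sub>R X)) (at 0)"
    using assms by (simp add: unit_curve_def has_vector_derivative_def)
  from has_derivative_compose[OF this, of "conj_chart g" "ad_group g"]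
  have *: "((\<lambda>s. conj_chart g (\<phi> (\<gamma> s))) has_derivative (\<lambda>h. ad_group g (h *\<^sub>R X))) (at 0)"
    using has_derivative_conj_chart[of g] assms by (simp add: unit_curve_def)
  obtain S where S: "open S" "0 \<in> S" "\<And>s. s \<in> S \<Longrightarrow> \<gamma> s \<in> chart_dom c"
    using unit_curve_eventually[OF assms] by (auto simp: eventually_nhds)
  have "((\<lambda>s. \<phi> (g \<otimes> \<gamma> s \<otimes> inv g)) has_derivative (\<lambda>h. ad_group g (h *\<^sub>R X))) (at 0)"
    by (rule has_derivative_transform_within_open[OF * S(1,2)]) (use S(3) chart(5)[OF c(1)] in auto)
  then show "((\<lambda>s. \<phi> (g \<otimes> \<gamma> s \<otimes> inv g)) has_vector_derivative ad_group g X) (at 0)"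
    by (simp add: has_vector_derivative_def linear_scale[OF linear_ad])
qed

lemma unit_curve_exists: "\<exists>\<gamma>. unit_curve \<gamma> X"
proof (intro exI)
  let ?\<gamma> = "\<lambda>s. \<psi> (e + s *\<^sub>R X)"
  have lim: "((\<lambda>s. e + s *\<^sub>R X) \<longlongrightarrow> e + 0 *\<^sub>R X) (at 0)"
    by (intro tendsto_intros)
  have d: "((\<lambda>s. e + s *\<^sub>R X) has_vector_derivative X) (at 0)"
    by (auto intro!: derivative_eq_intros)
  have "open ((\<lambda>s. e + s *\<^sub>R X) -` chart_range c)"
    using chart(2)[OF c(1)] by (intro open_vimage continuous_intros)
  then have "((\<lambda>s. \<phi> (?\<gamma> s)) has_vector_derivative X) (at 0)"
    by (rule has_vector_derivative_transform_within_open[OF d]) (use e chart(7)[OF c(1)] in auto)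
  then show "unit_curve ?\<gamma> X"
    using tendsto_chart_inv[OF c(1) e(1)] lim e(2) by (auto simp: unit_curve_def isCont_def)
qed

end

section \<open>Derivatives of the group law in the chart at the unit\<close>

context lie_chart
begin

abbreviation mult_chart :: "'e \<times> 'e \<Rightarrow> 'e"
  where "mult_chart \<equiv> \<lambda>(x, y). \<phi> (\<psi> x \<otimes> \<psi> y)"

abbreviation mdom :: "('e \<times> 'e) set"
  where "mdom \<equiv> mult_dom c c c"

text \<open>The choice already demands a second derivative, so that \<open>mult_deriv2\<close> can
  be chosen for this very function. In \<open>mult_deriv2 v p w\<close> the direction
  \<open>v\<close> belongs to the first differentiation and \<open>w\<close> to the second.\<close>

definition mult_deriv :: "'e \<times> 'e \<Rightarrow> 'e \<times> 'e \<Rightarrow> 'e"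
  where "mult_deriv = (SOME f'. \<exists>f''. (\<forall>p\<in>mdom. (mult_chart has_derivative f' p) (at p)) \<and>
    (\<forall>p\<in>mdom. \<forall>v. ((\<lambda>p. f' p v) has_derivative f'' v p) (at p)) \<and>
    (\<forall>v w. continuous_on mdom (\<lambda>p. f'' v p w)))"

definition mult_deriv2 :: "'e \<times> 'e \<Rightarrow> 'e \<times> 'e \<Rightarrow> 'e \<times> 'e \<Rightarrow> 'e"
  where "mult_deriv2 = (SOME f''. (\<forall>p\<in>mdom. (mult_chart has_derivative mult_deriv p) (at p)) \<and>
    (\<forall>p\<in>mdom. \<forall>v. ((\<lambda>p. mult_deriv p v) has_derivative f'' v p) (at p)) \<and>
    (\<forall>v w. continuous_on mdom (\<lambda>p. f'' v p w)))"

lemma mult_derivatives: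
  shows has_derivative_mult_chart: "p \<in> mdom \<Longrightarrow> (mult_chart has_derivative mult_deriv p) (at p)"
    and has_derivative_mult_deriv: "p \<in> mdom \<Longrightarrow> ((\<lambda>p. mult_deriv p v) has_derivative mult_deriv2 v p) (at p)"
    and continuous_on_mult_deriv2: "continuous_on mdom (\<lambda>p. mult_deriv2 v p w)"
proof -
  have "\<exists>f' f''. (\<forall>p\<in>mdom. (mult_chart has_derivative f' p) (at p)) \<and>
    (\<forall>p\<in>mdom. \<forall>v. ((\<lambda>p. f' p v) has_derivative f'' v p) (at p)) \<and>
    (\<forall>v w. continuous_on mdom (\<lambda>p. f'' v p w))"
    using mult_C2[OF c(1) c(1) c(1)] by metis
  from someI_ex[OF this] have "\<exists>f''. (\<forall>p\<in>mdom. (mult_chart has_derivative mult_deriv p) (at p)) \<and>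
    (\<forall>p\<in>mdom. \<forall>v. ((\<lambda>p. mult_deriv p v) has_derivative f'' v p) (at p)) \<and>
    (\<forall>v w. continuous_on mdom (\<lambda>p. f'' v p w))"
    unfolding mult_deriv_def[symmetric] .
  from someI_ex[OF this] have *: "(\<forall>p\<in>mdom. (mult_chart has_derivative mult_deriv p) (at p)) \<and>
    (\<forall>p\<in>mdom. \<forall>v. ((\<lambda>p. mult_deriv p v) has_derivative mult_deriv2 v p) (at p)) \<and>
    (\<forall>v w. continuous_on mdom (\<lambda>p. mult_deriv2 v p w))"
    unfolding mult_deriv2_def[symmetric] .
  show "p \<in> mdom \<Longrightarrow> (mult_chart has_derivative mult_deriv p) (at p)"
    and "p \<in> mdom \<Longrightarrow> ((\<lambda>p. mult_deriv p v) has_derivative mult_deriv2 v p) (at p)"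
    and "continuous_on mdom (\<lambda>p. mult_deriv2 v p w)"
    using * by blast+
qed

lemma linear_mult_deriv: "p \<in> mdom \<Longrightarrow> linear (mult_deriv p)"
  using has_derivative_mult_chart has_derivative_linear by blast

lemma linear_mult_deriv2: "p \<in> mdom \<Longrightarrow> linear (mult_deriv2 v p)"
  using has_derivative_mult_deriv has_derivative_linear by blast

lemma mdom_e: "x \<in> chart_range c \<Longrightarrow> (x, e) \<in> mdom" "x \<in> chart_range c \<Longrightarrow> (e, x) \<in> mdom"
  "(e, e) \<in> mdom"
  using e chart(6)[OF c(1)] c by (auto simp: mult_dom_def)

lemma has_derivative_mult_chart_right:
  assumes "(x, y) \<in> mdom"
  shows "((\<lambda>y. mult_chart (x, y)) has_derivative (\<lambda>v. mult_deriv (x, y) (0, v))) (at y)"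
proof -
  have "((\<lambda>y. (x, y)) has_derivative (\<lambda>v. (0, v))) (at y)"
    by (auto intro!: derivative_eq_intros)
  from has_derivative_compose[OF this has_derivative_mult_chart[OF assms]] show ?thesis
    by simp
qed

lemma has_derivative_mult_chart_left:
  assumes "(x, y) \<in> mdom"
  shows "((\<lambda>x. mult_chart (x, y)) has_derivative (\<lambda>v. mult_deriv (x, y) (v, 0))) (at x)"
proof -
  have "((\<lambda>x. (x, y)) has_derivative (\<lambda>v. (v, 0))) (at x)"
    by (auto intro!: derivative_eq_intros)
  from has_derivative_compose[OF this has_derivative_mult_chart[OF assms]] show ?thesis
    by simp
qed

lemma mult_deriv_e: "mult_deriv (e, e) (0, v) = v" "mult_deriv (e, e) (v, 0) = v"
proof -
  have "((\<lambda>y. y) has_derivative (\<lambda>v. mult_deriv (e, e) (0, v))) (at e)"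
    by (rule has_derivative_transform_within_open[OF has_derivative_mult_chart_right[OF mdom_e(3)]
          chart(2)[OF c(1)] e(1)]) (use chart(7)[OF c(1)] e in auto)
  then show "mult_deriv (e, e) (0, v) = v"
    using has_derivative_unique[OF has_derivative_ident] by metis
  have "((\<lambda>y. y) has_derivative (\<lambda>v. mult_deriv (e, e) (v, 0))) (at e)"
    by (rule has_derivative_transform_within_open[OF has_derivative_mult_chart_left[OF mdom_e(3)]
          chart(2)[OF c(1)] e(1)]) (use chart(7)[OF c(1)] e in auto)
  then show "mult_deriv (e, e) (v, 0) = v"
    using has_derivative_unique[OF has_derivative_ident] by metis
qed

text \<open>Differentiate \<open>(x y x\<^sup>-\<^sup>1) x = x y\<close> with respect to \<open>y\<close>.\<close>

lemma mult_deriv_ad: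
  assumes x: "x \<in> chart_range c"
  shows "mult_deriv (e, x) (ad_group (\<psi> x) Y, 0) = mult_deriv (x, e) (0, Y)"
proof -
  obtain S where S: "open S" "e \<in> S" "S \<subseteq> chart_range c"
    "\<And>y. y \<in> S \<Longrightarrow> \<psi> x \<otimes> \<psi> y \<otimes> inv (\<psi> x) \<in> chart_dom c"
    using conj_near_e[of c "\<psi> x" "inv (\<psi> x)"] c by auto
  have "((\<lambda>y. mult_chart (conj_chart (\<psi> x) y, x)) has_derivative (\<lambda>v. mult_deriv (e, x) (ad_group (\<psi> x) v, 0))) (at e)"
    using has_derivative_compose[OF has_derivative_conj_chart[of "\<psi> x"],
        of "\<lambda>z. mult_chart (z, x)" "\<lambda>v. mult_deriv (e, x) (v, 0)"]
      has_derivative_mult_chart_left[OF mdom_e(2)[OF x]] by simp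
  then have "((\<lambda>y. mult_chart (x, y)) has_derivative (\<lambda>v. mult_deriv (e, x) (ad_group (\<psi> x) v, 0))) (at e)"
    by (rule has_derivative_transform_within_open[OF _ S(1,2)])
      (use S(4) chart(5)[OF c(1)] in \<open>auto simp: m_assoc\<close>)
  from has_derivative_unique[OF this has_derivative_mult_chart_right[OF mdom_e(1)[OF x]]]
  show ?thesis
    by metis
qed

end

context inner_form
begin

text \<open>By compactness \<open>B x x\<close> has a positive minimum on the unit sphere. This
  converts invariance of \<open>B\<close> into a bound on \<open>Ad\<close> in the Euclidean
  norm.\<close>

lemma norm_le_form: obtains K where "K > 0" "\<And>x. (norm x)\<^sup>2 \<le> K * B x x"
proof -
  have "continuous_on (sphere 0 1) (\<lambda>x. B x x)"
    by (intro continuous_on continuous_on_id)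
  then obtain z where z: "z \<in> sphere 0 1" "\<And>x. x \<in> sphere 0 1 \<Longrightarrow> B z z \<le> B x x"
    using continuous_attains_inf[OF compact_sphere, of 0 1 "\<lambda>x. B x x"] by fastforce
  then have m: "B z z > 0"
    by (intro pos) auto
  show thesis
  proof
    show "1 / B z z > 0"
      using m by simp
    fix x
    show "(norm x)\<^sup>2 \<le> 1 / B z z * B x x"
    proof (cases "x = 0")
      case False
      have "B z z \<le> B (x /\<^sub>R norm x) (x /\<^sub>R norm x)"
        using False by (intro z(2)) simp
      also have "\<dots> = B x x / (norm x)\<^sup>2"
        by (simp add: form_simps power2_eq_square divide_inverse)
      finally show ?thesis
        using m False by (simp add: field_simps)
    qed (simp add: form_simps)
  qed
qed

end

section \<open>The invariant form and the Lie bracket\<close>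

locale lie_chart_form = lie_chart G A c + inner_form B
  for G :: "('k::t2_space) monoid" (structure)
    and A :: "('k, 'e::euclidean_space) chart set"
    and c :: "('k, 'e) chart"
    and B :: "'e \<Rightarrow> 'e \<Rightarrow> real" +
  assumes ad_form: "B (Ad G UNIV c g X) (Ad G UNIV c g Y) = B X Y"
begin

lemma ad_bounded: obtains C where "\<And>g. norm (ad_group g Y) \<le> C"
proof -
  obtain K where K: "K > 0" "\<And>x. (norm x)\<^sup>2 \<le> K * B x x"
    using norm_le_form by blast
  have "norm (ad_group g Y) \<le> sqrt (K * B Y Y)" for g
    using K(2)[of "ad_group g Y"] by (simp add: ad_form real_le_rsqrt)
  then show thesis ..
qed

text \<open>With the unit placed at the origin, the group law is \<open>x + y + b x y\<close> up to
  higher order, with \<open>b\<close> bilinear, and this is \<open>b U Y - b Y U\<close>. The second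
  term is expanded over a basis, the form in which it arises when \<open>Ad\<close> is
  differentiated.\<close>

definition bracket :: "'e \<Rightarrow> 'e \<Rightarrow> 'e"
  where "bracket U Y = mult_deriv2 (0, Y) (e, e) (U, 0) - (\<Sum>b\<in>Basis. (Y \<bullet> b) *\<^sub>R mult_deriv2 (b, 0) (e, e) (0, U))"

text \<open>\<open>mult_deriv_ad\<close> is a linear equation for \<open>a s\<close>, namely
  \<open>l s = a s + (\<Sum>b\<in>Basis. (a s \<bullet> b) *\<^sub>R r b s)\<close>, in which
  \<open>l\<close> and \<open>r b\<close> are differentiable and \<open>r b\<close> vanishes at 0.
  Boundedness of \<open>Ad\<close> first gives convergence of \<open>a s\<close> to
  \<open>Y\<close>, and the product rule with a vanishing factor then gives the derivative.\<close>

lemma has_vector_derivative_ad: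
  assumes \<gamma>: "unit_curve \<gamma> U"
  shows "((\<lambda>s. ad_group (\<gamma> s) Y) has_vector_derivative bracket U Y) (at 0)"
proof -
  define x where "x s = \<phi> (\<gamma> s)" for s
  define l where "l s = mult_deriv (x s, e) (0, Y)" for s
  define r where "r b s = mult_deriv (e, x s) (b, 0) - b" for b s
  define a where "a s = ad_group (\<gamma> s) Y" for s
  have x0: "x 0 = e" and dx: "(x has_derivative (\<lambda>h. h *\<^sub>R U)) (at 0)" and \<gamma>0: "\<gamma> 0 = \<one>"
    using \<gamma> by (auto simp: unit_curve_def x_def[abs_def] has_vector_derivative_def)
  have l0: "l 0 = Y" and r0: "r b 0 = 0" and a0: "a 0 = Y" for b
    by (simp_all add: l_def r_def a_def x0 mult_deriv_e \<gamma>0)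
  have "((\<lambda>s. (x s, e)) has_derivative (\<lambda>h. (h *\<^sub>R U, 0))) (at 0)"
    by (intro has_derivative_Pair dx has_derivative_const)
  from has_derivative_compose[OF this, of "\<lambda>p. mult_deriv p (0, Y)" "mult_deriv2 (0, Y) (e, e)"]
  have "(l has_derivative (\<lambda>h. mult_deriv2 (0, Y) (e, e) (h *\<^sub>R U, 0))) (at 0)"
    using has_derivative_mult_deriv[OF mdom_e(3)] by (simp add: x0 l_def[abs_def])
  moreover have "mult_deriv2 (0, Y) (e, e) (h *\<^sub>R U, 0) = h *\<^sub>R mult_deriv2 (0, Y) (e, e) (U, 0)" for h
    using linear_scale[OF linear_mult_deriv2[OF mdom_e(3)], of _ h "(U, 0)"] by simp
  ultimately have dl: "(l has_vector_derivative mult_deriv2 (0, Y) (e, e) (U, 0)) (at 0)"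
    by (simp add: has_vector_derivative_def)
  have dr: "(r b has_vector_derivative mult_deriv2 (b, 0) (e, e) (0, U)) (at 0)" for b
  proof -
    have "((\<lambda>s. (e, x s)) has_derivative (\<lambda>h. (0, h *\<^sub>R U))) (at 0)"
      by (intro has_derivative_Pair dx has_derivative_const)
    from has_derivative_compose[OF this, of "\<lambda>p. mult_deriv p (b, 0)" "mult_deriv2 (b, 0) (e, e)"]
    have "((\<lambda>s. mult_deriv (e, x s) (b, 0)) has_derivative (\<lambda>h. mult_deriv2 (b, 0) (e, e) (0, h *\<^sub>R U))) (at 0)"
      using has_derivative_mult_deriv[OF mdom_e(3)] by (simp add: x0)
    moreover have "mult_deriv2 (b, 0) (e, e) (0, h *\<^sub>R U) = h *\<^sub>R mult_deriv2 (b, 0) (e, e) (0, U)" for h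
      using linear_scale[OF linear_mult_deriv2[OF mdom_e(3)], of _ h "(0, U)"] by simp
    ultimately have "((\<lambda>s. mult_deriv (e, x s) (b, 0)) has_vector_derivative mult_deriv2 (b, 0) (e, e) (0, U)) (at 0)"
      by (simp add: has_vector_derivative_def)
    from has_vector_derivative_diff[OF this has_vector_derivative_const[of b]] show ?thesis
      by (simp add: r_def[abs_def])
  qed
  obtain S where S: "open S" "0 \<in> S" "\<And>s. s \<in> S \<Longrightarrow> \<gamma> s \<in> chart_dom c"
    using unit_curve_eventually[OF \<gamma>] by (auto simp: eventually_nhds)
  have eq: "l s - (\<Sum>b\<in>Basis. (a s \<bullet> b) *\<^sub>R r b s) = a s" if "s \<in> S" for s
  proof -
    have xs: "x s \<in> chart_range c" and "\<psi> (x s) = \<gamma> s"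
      using S(3)[OF that] chart(5)[OF c(1)] by (auto simp: x_def)
    then have l: "l s = mult_deriv (e, x s) (a s, 0)"
      using mult_deriv_ad[OF xs, of Y] by (simp add: l_def a_def)
    have lin: "linear (\<lambda>v. mult_deriv (e, x s) (v, 0))"
      using has_derivative_mult_chart_left[OF mdom_e(2)[OF xs]] has_derivative_linear by blast
    have "l s = mult_deriv (e, x s) ((\<Sum>b\<in>Basis. (a s \<bullet> b) *\<^sub>R b), 0)"
      by (simp add: l euclidean_representation)
    also have "\<dots> = (\<Sum>b\<in>Basis. (a s \<bullet> b) *\<^sub>R mult_deriv (e, x s) (b, 0))"
      by (simp add: linear_sum[OF lin] linear_scale[OF lin])
    finally have "l s - (\<Sum>b\<in>Basis. (a s \<bullet> b) *\<^sub>R r b s) = (\<Sum>b\<in>Basis. (a s \<bullet> b) *\<^sub>R b)"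
      by (simp add: r_def scaleR_diff_right sum_subtractf)
    then show ?thesis
      by (simp add: euclidean_representation)
  qed
  have a_lim: "(a \<longlongrightarrow> Y) (at 0)"
  proof -
    obtain C where C: "\<And>g. norm (ad_group g Y) \<le> C"
      using ad_bounded by blast
    have "((\<lambda>s. (a s \<bullet> b) *\<^sub>R r b s) \<longlongrightarrow> 0) (at 0)" if "b \<in> Basis" for b
    proof (rule Lim_null_comparison)
      have "r b \<midarrow>0\<rightarrow> r b 0"
        using has_vector_derivative_continuous[OF dr[of b]] by (simp add: isCont_def)
      from tendsto_mult_right_zero[OF tendsto_norm_zero[OF this[unfolded r0]], of C]
      show "((\<lambda>s. C * norm (r b s)) \<longlongrightarrow> 0) (at 0)" .
      have "\<bar>a s \<bullet> b\<bar> \<le> C" for s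
        using Basis_le_norm[OF that, of "a s"] C[of "\<gamma> s"] by (simp add: a_def)
      then show "\<forall>\<^sub>F s in at 0. norm ((a s \<bullet> b) *\<^sub>R r b s) \<le> C * norm (r b s)"
        by (intro always_eventually allI) (simp add: mult_right_mono)
    qed
    then have "((\<lambda>s. \<Sum>b\<in>Basis. (a s \<bullet> b) *\<^sub>R r b s) \<longlongrightarrow> 0) (at 0)"
      by (intro tendsto_null_sum)
    moreover have "(l \<longlongrightarrow> Y) (at 0)"
      using has_vector_derivative_continuous[OF dl] by (simp add: isCont_def l0)
    ultimately have "((\<lambda>s. l s - (\<Sum>b\<in>Basis. (a s \<bullet> b) *\<^sub>R r b s)) \<longlongrightarrow> Y - 0) (at 0)"
      by (intro tendsto_diff)
    moreover have "\<forall>\<^sub>F s in at 0. l s - (\<Sum>b\<in>Basis. (a s \<bullet> b) *\<^sub>R r b s) = a s"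
      using eventually_at_topological S(1,2) eq by blast
    ultimately show ?thesis
      using tendsto_cong by fastforce
  qed
  have "((\<lambda>s. l s - (\<Sum>b\<in>Basis. (a s \<bullet> b) *\<^sub>R r b s)) has_vector_derivative bracket U Y) (at 0)"
    unfolding bracket_def
    by (intro has_vector_derivative_diff dl has_vector_derivative_sum
        has_vector_derivative_scaleR_vanishing tendsto_inner a_lim tendsto_const dr r0)
  then have "(a has_vector_derivative bracket U Y) (at 0)"
    by (rule has_vector_derivative_transform_within_open[OF _ S(1,2) eq])
  then show ?thesis
    by (simp add: a_def[abs_def])
qed

lemma bracket_unique:
  "unit_curve \<gamma> U \<Longrightarrow> ((\<lambda>s. ad_group (\<gamma> s) Y) has_vector_derivative D) (at 0) \<Longrightarrow> bracket U Y = D"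
  using has_vector_derivative_ad vector_derivative_unique_at by blast

lemma linear_bracket_left: "linear (\<lambda>U. bracket U Y)"
proof (rule linearI)
  note add = linear_add[OF linear_mult_deriv2[OF mdom_e(3)]] and scale = linear_scale[OF linear_mult_deriv2[OF mdom_e(3)]]
  fix U V and k :: real
  show "bracket (U + V) Y = bracket U Y + bracket V Y"
    using add[of _ "(U, 0)" "(V, 0)"] add[of _ "(0, U)" "(0, V)"]
    by (simp add: bracket_def scaleR_add_right sum.distrib)
  show "bracket (k *\<^sub>R U) Y = k *\<^sub>R bracket U Y"
    using scale[of _ k "(U, 0)"] scale[of _ k "(0, U)"]
    by (simp add: bracket_def scaleR_diff_right scaleR_sum_right mult.commute)
qed

lemma linear_bracket_right: "linear (bracket U)"
proof -
  obtain \<gamma> where \<gamma>: "unit_curve \<gamma> U"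
    using unit_curve_exists by blast
  show ?thesis
  proof (rule linearI)
    fix Y Z and k :: real
    show "bracket U (Y + Z) = bracket U Y + bracket U Z"
      using has_vector_derivative_add[OF has_vector_derivative_ad[OF \<gamma>, of Y]
          has_vector_derivative_ad[OF \<gamma>, of Z]]
      by (intro bracket_unique[OF \<gamma>]) (simp add: linear_add[OF linear_ad])
    show "bracket U (k *\<^sub>R Y) = k *\<^sub>R bracket U Y"
      using bounded_linear.has_vector_derivative[OF bounded_linear_scaleR_right
          has_vector_derivative_ad[OF \<gamma>, of Y], of k]
      by (intro bracket_unique[OF \<gamma>]) (simp add: linear_scale[OF linear_ad])
  qed
qed

text \<open>Conjugating a curve by \<open>g\<close> changes its velocity from \<open>U\<close> to
  \<open>ad_group g U\<close>.\<close>

lemma ad_bracket: "ad_group g (bracket U Y) = bracket (ad_group g U) (ad_group g Y)"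
proof -
  obtain \<gamma> where \<gamma>: "unit_curve \<gamma> U"
    using unit_curve_exists by blast
  have "((\<lambda>s. ad_group g (ad_group (\<gamma> s) Y)) has_vector_derivative ad_group g (bracket U Y)) (at 0)"
    by (intro bounded_linear.has_vector_derivative[OF bounded_linear_ad] has_vector_derivative_ad \<gamma>)
  then have "((\<lambda>s. ad_group (g \<otimes> \<gamma> s \<otimes> inv g) (ad_group g Y)) has_vector_derivative
      ad_group g (bracket U Y)) (at 0)"
    by (simp add: ad_mult)
  from bracket_unique[OF unit_curve_conj[OF \<gamma>] this] show ?thesis ..
qed

text \<open>Differentiate the invariance of \<open>B\<close> along a curve with velocity
  \<open>U\<close>.\<close>

lemma bracket_skew: "B (bracket U Y) Z = - B Y (bracket U Z)"
proof -
  obtain \<gamma> where \<gamma>: "unit_curve \<gamma> U"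
    using unit_curve_exists by blast
  have \<gamma>0: "\<gamma> 0 = \<one>"
    using \<gamma> by (simp add: unit_curve_def)
  have "((\<lambda>s. B (ad_group (\<gamma> s) Y) (ad_group (\<gamma> s) Z)) has_vector_derivative
      B (ad_group (\<gamma> 0) Y) (bracket U Z) + B (bracket U Y) (ad_group (\<gamma> 0) Z)) (at 0)"
    by (intro has_vector_derivative has_vector_derivative_ad \<gamma>)
  then have "((\<lambda>s. B Y Z) has_vector_derivative B Y (bracket U Z) + B (bracket U Y) Z) (at 0)"
    by (simp add: ad_form \<gamma>0)
  from vector_derivative_unique_at[OF this has_vector_derivative_const] show ?thesis
    by simp
qed

end

section \<open>One-parameter subgroups\<close>

lemma (in group) int_pow_commute:
  assumes "x \<otimes> y = y \<otimes> x" "x \<in> carrier G" "y \<in> carrier G"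
  shows "x [^] (k::int) \<otimes> y = y \<otimes> x [^] k"
proof (cases "k \<ge> 0")
  case True
  then obtain n where "k = int n"
    using nonneg_int_cases by blast
  then show ?thesis
    using assms by (simp add: int_pow_int group_commutes_pow)
next
  case False
  define n where "n = nat (- k)"
  have k: "k = - int n"
    using False by (simp add: n_def)
  have "x [^] n \<otimes> y = y \<otimes> x [^] n"
    using assms by (simp add: group_commutes_pow)
  moreover have "inv (x [^] n) \<otimes> (x [^] n \<otimes> y) \<otimes> inv (x [^] n) = y \<otimes> inv (x [^] n)"
    using assms by (simp flip: m_assoc)
  moreover have "inv (x [^] n) \<otimes> (y \<otimes> x [^] n) \<otimes> inv (x [^] n) = inv (x [^] n) \<otimes> y"
    using assms by (simp add: m_assoc)
  ultimately have "y \<otimes> inv (x [^] n) = inv (x [^] n) \<otimes> y"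
    by simp
  then show ?thesis
    using assms by (simp add: k int_pow_neg_int)
qed

text \<open>With \<open>p = g \<epsilon>\<close>, the extension of \<open>g\<close> takes the value \<open>g a p\<^sup>k\<close> at \<open>a + k \<epsilon>\<close> for \<open>0 \<le> a < \<epsilon>\<close>.\<close>

lemma (in group) local_hom_extend:
  fixes g :: "real \<Rightarrow> 'a" and \<epsilon> :: real
  assumes "\<epsilon> > 0" and closed: "\<And>s. g s \<in> carrier G"
    and hom: "\<And>s t. s \<in> {-\<epsilon>..\<epsilon>} \<Longrightarrow> t \<in> {-\<epsilon>..\<epsilon>} \<Longrightarrow> s + t \<in> {-\<epsilon>..\<epsilon>} \<Longrightarrow> g (s + t) = g s \<otimes> g t"
  obtains \<gamma> where "\<And>s t. \<gamma> (s + t) = \<gamma> s \<otimes> \<gamma> t" "\<And>s. s \<in> {-\<epsilon><..<\<epsilon>} \<Longrightarrow> \<gamma> s = g s"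
    "\<And>s. \<gamma> s \<in> carrier G"
proof -
  define p where "p = g \<epsilon>"
  have p: "p \<in> carrier G"
    by (simp add: p_def closed)
  define \<gamma> where "\<gamma> s = g (s - \<epsilon> * of_int \<lfloor>s / \<epsilon>\<rfloor>) \<otimes> p [^] \<lfloor>s / \<epsilon>\<rfloor>" for s
  have rep: "\<gamma> (a + \<epsilon> * of_int k) = g a \<otimes> p [^] k" if "0 \<le> a" "a < \<epsilon>" for a k
  proof -
    have "\<lfloor>(a + \<epsilon> * of_int k) / \<epsilon>\<rfloor> = k"
      using that by (intro floor_unique) (auto simp: field_simps)
    then show ?thesis
      by (simp add: \<gamma>_def)
  qed
  have dec: "\<exists>a k. 0 \<le> a \<and> a < \<epsilon> \<and> s = a + \<epsilon> * of_int k" for s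
  proof (intro exI conjI)
    show "s = (s - \<epsilon> * of_int \<lfloor>s / \<epsilon>\<rfloor>) + \<epsilon> * of_int \<lfloor>s / \<epsilon>\<rfloor>"
      by simp
    have "\<epsilon> * of_int \<lfloor>s / \<epsilon>\<rfloor> \<le> \<epsilon> * (s / \<epsilon>)" "\<epsilon> * (s / \<epsilon>) < \<epsilon> * (of_int \<lfloor>s / \<epsilon>\<rfloor> + 1)"
      using \<open>\<epsilon> > 0\<close> by (intro mult_left_mono mult_strict_left_mono; linarith)+
    then show "0 \<le> s - \<epsilon> * of_int \<lfloor>s / \<epsilon>\<rfloor>" "s - \<epsilon> * of_int \<lfloor>s / \<epsilon>\<rfloor> < \<epsilon>"
      using \<open>\<epsilon> > 0\<close> by (simp_all add: field_simps)
  qed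
  \<comment> \<open>The sum \<open>\<epsilon> + b\<close> may leave the interval, but the half
    arguments add up inside it; their values commute, and \<open>p\<close> and \<open>g b\<close>
    are the squares of these values.\<close>
  have comm: "p \<otimes> g b = g b \<otimes> p" if "0 \<le> b" "b < \<epsilon>" for b
  proof -
    let ?u = "g (\<epsilon>/2)" and ?v = "g (b/2)"
    have uv: "?u \<otimes> ?v = ?v \<otimes> ?u"
      using hom[of "\<epsilon>/2" "b/2"] hom[of "b/2" "\<epsilon>/2"] that by (simp add: add.commute)
    have "p = ?u \<otimes> ?u" "g b = ?v \<otimes> ?v"
      using hom[of "\<epsilon>/2" "\<epsilon>/2"] hom[of "b/2" "b/2"] that by (auto simp: p_def)
    then show ?thesis
      using uv closed by (metis m_assoc m_closed)
  qed
  have comm': "p [^] k \<otimes> g b = g b \<otimes> p [^] k" if "0 \<le> b" "b < \<epsilon>" for b and k :: int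
    using comm[OF that] p closed by (rule int_pow_commute)
  have g0: "g 0 = \<one>"
    using hom[of 0 0] \<open>\<epsilon> > 0\<close> closed[of 0] by simp
  show thesis
  proof
    show "\<gamma> s \<in> carrier G" for s
      using p by (simp add: \<gamma>_def closed)
    show "\<gamma> (s + t) = \<gamma> s \<otimes> \<gamma> t" for s t
    proof -
      obtain a k where a: "0 \<le> a" "a < \<epsilon>" "s = a + \<epsilon> * of_int k"
        using dec by blast
      obtain b l where b: "0 \<le> b" "b < \<epsilon>" "t = b + \<epsilon> * of_int l"
        using dec by blast
      have "\<gamma> s \<otimes> \<gamma> t = (g a \<otimes> p [^] k) \<otimes> (g b \<otimes> p [^] l)"
        by (simp add: a b rep)
      also have "\<dots> = g a \<otimes> (p [^] k \<otimes> g b) \<otimes> p [^] l"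
        using p closed by (simp add: m_assoc)
      also have "\<dots> = g a \<otimes> g b \<otimes> p [^] (k + l)"
        using p closed b by (simp add: comm' m_assoc int_pow_mult)
      finally have *: "\<gamma> s \<otimes> \<gamma> t = g a \<otimes> g b \<otimes> p [^] (k + l)" .
      show ?thesis
      proof (cases "a + b < \<epsilon>")
        case True
        have "\<gamma> (s + t) = \<gamma> ((a + b) + \<epsilon> * of_int (k + l))"
          by (simp add: a b algebra_simps)
        also have "\<dots> = g (a + b) \<otimes> p [^] (k + l)"
          using True a b by (intro rep) auto
        finally show ?thesis
          using True a(1,2) b(1,2) hom[of a b] * by simp
      next
        case False
        \<comment> \<open>Carry: the same factor \<open>g (\<epsilon> - b)\<close> completes
          \<open>g (a + b - \<epsilon>)\<close> to \<open>g a\<close> and \<open>g b\<close> to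
          \<open>p\<close>.\<close>
        have 1: "g a = g (a + b - \<epsilon>) \<otimes> g (\<epsilon> - b)"
          using hom[of "a + b - \<epsilon>" "\<epsilon> - b"] False a b by simp
        have 2: "g (\<epsilon> - b) \<otimes> g b = p"
          using hom[of "\<epsilon> - b" b] a b by (simp add: p_def)
        have "\<gamma> (s + t) = \<gamma> ((a + b - \<epsilon>) + \<epsilon> * of_int (1 + (k + l)))"
          by (simp add: a b algebra_simps)
        also have "\<dots> = g (a + b - \<epsilon>) \<otimes> p [^] (1 + (k + l))"
          using False a b by (intro rep) auto
        also have "\<dots> = g (a + b - \<epsilon>) \<otimes> p \<otimes> p [^] (k + l)"
          using p closed by (simp add: int_pow_mult m_assoc)
        also have "\<dots> = g a \<otimes> g b \<otimes> p [^] (k + l)"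
          using closed by (simp add: 1 m_assoc flip: 2)
        finally show ?thesis
          by (simp add: *)
      qed
    qed
    fix s
    assume s: "s \<in> {-\<epsilon><..<\<epsilon>}"
    show "\<gamma> s = g s"
    proof (cases "s \<ge> 0")
      case True
      then show ?thesis
        using rep[of s 0] s closed by simp
    next
      case False
      \<comment> \<open>For these negative \<open>s\<close> the floor of
        \<open>s / \<epsilon>\<close> is -1.\<close>
      then have "\<gamma> s = g (s + \<epsilon>) \<otimes> inv p"
        using rep[of "s + \<epsilon>" "-1"] s p by (simp add: int_pow_neg)
      also have "g (s + \<epsilon>) = g s \<otimes> p"
        using hom[of s \<epsilon>] s False by (simp add: p_def)
      finally show ?thesis
        using p closed by (simp add: m_assoc)
    qed
  qed
qed

section \<open>One-parameter subgroups as integral curves of left-invariant fields\<close>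

context lie_chart
begin

lemma one_param_D:
  assumes "one_param G c X \<gamma>"
  shows "\<gamma> (s + t) = \<gamma> s \<otimes> \<gamma> t" "\<gamma> 0 = \<one>" "continuous_on UNIV \<gamma>"
    and "((\<lambda>s. \<phi> (\<gamma> s)) has_vector_derivative X) (at 0)"
    and "unit_curve \<gamma> X"
proof -
  show hom: "\<gamma> (s + t) = \<gamma> s \<otimes> \<gamma> t" for s t
    using assms by (simp add: one_param_def)
  have "\<gamma> 0 \<otimes> \<gamma> 0 = \<gamma> 0"
    using hom[of 0 0] by simp
  then show 0: "\<gamma> 0 = \<one>"
    by simp
  show "continuous_on UNIV \<gamma>" "((\<lambda>s. \<phi> (\<gamma> s)) has_vector_derivative X) (at 0)"
    using assms by (auto simp: one_param_def)
  then show "unit_curve \<gamma> X"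
    using 0 by (simp add: unit_curve_def continuous_on_eq_continuous_at)
qed

lemma one_param_conj:
  assumes "one_param G c X \<gamma>"
  shows "one_param G c (ad_group g X) (\<lambda>s. g \<otimes> \<gamma> s \<otimes> inv g)"
  unfolding one_param_def
proof (intro conjI allI)
  show "continuous_on UNIV (\<lambda>s. g \<otimes> \<gamma> s \<otimes> inv g)"
    by (intro continuous_intros one_param_D[OF assms])
  show "((\<lambda>s. \<phi> (g \<otimes> \<gamma> s \<otimes> inv g)) has_vector_derivative ad_group g X) (at 0)"
    using unit_curve_conj[OF one_param_D(5)[OF assms]] by (simp add: unit_curve_def)
  fix s t
  have "g \<otimes> \<gamma> s \<otimes> inv g \<otimes> (g \<otimes> \<gamma> t \<otimes> inv g) = g \<otimes> \<gamma> s \<otimes> (inv g \<otimes> g) \<otimes> \<gamma> t \<otimes> inv g"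
    by (simp only: m_assoc carrier UNIV_I inv_closed m_closed)
  then show "g \<otimes> \<gamma> (s + t) \<otimes> inv g = g \<otimes> \<gamma> s \<otimes> inv g \<otimes> (g \<otimes> \<gamma> t \<otimes> inv g)"
    by (simp add: one_param_D(1)[OF assms] m_assoc)
qed

text \<open>The left-invariant vector field with value \<open>X\<close> at the unit, read in the
  chart.\<close>

abbreviation left_field :: "'e \<Rightarrow> 'e \<Rightarrow> 'e"
  where "left_field X x \<equiv> mult_deriv (x, e) (0, X)"

text \<open>Left invariance of the field: differentiate the associative law
  \<open>x (y h) = (x y) h\<close> in \<open>h\<close> at the unit.\<close>

lemma left_field_mult_chart:
  assumes "(x, y) \<in> mdom"
  shows "mult_deriv (x, y) (0, left_field X y) = left_field X (mult_chart (x, y))"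
proof -
  have x: "x \<in> chart_range c" and y: "y \<in> chart_range c" and xy: "\<psi> x \<otimes> \<psi> y \<in> chart_dom c"
    using assms by (auto simp: mult_dom_def)
  obtain S where S: "open S" "e \<in> S" "S \<subseteq> chart_range c" "\<And>h. h \<in> S \<Longrightarrow> \<psi> y \<otimes> \<psi> h \<otimes> \<one> \<in> chart_dom c"
    using conj_near_e[of c "\<psi> y" \<one>] c y chart(6)[OF c(1)] by auto
  have m: "mult_chart (x, y) \<in> chart_range c"
    using xy by auto
  have ye: "mult_chart (y, e) = y"
    using y e chart(7)[OF c(1)] by simp
  have "((\<lambda>h. mult_chart (x, mult_chart (y, h))) has_derivative (\<lambda>v. mult_deriv (x, y) (0, mult_deriv (y, e) (0, v)))) (at e)"
    using has_derivative_compose[OF has_derivative_mult_chart_right[OF mdom_e(1)[OF y]],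
        of "\<lambda>z. mult_chart (x, z)" "\<lambda>v. mult_deriv (x, y) (0, v)"] has_derivative_mult_chart_right[OF assms] ye by simp
  then have "((\<lambda>h. mult_chart (mult_chart (x, y), h)) has_derivative (\<lambda>v. mult_deriv (x, y) (0, mult_deriv (y, e) (0, v)))) (at e)"
  proof (rule has_derivative_transform_within_open[OF _ S(1,2)])
    fix h assume "h \<in> S"
    then show "mult_chart (x, mult_chart (y, h)) = mult_chart (mult_chart (x, y), h)"
      using S(4)[of h] xy chart(5)[OF c(1)] by (simp add: m_assoc)
  qed
  from has_derivative_unique[OF this has_derivative_mult_chart_right[OF mdom_e(1)[OF m]]]
  show ?thesis
    by metis
qed

lemma left_field_lipschitz:
  obtains r L where "r > 0" "cball e r \<subseteq> chart_range c" "L-lipschitz_on (cball e r) (left_field X)"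
proof -
  obtain r where r: "r > 0" "cball e r \<subseteq> chart_range c"
    using open_contains_cball chart(2)[OF c(1)] e(1) by blast
  have "((\<lambda>x. left_field X x) has_derivative (\<lambda>v. mult_deriv2 (0, X) (x, e) (v, 0))) (at x)" if "x \<in> cball e r" for x
  proof -
    have "((\<lambda>x. (x, e)) has_derivative (\<lambda>v. (v, 0))) (at x)"
      by (auto intro!: derivative_eq_intros)
    from has_derivative_compose[OF this has_derivative_mult_deriv[OF mdom_e(1)]] show ?thesis
      using that r by blast
  qed
  moreover have "continuous_on (cball e r) (\<lambda>x. mult_deriv2 (0, X) (x, e) (v, 0))" for v
    by (rule continuous_on_compose2[OF continuous_on_mult_deriv2])
      (use r mdom_e(1) in \<open>auto intro!: continuous_intros\<close>)
  ultimately obtain L where "L-lipschitz_on (cball e r) (left_field X)"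
    by (rule C1_lipschitz)
  with r show thesis
    using that by blast
qed

text \<open>Writing \<open>\<gamma> t\<close> as
  \<open>\<gamma> s \<otimes> \<gamma> (t - s)\<close> exhibits the velocity at \<open>s\<close> as
  the left translate of the velocity at 0.\<close>

lemma one_param_ode:
  assumes \<gamma>: "one_param G c X \<gamma>" and s: "\<gamma> s \<in> chart_dom c"
  shows "((\<lambda>t. \<phi> (\<gamma> t)) has_vector_derivative left_field X (\<phi> (\<gamma> s))) (at s)"
proof -
  have "((\<lambda>t. \<gamma> (t - s)) \<longlongrightarrow> \<gamma> (s - s)) (nhds s)"
    using one_param_D(3)[OF \<gamma>]
    by (intro isCont_tendsto_compose[of _ \<gamma>] tendsto_diff filterlim_ident tendsto_const)
      (simp add: continuous_on_eq_continuous_at)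
  then have "\<forall>\<^sub>F t in nhds s. \<gamma> (t - s) \<in> chart_dom c"
    using chart(1)[OF c(1)] c one_param_D(2)[OF \<gamma>] by (auto dest: topological_tendstoD)
  then obtain S where S: "open S" "s \<in> S" "\<And>t. t \<in> S \<Longrightarrow> \<gamma> (t - s) \<in> chart_dom c"
    by (auto simp: eventually_nhds)
  have "((\<lambda>t. t - s) has_derivative (\<lambda>h. h)) (at s)"
    by (auto intro!: derivative_eq_intros)
  from has_derivative_compose[OF this, of "\<lambda>t. \<phi> (\<gamma> t)" "\<lambda>h. h *\<^sub>R X"]
  have "((\<lambda>t. \<phi> (\<gamma> (t - s))) has_derivative (\<lambda>h. h *\<^sub>R X)) (at s)"
    using one_param_D(4)[OF \<gamma>] by (simp add: has_vector_derivative_def)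
  from has_derivative_compose[OF this, of "\<lambda>y. mult_chart (\<phi> (\<gamma> s), y)" "\<lambda>v. mult_deriv (\<phi> (\<gamma> s), e) (0, v)"]
  have "((\<lambda>t. mult_chart (\<phi> (\<gamma> s), \<phi> (\<gamma> (t - s)))) has_derivative (\<lambda>h. mult_deriv (\<phi> (\<gamma> s), e) (0, h *\<^sub>R X))) (at s)"
    using has_derivative_mult_chart_right[OF mdom_e(1)] s one_param_D(2)[OF \<gamma>] by simp
  then have "((\<lambda>t. \<phi> (\<gamma> t)) has_derivative (\<lambda>h. mult_deriv (\<phi> (\<gamma> s), e) (0, h *\<^sub>R X))) (at s)"
  proof (rule has_derivative_transform_within_open[OF _ S(1,2)])
    fix t assume "t \<in> S"
    then show "mult_chart (\<phi> (\<gamma> s), \<phi> (\<gamma> (t - s))) = \<phi> (\<gamma> t)"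
      using S(3) s chart(5)[OF c(1)] one_param_D(1)[OF \<gamma>, of s "t - s"] by simp
  qed
  moreover have "mult_deriv (\<phi> (\<gamma> s), e) (0, h *\<^sub>R X) = h *\<^sub>R left_field X (\<phi> (\<gamma> s))" for h
    using linear_scale[OF linear_mult_deriv[OF mdom_e(1)], of "\<phi> (\<gamma> s)" h "(0, X)"] s by simp
  ultimately show ?thesis
    by (simp add: has_vector_derivative_def)
qed

lemma hom_nat_pow:
  assumes "\<And>s t. \<gamma> (s + t) = \<gamma> s \<otimes> \<gamma> (t::real)" "\<gamma> 0 = \<one>"
  shows "\<gamma> (real n * s) = \<gamma> s [^] n"
  by (induction n) (simp_all add: assms distrib_right add.commute[of 1])

text \<open>Near 0 both curves are integral curves of one Lipschitz field. Agreement there spreads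
  to any \<open>s\<close>, whose value is the \<open>n\<close>-th power of the value at
  \<open>s / n\<close>.\<close>

lemma one_param_unique:
  assumes \<gamma>: "one_param G c X \<gamma>" and \<delta>: "one_param G c X \<delta>"
  shows "\<gamma> = \<delta>"
proof -
  obtain r L where r: "r > 0" "cball e r \<subseteq> chart_range c" and L: "L-lipschitz_on (cball e r) (left_field X)"
    using left_field_lipschitz by blast
  have near: "\<forall>\<^sub>F s in nhds 0. \<gamma> s \<in> chart_dom c \<and> \<phi> (\<gamma> s) \<in> ball e r"
    if \<gamma>: "one_param G c X \<gamma>" for \<gamma>
  proof (rule eventually_conj)
    show "\<forall>\<^sub>F s in nhds 0. \<gamma> s \<in> chart_dom c"
      using unit_curve_eventually one_param_D(5)[OF \<gamma>] .
    have "((\<lambda>s. \<phi> (\<gamma> s)) \<longlongrightarrow> \<phi> (\<gamma> 0)) (at 0)"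
      using has_vector_derivative_continuous[OF one_param_D(4)[OF \<gamma>]] by (simp add: isCont_def)
    then have "\<forall>\<^sub>F s in at 0. \<phi> (\<gamma> s) \<in> ball e r"
      using one_param_D(2)[OF \<gamma>] r by (intro topological_tendstoD[where l=e]) auto
    then show "\<forall>\<^sub>F s in nhds 0. \<phi> (\<gamma> s) \<in> ball e r"
      using one_param_D(2)[OF \<gamma>] r by (simp add: eventually_nhds_conv_at)
  qed
  obtain d where d: "d > 0" "\<And>s. dist s 0 < d \<Longrightarrow> (\<gamma> s \<in> chart_dom c \<and> \<phi> (\<gamma> s) \<in> ball e r) \<and>
      (\<delta> s \<in> chart_dom c \<and> \<phi> (\<delta> s) \<in> ball e r)"
    using eventually_conj[OF near[OF \<gamma>] near[OF \<delta>]] unfolding eventually_nhds_metric by blast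
  have L0: "L \<ge> 0"
    using L lipschitz_on_nonneg by blast
  \<comment> \<open>The first bound keeps both curves in the ball; the second gives
    \<open>L * (2 * \<eta>) < 1\<close>, as \<open>ode_unique\<close> requires.\<close>
  define \<eta> where "\<eta> = min (d / 2) (1 / (2 * L + 2) / 2)"
  have \<eta>: "\<eta> > 0" "\<eta> < d"
    using d L0 by (auto simp: \<eta>_def)
  have "\<eta> \<le> 1 / (2 * L + 2) / 2"
    by (simp add: \<eta>_def)
  then have "L * (\<eta> * 4) + \<eta> * 4 \<le> 1"
    using L0 by (simp add: field_simps)
  moreover have "L * (\<eta> * 4) \<ge> 0"
    using \<eta> L0 by simp
  ultimately have small: "L * (\<eta> - (-\<eta>)) < 1"
    using \<eta> by (simp add: algebra_simps)
  have loc: "\<gamma> s = \<delta> s" if s: "s \<in> {-\<eta>..\<eta>}" for s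
  proof -
    have mem: "dist t 0 < d" if "t \<in> {-\<eta>..\<eta>}" for t
      using that \<eta> by (auto simp: dist_real_def)
    have ode: "((\<lambda>t. \<phi> (\<gamma> t)) has_vector_derivative left_field X (\<phi> (\<gamma> t))) (at t within {-\<eta>..\<eta>})"
        "((\<lambda>t. \<phi> (\<delta> t)) has_vector_derivative left_field X (\<phi> (\<delta> t))) (at t within {-\<eta>..\<eta>})"
      and S: "\<phi> (\<gamma> t) \<in> cball e r" "\<phi> (\<delta> t) \<in> cball e r" if "t \<in> {-\<eta>..\<eta>}" for t
      using one_param_ode[OF \<gamma>, of t] one_param_ode[OF \<delta>, of t] d(2)[OF mem[OF that]]
      by (auto intro: has_vector_derivative_at_within)
    have "\<phi> (\<gamma> 0) = \<phi> (\<delta> 0)" "0 \<in> {-\<eta>..\<eta>}"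
      using \<eta> one_param_D(2)[OF \<gamma>] one_param_D(2)[OF \<delta>] by auto
    from ode_unique[OF ode S L this small s] have "\<phi> (\<gamma> s) = \<phi> (\<delta> s)" .
    then show ?thesis
      using d(2)[OF mem[OF s]] chart(5)[OF c(1)] by metis
  qed
  show ?thesis
  proof
    fix s
    obtain n where n: "\<bar>s\<bar> / \<eta> < real n"
      using reals_Archimedean2 by blast
    then have "real n > 0"
      using \<eta> by (smt (verit) divide_nonneg_pos)
    then have sn: "s / real n \<in> {-\<eta>..\<eta>}" "s = real n * (s / real n)"
      using n \<eta> by (auto simp: field_simps abs_if split: if_splits)
    have "\<gamma> (real n * (s / real n)) = \<gamma> (s / real n) [^] n"
      "\<delta> (real n * (s / real n)) = \<delta> (s / real n) [^] n"
      by (intro hom_nat_pow one_param_D[OF \<gamma>] one_param_D[OF \<delta>])+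
    then show "\<gamma> s = \<delta> s"
      using loc[OF sn(1)] sn(2) by simp
  qed
qed

text \<open>Let \<open>y\<close> be the local integral curve through the unit. For fixed
  \<open>s\<close>, both \<open>y (s + h)\<close> and the product of \<open>y s\<close> and
  \<open>y h\<close> solve the same equation in \<open>h\<close> with the same initial value, so
  \<open>y\<close> is a local homomorphism, which extends to the whole line.\<close>

lemma one_param_exists: "\<exists>\<gamma>. one_param G c X \<gamma>"
proof -
  obtain r0 L where r0: "r0 > 0" "cball e r0 \<subseteq> chart_range c" and L: "L-lipschitz_on (cball e r0) (left_field X)"
    using left_field_lipschitz by blast
  have "continuous_on mdom mult_chart"
    by (intro continuous_at_imp_continuous_on ballI has_derivative_continuous[OF has_derivative_mult_chart])
  then have "open (mdom \<inter> mult_chart -` ball e r0)"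
    using open_mult_dom c by (intro continuous_open_preimage) auto
  moreover have "(e, e) \<in> mdom \<inter> mult_chart -` ball e r0"
    using mdom_e r0 e by auto
  ultimately obtain U V where UV: "open U" "open V" "e \<in> U" "e \<in> V" "U \<times> V \<subseteq> mdom \<inter> mult_chart -` ball e r0"
    by (auto elim!: open_prod_elim)
  then obtain r1 where r1: "r1 > 0" "cball e r1 \<subseteq> U \<inter> V"
    using open_contains_cball[of "U \<inter> V"] by blast
  \<comment> \<open>Confining the solution to this smaller ball keeps products of its values in the
    ball of radius \<open>r0\<close>, where the Lipschitz bound holds.\<close>
  define r where "r = min r0 r1"
  have r: "r > 0" "cball e r \<subseteq> cball e r0" "cball e r \<subseteq> chart_range c"
    using r0 r1 by (auto simp: r_def)
  have prod: "(x, y) \<in> mdom" "mult_chart (x, y) \<in> cball e r0" if "x \<in> cball e r" "y \<in> cball e r" for x y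
  proof -
    have "(x, y) \<in> U \<times> V"
      using that r1 by (auto simp: r_def)
    then have "(x, y) \<in> mdom \<inter> mult_chart -` ball e r0"
      using UV by blast
    then show "(x, y) \<in> mdom" "mult_chart (x, y) \<in> cball e r0"
      by auto
  qed
  have "L-lipschitz_on (cball e r) (left_field X)"
    using lipschitz_on_subset[OF L r(2)] .
  then obtain y \<epsilon> where \<epsilon>: "\<epsilon> > 0" "2 * \<epsilon> * L < 1" and y0: "y 0 = e"
    and y: "\<And>t. t \<in> {-\<epsilon>..\<epsilon>} \<Longrightarrow> y t \<in> cball e r"
    and ode: "\<And>t. t \<in> {-\<epsilon>..\<epsilon>} \<Longrightarrow> (y has_vector_derivative left_field X (y t)) (at t within {-\<epsilon>..\<epsilon>})"
    by (rule ode_local_solution[OF _ r(1)]) (rule that)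
  have L0: "L \<ge> 0"
    using L lipschitz_on_nonneg by blast
  have "\<psi> (y (s + t)) = \<psi> (y s) \<otimes> \<psi> (y t)"
    if s: "s \<in> {-\<epsilon>..\<epsilon>}" and t: "t \<in> {-\<epsilon>..\<epsilon>}" and st: "s + t \<in> {-\<epsilon>..\<epsilon>}" for s t
  proof -
    \<comment> \<open>\<open>{a..b}\<close> consists of the \<open>h\<close> for which both
      \<open>h\<close> and \<open>s + h\<close> lie in the time interval of the solution; its length
      is at most \<open>2 * \<epsilon>\<close>.\<close>
    define a where "a = max (-\<epsilon>) (-\<epsilon> - s)"
    define b where "b = min \<epsilon> (\<epsilon> - s)"
    have ab: "h \<in> {-\<epsilon>..\<epsilon>}" "s + h \<in> {-\<epsilon>..\<epsilon>}" if "h \<in> {a..b}" for h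
      using that by (auto simp: a_def b_def)
    have ode_u: "((\<lambda>h. y (s + h)) has_vector_derivative left_field X (y (s + h))) (at h within {a..b})"
      and ode_v: "((\<lambda>h. mult_chart (y s, y h)) has_vector_derivative left_field X (mult_chart (y s, y h))) (at h within {a..b})"
      and S: "y (s + h) \<in> cball e r0" "mult_chart (y s, y h) \<in> cball e r0" if h: "h \<in> {a..b}" for h
    proof -
      have "((\<lambda>h. s + h) has_derivative (\<lambda>h. h)) (at h within {a..b})"
        by (auto intro!: derivative_eq_intros)
      moreover have "(y has_derivative (\<lambda>k. k *\<^sub>R left_field X (y (s + h)))) (at (s + h) within (\<lambda>h. s + h) ` {a..b})"
        by (rule has_derivative_subset[OF ode[OF ab(2)[OF h], unfolded has_vector_derivative_def]])
          (use ab in blast)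
      ultimately show "((\<lambda>h. y (s + h)) has_vector_derivative left_field X (y (s + h))) (at h within {a..b})"
        unfolding has_vector_derivative_def by (rule has_derivative_in_compose)
      have dy: "(y has_derivative (\<lambda>k. k *\<^sub>R left_field X (y h))) (at h within {a..b})"
        by (rule has_derivative_subset[OF ode[OF ab(1)[OF h], unfolded has_vector_derivative_def]])
          (use ab in blast)
      have m: "(y s, y h) \<in> mdom"
        using y s ab(1)[OF h] prod by blast
      have "((\<lambda>h. mult_chart (y s, y h)) has_derivative (\<lambda>k. mult_deriv (y s, y h) (0, k *\<^sub>R left_field X (y h)))) (at h within {a..b})"
        by (rule has_derivative_compose[OF dy, where g="\<lambda>z. mult_chart (y s, z)"])
          (rule has_derivative_mult_chart_right[OF m])
      moreover have "mult_deriv (y s, y h) (0, k *\<^sub>R left_field X (y h)) = k *\<^sub>R left_field X (mult_chart (y s, y h))" for k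
        using linear_scale[OF linear_mult_deriv[OF m], of k "(0, left_field X (y h))"] left_field_mult_chart[OF m] by simp
      ultimately show "((\<lambda>h. mult_chart (y s, y h)) has_vector_derivative left_field X (mult_chart (y s, y h))) (at h within {a..b})"
        by (simp add: has_vector_derivative_def)
      show "y (s + h) \<in> cball e r0" "mult_chart (y s, y h) \<in> cball e r0"
        using y[OF ab(2)[OF h]] r prod(2)[OF y[OF s] y[OF ab(1)[OF h]]] by auto
    qed
    have "y s \<in> chart_range c"
      using y[OF s] r by blast
    then have init: "y (s + 0) = mult_chart (y s, y 0)"
      using chart(7)[OF c(1)] by (simp add: y0 e)
    have "L * (b - a) \<le> L * (2 * \<epsilon>)"
      using L0 by (intro mult_left_mono) (auto simp: a_def b_def)
    then have small: "L * (b - a) < 1"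
      using \<epsilon> by (simp add: mult.commute mult.left_commute)
    have "0 \<in> {a..b}" "t \<in> {a..b}"
      using s t st \<epsilon> by (auto simp: a_def b_def)
    from ode_unique[OF ode_u ode_v S L init this(1) small this(2)]
    have "y (s + t) = mult_chart (y s, y t)" .
    then show ?thesis
      using prod(1)[OF y[OF s] y[OF t]] chart(5)[OF c(1)] by (simp add: mult_dom_def)
  qed
  then obtain \<gamma> where hom: "\<And>s t. \<gamma> (s + t) = \<gamma> s \<otimes> \<gamma> t"
    and \<gamma>: "\<And>s. s \<in> {-\<epsilon><..<\<epsilon>} \<Longrightarrow> \<gamma> s = \<psi> (y s)"
    using local_hom_extend[OF \<epsilon>(1), of "\<lambda>s. \<psi> (y s)"] by auto
  have dy: "(y has_vector_derivative X) (at 0)"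
    using ode[of 0] \<epsilon> by (simp add: y0 mult_deriv_e at_within_Icc_at)
  have "open {-\<epsilon><..<\<epsilon>}" "0 \<in> {-\<epsilon><..<\<epsilon>}"
    using \<epsilon> by auto
  then have d\<gamma>: "((\<lambda>s. \<phi> (\<gamma> s)) has_vector_derivative X) (at 0)"
  proof (rule has_vector_derivative_transform_within_open[OF dy])
    fix s assume "s \<in> {-\<epsilon><..<\<epsilon>}"
    then show "y s = \<phi> (\<gamma> s)"
      using \<gamma>[of s] y[of s] r chart(7)[OF c(1)] by auto
  qed
  have "((\<lambda>s. \<psi> (y s)) \<longlongrightarrow> \<psi> e) (at 0)"
    using tendsto_chart_inv[OF c(1) e(1)] has_vector_derivative_continuous[OF dy]
    by (simp add: isCont_def y0)
  then have lim0: "(\<gamma> \<longlongrightarrow> \<one>) (at 0)"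
    unfolding e(2)
    by (rule Lim_transform_within_open[OF _ \<open>open {-\<epsilon><..<\<epsilon>}\<close> \<open>0 \<in> {-\<epsilon><..<\<epsilon>}\<close>]) (simp add: \<gamma>)
  \<comment> \<open>Continuity at 0 is carried to \<open>s\<close> by left translation.\<close>
  have "isCont \<gamma> s" for s
  proof -
    have "((\<lambda>h. \<gamma> s \<otimes> \<gamma> h) \<longlongrightarrow> \<gamma> s \<otimes> \<one>) (at 0)"
      by (intro tendsto_mult_group lim0 tendsto_const)
    then have "((\<lambda>h. \<gamma> (s + h)) \<longlongrightarrow> \<gamma> s) (at 0)"
      by (simp add: hom)
    then show ?thesis
      unfolding isCont_def by (rule LIM_offset_zero_cancel)
  qed
  then have "one_param G c X \<gamma>"
    using hom d\<gamma> by (simp add: one_param_def continuous_on_eq_continuous_at)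
  then show ?thesis
    by blast
qed

end

section \<open>Self-adjoint operators\<close>

context inner_form
begin

lemma finite_orthogonal:
  assumes ne: "0 \<notin> S" and orth: "\<And>x y. x \<in> S \<Longrightarrow> y \<in> S \<Longrightarrow> x \<noteq> y \<Longrightarrow> B x y = 0"
  shows "finite S"
proof -
  have "x \<notin> span (S - {x})" if "x \<in> S" for x
  proof
    assume x: "x \<in> span (S - {x})"
    have "span (S - {x}) \<subseteq> {y. B x y = 0}"
      using orth[OF that] by (intro span_minimal) (auto simp: subspace_def form_simps)
    with x ne that show False
      by auto
  qed
  then have "independent S"
    by (auto simp: dependent_def)
  then show ?thesis
    by (rule finiteI_independent)
qed

text \<open>
  At a maximum \<open>z\<close> of the Rayleigh quotient, the form \<open>(x, y) \<mapsto> B (k x - C x) y\<close> is positive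
  semidefinite and isotropic on \<open>z\<close>, so \<open>z\<close> lies in its radical.
\<close>

lemma self_adjoint_eigenvector:
  assumes S: "subspace S" "S \<noteq> {0}" and C: "linear C" "\<And>x. x \<in> S \<Longrightarrow> C x \<in> S"
    and adj: "\<And>x y. x \<in> S \<Longrightarrow> y \<in> S \<Longrightarrow> B (C x) y = B x (C y)"
  obtains z k where "z \<in> S" "z \<noteq> 0" "C z = k *\<^sub>R z"
proof -
  define q where "q x = B (C x) x / B x x" for x
  have cont: "continuous_on (S \<inter> sphere 0 1) q"
    unfolding q_def using C(1)
    by (intro continuous_on_divide continuous_on continuous_on_id
        linear_continuous_on linear_conv_bounded_linear[THEN iffD1]) auto
  obtain x where "x \<in> S" "x \<noteq> 0"
    using S subspace_0 by blast
  then have "x /\<^sub>R norm x \<in> S \<inter> sphere 0 1"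
    using S by (auto simp: subspace_scale)
  then obtain z where z: "z \<in> S \<inter> sphere 0 1" "\<And>x. x \<in> S \<inter> sphere 0 1 \<Longrightarrow> q x \<le> q z"
    using continuous_attains_sup[OF _ _ cont] S(1)
    by (metis closed_Int_compact closed_subspace compact_sphere empty_iff)
  then have z0: "z \<in> S" "z \<noteq> 0"
    by auto
  define k where "k = q z"
  have q_le: "B (C x) x \<le> k * B x x" if "x \<in> S" for x
  proof (cases "x = 0")
    case False
    have "q (x /\<^sub>R norm x) \<le> k"
      using False that S unfolding k_def by (intro z(2)) (auto simp: subspace_scale)
    moreover have "q (x /\<^sub>R norm x) = q x"
      using False by (simp add: q_def linear_scale[OF C(1)] form_simps)
    ultimately show ?thesis
      using pos[OF False] by (simp add: q_def field_simps)
  qed (simp add: form_simps)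
  define w where "w = k *\<^sub>R z - C z"
  have w: "w \<in> S"
    using z0 S C by (simp add: w_def subspace_diff subspace_scale)
  have zz: "B (C z) z = k * B z z"
    using z0(2) by (simp add: k_def q_def)
  define m where "m = k * B w w - B (C w) w"
  \<comment> \<open>This is \<open>q_le\<close> at \<open>z + t *\<^sub>R w\<close>, where the
    constant terms cancel because \<open>z\<close> is a maximum. Its linear coefficient must
    therefore vanish.\<close>
  have "2 * t * B w w + t\<^sup>2 * m \<ge> 0" for t
  proof -
    have "B (C (z + t *\<^sub>R w)) (z + t *\<^sub>R w) \<le> k * B (z + t *\<^sub>R w) (z + t *\<^sub>R w)"
      using z0 w S by (intro q_le) (simp add: subspace_add subspace_scale)
    moreover have "B (C w) z = B w (C z)"
      using adj w z0 by blast
    ultimately have "B (C z) z + 2 * t * B w (C z) + t\<^sup>2 * B (C w) w \<le>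
        k * (B z z + 2 * t * B w z + t\<^sup>2 * B w w)"
      by (simp add: linear_add[OF C(1)] linear_scale[OF C(1)] form_simps power2_eq_square
          sym[of z w] sym[of "C z" w] algebra_simps)
    then have le: "2 * t * B w (C z) + t\<^sup>2 * B (C w) w \<le> k * (2 * t * B w z + t\<^sup>2 * B w w)"
      by (simp add: zz algebra_simps)
    have eq: "B w (C z) = k * B w z - B w w"
      by (simp add: w_def[THEN arg_cong[where f="B w"]] form_simps)
    show ?thesis
      using le unfolding eq m_def by (simp add: algebra_simps)
  qed
  note ineq = this
  have "B w w = 0"
  proof (rule ccontr)
    assume "B w w \<noteq> 0"
    then have pw: "B w w > 0"
      using pos[of w] by auto
    \<comment> \<open>A negative \<open>t\<close> so small that
      \<open>\<bar>t * m\<bar> \<le> B w w\<close>, hence the linear term dominates.\<close>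
    define t where "t = - B w w / (\<bar>m\<bar> + 1)"
    have t: "t < 0"
      using pw by (simp add: t_def divide_neg_pos)
    have "t * (2 * B w w + t * m) \<ge> 0"
      using ineq[of t] by (simp add: algebra_simps power2_eq_square)
    then have "2 * B w w + t * m \<le> 0"
      using t by (simp add: zero_le_mult_iff)
    moreover have "\<bar>t * m\<bar> \<le> B w w"
    proof -
      have "\<bar>t * m\<bar> = B w w * (\<bar>m\<bar> / (\<bar>m\<bar> + 1))"
        using pw by (simp add: t_def abs_mult)
      also have "\<dots> \<le> B w w * 1"
        using pw by (intro mult_left_mono) auto
      finally show ?thesis
        by simp
    qed
    ultimately show False
      using pw by (simp add: abs_le_iff)
  qed
  then have "C z = k *\<^sub>R z"
    by (simp add: w_def)
  with z0 show thesis
    by (rule that)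
qed

text \<open>Schur's argument: an eigenspace of \<open>C\<close> in \<open>S\<close> is stable under
  the commuting family \<open>F\<close>, so minimality makes it all of \<open>S\<close>.\<close>

lemma self_adjoint_scalar:
  assumes S: "subspace S" "S \<noteq> {0}"
    and min: "\<And>S'. subspace S' \<Longrightarrow> S' \<subseteq> S \<Longrightarrow> S' \<noteq> {0} \<Longrightarrow> \<forall>f\<in>F. f ` S' \<subseteq> S' \<Longrightarrow> S' = S"
    and F: "\<And>f. f \<in> F \<Longrightarrow> linear f" "\<And>f. f \<in> F \<Longrightarrow> f ` S \<subseteq> S"
    and C: "linear C" "\<And>x. x \<in> S \<Longrightarrow> C x \<in> S"
    and adj: "\<And>x y. x \<in> S \<Longrightarrow> y \<in> S \<Longrightarrow> B (C x) y = B x (C y)"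
    and comm: "\<And>f x. f \<in> F \<Longrightarrow> x \<in> S \<Longrightarrow> C (f x) = f (C x)"
  obtains k where "\<And>x. x \<in> S \<Longrightarrow> C x = k *\<^sub>R x"
proof -
  obtain z k where z: "z \<in> S" "z \<noteq> 0" "C z = k *\<^sub>R z"
    using self_adjoint_eigenvector[OF S C adj] by blast
  let ?S = "{x \<in> S. C x = k *\<^sub>R x}"
  have "?S = S"
  proof (rule min)
    show "subspace ?S"
      using S C by (auto simp: subspace_def linear_0 linear_add linear_scale scaleR_add_right)
    show "?S \<noteq> {0}"
      using z by blast
    show "\<forall>f\<in>F. f ` ?S \<subseteq> ?S"
      using F comm by (auto simp: linear_scale)
  qed auto
  then show thesis
    using that by blast
qed

end

lemma minimal_invariant_subspace:
  fixes W :: "'a::euclidean_space set"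
  assumes "subspace W" "W \<noteq> {0}" "\<And>f. f \<in> F \<Longrightarrow> f ` W \<subseteq> W"
  obtains S where "subspace S" "S \<subseteq> W" "S \<noteq> {0}" "\<And>f. f \<in> F \<Longrightarrow> f ` S \<subseteq> S"
    and "\<And>S'. subspace S' \<Longrightarrow> S' \<subseteq> S \<Longrightarrow> S' \<noteq> {0} \<Longrightarrow> \<forall>f\<in>F. f ` S' \<subseteq> S' \<Longrightarrow> S' = S"
proof -
  define Q where "Q S \<longleftrightarrow> subspace S \<and> S \<subseteq> W \<and> S \<noteq> {0} \<and> (\<forall>f\<in>F. f ` S \<subseteq> S)" for S
  have "Q W"
    using assms by (auto simp: Q_def)
  then obtain S where S: "Q S" "\<And>S'. Q S' \<Longrightarrow> dim S \<le> dim S'"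
    using ex_has_least_nat[of Q W dim] by blast
  show thesis
  proof
    show "f ` S \<subseteq> S" if "f \<in> F" for f
      using S that by (auto simp: Q_def)
    show "subspace S" "S \<subseteq> W" "S \<noteq> {0}"
      using S by (auto simp: Q_def)
    fix S'
    assume S': "subspace S'" "S' \<subseteq> S" "S' \<noteq> {0}" "\<forall>f\<in>F. f ` S' \<subseteq> S'"
    then have "Q S'"
      using S by (auto simp: Q_def)
    then have "dim S \<le> dim S'"
      by (rule S)
    then show "S' = S"
      using S S' by (intro subspace_dim_equal) (auto simp: Q_def)
  qed
qed

text \<open>With \<open>(U, V)\<close> read as \<open>U + i V\<close>, this is the real part of the
  Hermitian extension of \<open>B\<close> to the complexification.\<close>

lemma (in inner_form) inner_form_prod:
  "inner_form (\<lambda>p q. B (fst p) (fst q) + B (snd p) (snd q))"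
proof
  show "bilinear (\<lambda>p q. B (fst p) (fst q) + B (snd p) (snd q))"
    by (auto simp: bilinear_def form_simps algebra_simps intro!: linearI)
  show "B (fst x) (fst y) + B (snd x) (snd y) = B (fst y) (fst x) + B (snd y) (snd x)" for x y
    by (simp add: sym)
  show "B (fst x) (fst x) + B (snd x) (snd x) > 0" if "x \<noteq> 0" for x
    using that pos[of "fst x"] pos[of "snd x"] nonneg[of "fst x"] nonneg[of "snd x"]
    by (cases "fst x = 0") (auto simp: prod_eq_iff intro: add_pos_nonneg add_nonneg_pos)
qed

section \<open>Roots of a compact Lie group\<close>

context lie_chart_form
begin

lemma one_param_ad_deriv:
  assumes "one_param G c U \<gamma>"
  shows "((\<lambda>s. ad_group (\<gamma> s) Y) has_vector_derivative ad_group (\<gamma> s) (bracket U Y)) (at s)"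
proof -
  have "((\<lambda>t. t - s) has_derivative (\<lambda>h. h)) (at s)"
    by (auto intro!: derivative_eq_intros)
  from has_derivative_compose[OF this, of "\<lambda>t. ad_group (\<gamma> t) Y" "\<lambda>h. h *\<^sub>R bracket U Y"]
  have "((\<lambda>t. ad_group (\<gamma> (t - s)) Y) has_vector_derivative bracket U Y) (at s)"
    using has_vector_derivative_ad[OF one_param_D(5)[OF assms], of Y]
    by (simp add: has_vector_derivative_def)
  from bounded_linear.has_vector_derivative[OF bounded_linear_ad this, of "\<gamma> s"]
  have "((\<lambda>t. ad_group (\<gamma> s) (ad_group (\<gamma> (t - s)) Y)) has_vector_derivative
      ad_group (\<gamma> s) (bracket U Y)) (at s)" .
  moreover have "ad_group (\<gamma> s) (ad_group (\<gamma> (t - s)) Y) = ad_group (\<gamma> t) Y" for t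
    using one_param_D(1)[OF assms, of s "t - s"] by (simp flip: ad_mult)
  ultimately show ?thesis
    by simp
qed

text \<open>Conjugation by \<open>g\<close> fixes the curve pointwise, hence also its
  velocity.\<close>

lemma ad_fixed_of_commute:
  assumes \<gamma>: "one_param G c X \<gamma>" and comm: "\<And>t. g \<otimes> \<gamma> t = \<gamma> t \<otimes> g"
  shows "ad_group g X = X"
proof -
  have "g \<otimes> \<gamma> t \<otimes> inv g = \<gamma> t" for t
    by (simp add: comm m_assoc)
  then have "one_param G c (ad_group g X) \<gamma>"
    using one_param_conj[OF \<gamma>, of g] by simp
  then show ?thesis
    using one_param_D(4) \<gamma> vector_derivative_unique_at by blast
qed

lemma bracket_self: "bracket X X = 0"
proof -
  obtain \<gamma> where \<gamma>: "one_param G c X \<gamma>"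
    using one_param_exists by blast
  have "ad_group (\<gamma> s) X = X" for s
    by (rule ad_fixed_of_commute[OF \<gamma>])
      (simp flip: one_param_D(1)[OF \<gamma>] add: add.commute)
  then show ?thesis
    by (intro bracket_unique[OF one_param_D(5)[OF \<gamma>]]) simp
qed

lemmas bracket_simps = linear_add[OF linear_bracket_left] linear_add[OF linear_bracket_right]
  linear_diff[OF linear_bracket_left] linear_diff[OF linear_bracket_right]
  linear_scale[OF linear_bracket_left] linear_scale[OF linear_bracket_right]

lemma bracket_antisym: "bracket X Y = - bracket Y X"
  using bracket_self[of "X + Y"] 
  by (simp add: bracket_simps bracket_self[of X] bracket_self[of Y] eq_neg_iff_add_eq_0 add.commute)

lemma one_param_scale:
  assumes \<gamma>: "one_param G c X \<gamma>"
  shows "one_param G c (k *\<^sub>R X) (\<lambda>s. \<gamma> (k * s))"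
  unfolding one_param_def
proof (intro conjI allI)
  show "continuous_on UNIV (\<lambda>s. \<gamma> (k * s))"
    by (rule continuous_on_compose2[OF one_param_D(3)[OF \<gamma>]]) (auto intro!: continuous_intros)
  show "\<gamma> (k * (s + t)) = \<gamma> (k * s) \<otimes> \<gamma> (k * t)" for s t
    by (simp add: distrib_left one_param_D(1)[OF \<gamma>])
  have "((\<lambda>s. k * s) has_vector_derivative k) (at 0)"
    by (auto intro!: derivative_eq_intros)
  from vector_diff_chain_at[OF this, of "\<lambda>s. \<phi> (\<gamma> s)" X]
  show "((\<lambda>s. \<phi> (\<gamma> (k * s))) has_vector_derivative k *\<^sub>R X) (at 0)"
    using one_param_D(4)[OF \<gamma>] by (simp add: o_def)
qed

end

section \<open>The maximal torus and its one-parameter subgroups\<close>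

locale compact_lie = lie_chart_form +
  fixes T :: "'a set"
  assumes compact: "compact (UNIV :: 'a set)" and torus: "maximal_torus G T"
begin

abbreviation \<t> :: "'b set"
  where "\<t> \<equiv> torus_dual G UNIV c T"

lemma subspace_t: "subspace \<t>"
  by (auto simp: subspace_def torus_dual_def linear_0[OF linear_ad] linear_add[OF linear_ad]
      linear_scale[OF linear_ad])

lemma T: "subgroup T G" "compact T" "connected T" "\<And>g h. g \<in> T \<Longrightarrow> h \<in> T \<Longrightarrow> g \<otimes> h = h \<otimes> g"
  and T_max: "\<And>T'. torus_in G T' \<Longrightarrow> T \<subseteq> T' \<Longrightarrow> T' = T"
  using torus by (auto simp: maximal_torus_def torus_in_def)

text \<open>The product and commutation laws pass to the closure one variable at a time, each with
  the other variable fixed. Compactness comes from that of the whole group.\<close>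

lemma torus_in_closure:
  assumes H: "subgroup H G" "connected H" "\<And>g h. g \<in> H \<Longrightarrow> h \<in> H \<Longrightarrow> g \<otimes> h = h \<otimes> g"
  shows "torus_in G (closure H)"
  unfolding torus_in_def
proof (intro conjI ballI)
  have cl: "closure H \<subseteq> {x. f x \<in> closure H}" if "H \<subseteq> {x. f x \<in> closure H}" "continuous_on UNIV f"
    for f :: "'a \<Rightarrow> 'a"
  proof (rule closure_minimal[OF that(1)])
    have "closed (f -` closure H)"
      using that(2) by (intro closed_vimage closed_closure)
    then show "closed {x. f x \<in> closure H}"
      by (simp add: vimage_def)
  qed
  have in_cl: "x \<in> H \<Longrightarrow> x \<in> closure H" for x
    using closure_subset by blast
  have 1: "x \<otimes> y \<in> closure H" if "x \<in> H" "y \<in> closure H" for x y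
  proof -
    have "continuous_on UNIV (\<lambda>y. x \<otimes> y)"
      by (intro continuous_on_mult continuous_on_const continuous_on_id)
    then have "closure H \<subseteq> {y. x \<otimes> y \<in> closure H}"
      using that subgroup.m_closed[OF H(1)] in_cl by (intro cl) auto
    then show ?thesis
      using that by auto
  qed
  have 2: "x \<otimes> y \<in> closure H" if "x \<in> closure H" "y \<in> closure H" for x y
  proof -
    have "continuous_on UNIV (\<lambda>x. x \<otimes> y)"
      by (intro continuous_on_mult continuous_on_const continuous_on_id)
    then have "closure H \<subseteq> {x. x \<otimes> y \<in> closure H}"
      using that 1 by (intro cl) auto
    then show ?thesis
      using that by auto
  qed
  have 3: "inv x \<in> closure H" if "x \<in> closure H" for x
  proof -
    have "continuous_on UNIV (\<lambda>x. inv x)"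
      by (intro continuous_on_inv continuous_on_id)
    then have "closure H \<subseteq> {x. inv x \<in> closure H}"
      using subgroup.m_inv_closed[OF H(1)] in_cl by (intro cl) auto
    then show ?thesis
      using that by auto
  qed
  show "subgroup (closure H) G"
    using 2 3 in_cl[OF subgroup.one_closed[OF H(1)]] by (intro subgroupI) auto
  show "compact (closure H)"
    using compact_Int_closed[OF compact closed_closure] by simp
  show "connected (closure H)"
    using H(2) by (rule connected_imp_connected_closure)
  have c1: "x \<otimes> y = y \<otimes> x" if "x \<in> H" "y \<in> closure H" for x y
  proof -
    have "closed {y. x \<otimes> y = y \<otimes> x}"
      by (intro closed_Collect_eq continuous_intros)
    then have "closure H \<subseteq> {y. x \<otimes> y = y \<otimes> x}"
      using H(3) that by (intro closure_minimal) auto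
    then show ?thesis
      using that by auto
  qed
  fix x y
  assume "x \<in> closure H" "y \<in> closure H"
  moreover have "closed {x. x \<otimes> y = y \<otimes> x}"
    by (intro closed_Collect_eq continuous_intros)
  ultimately show "x \<otimes> y = y \<otimes> x"
    using closure_minimal[of H "{x. x \<otimes> y = y \<otimes> x}"] c1 by auto
qed

text \<open>By maximality, \<open>T\<close> contains \<open>\<gamma>\<close>, since the closure of \<open>T \<gamma>(\<real>)\<close> is a torus.\<close>

lemma torus_one_param:
  assumes X: "X \<in> \<t>"
  obtains \<gamma> where "one_param G c X \<gamma>" "range \<gamma> \<subseteq> T"
proof -
  obtain \<gamma> where \<gamma>: "one_param G c X \<gamma>"
    using one_param_exists by blast
  have comm: "s \<otimes> \<gamma> t = \<gamma> t \<otimes> s" if "s \<in> T" for s t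
  proof -
    \<comment> \<open>Conjugation by \<open>s\<close> fixes the velocity \<open>X\<close>, so
      uniqueness makes it fix the whole curve.\<close>
    have "one_param G c X (\<lambda>t. s \<otimes> \<gamma> t \<otimes> inv s)"
      using one_param_conj[OF \<gamma>, of s] X that by (simp add: torus_dual_def)
    then have "s \<otimes> \<gamma> t \<otimes> inv s = \<gamma> t"
      using one_param_unique[OF _ \<gamma>] by metis
    then show ?thesis
      by (simp add: inv_solve_right')
  qed
  define H where "H = (\<lambda>p. fst p \<otimes> \<gamma> (snd p)) ` (T \<times> UNIV)"
  have prod: "(s \<otimes> \<gamma> a) \<otimes> (t \<otimes> \<gamma> b) = (s \<otimes> t) \<otimes> \<gamma> (a + b)" if "t \<in> T" for s t a b
  proof -
    have "(s \<otimes> \<gamma> a) \<otimes> (t \<otimes> \<gamma> b) = s \<otimes> (\<gamma> a \<otimes> t) \<otimes> \<gamma> b"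
      by (simp add: m_assoc)
    also have "\<dots> = (s \<otimes> t) \<otimes> \<gamma> (a + b)"
      by (simp add: comm[OF that, symmetric] m_assoc one_param_D(1)[OF \<gamma>])
    finally show ?thesis .
  qed
  have H_mem: "s \<otimes> \<gamma> a \<in> H" if "s \<in> T" for s a
    using that by (force simp: H_def)
  have "subgroup H G"
  proof (rule subgroupI)
    show "H \<noteq> {}"
      using H_mem subgroup.one_closed[OF T(1)] by blast
    fix x assume "x \<in> H"
    then obtain s a where x: "x = s \<otimes> \<gamma> a" "s \<in> T"
      by (auto simp: H_def)
    have "x \<otimes> (inv s \<otimes> \<gamma> (- a)) = \<one>"
      using prod[of "inv s" s a "-a"] x subgroup.m_inv_closed[OF T(1)] one_param_D(2)[OF \<gamma>] by simp
    then have "inv x = inv s \<otimes> \<gamma> (- a)"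
      by (metis UNIV_I carrier inv_unique' inv_inv inv_equality inv_comm)
    then show "inv x \<in> H"
      using H_mem x subgroup.m_inv_closed[OF T(1)] by simp
    fix y assume "y \<in> H"
    then obtain t b where "y = t \<otimes> \<gamma> b" "t \<in> T"
      by (auto simp: H_def)
    then show "x \<otimes> y \<in> H"
      using x prod H_mem subgroup.m_closed[OF T(1)] by simp
  qed auto
  moreover have "connected H"
    unfolding H_def
    using T(3) one_param_D(3)[OF \<gamma>]
    by (intro connected_continuous_image connected_Times connected_UNIV continuous_on_mult
        continuous_on_fst continuous_on_id continuous_on_compose2[OF one_param_D(3)[OF \<gamma>]]
        continuous_on_snd) auto
  moreover have "g \<otimes> h = h \<otimes> g" if "g \<in> H" "h \<in> H" for g h
    using that prod T(4) by (auto simp: H_def add.commute)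
  ultimately have "torus_in G (closure H)"
    by (rule torus_in_closure)
  moreover have "T \<subseteq> closure H"
  proof
    fix s assume "s \<in> T"
    then have "s \<in> H"
      using H_mem[of s 0] one_param_D(2)[OF \<gamma>] by simp
    then show "s \<in> closure H"
      using closure_subset by blast
  qed
  ultimately have "closure H = T"
    by (rule T_max)
  moreover have "\<gamma> t \<in> H" for t
    using H_mem[of \<one> t] subgroup.one_closed[OF T(1)] by simp
  ultimately have "range \<gamma> \<subseteq> T"
    using closure_subset by blast
  with \<gamma> show thesis
    by (rule that)
qed

text \<open>Together with \<open>torus_one_param\<close> this identifies \<open>\<t>\<close>,
  defined by invariance, with the Lie algebra of \<open>T\<close>.\<close>

lemma one_param_torus:
  assumes \<gamma>: "one_param G c X \<gamma>" and "range \<gamma> \<subseteq> T"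
  shows "X \<in> \<t>"
  using assms T(4) by (auto simp: torus_dual_def intro!: ad_fixed_of_commute[OF \<gamma>])

definition weight :: "'b \<Rightarrow> 'b \<Rightarrow> 'b \<Rightarrow> bool"
  where "weight \<alpha> U V \<longleftrightarrow> (\<forall>X \<gamma>. one_param G c X \<gamma> \<and> range \<gamma> \<subseteq> T \<longrightarrow>
    ad_group (\<gamma> 1) U = cos (B \<alpha> X) *\<^sub>R U - sin (B \<alpha> X) *\<^sub>R V \<and>
    ad_group (\<gamma> 1) V = sin (B \<alpha> X) *\<^sub>R U + cos (B \<alpha> X) *\<^sub>R V)"

abbreviation \<Delta> :: "'b set"
  where "\<Delta> \<equiv> roots G UNIV c B T"

lemma roots_iff: "\<alpha> \<in> \<Delta> \<longleftrightarrow> \<alpha> \<in> \<t> \<and> \<alpha> \<noteq> 0 \<and> (\<exists>U V. (U, V) \<noteq> (0, 0) \<and> weight \<alpha> U V)"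
  by (auto simp: roots_def weight_def)

text \<open>A weight is tested at time 1 only; replacing \<open>X\<close> by
  \<open>s *\<^sub>R X\<close> reaches every time \<open>s\<close>.\<close>

lemma weight_one_param:
  assumes w: "weight \<alpha> U V" and \<gamma>: "one_param G c X \<gamma>" "range \<gamma> \<subseteq> T"
  shows "ad_group (\<gamma> s) U = cos (s * B \<alpha> X) *\<^sub>R U - sin (s * B \<alpha> X) *\<^sub>R V"
    and "ad_group (\<gamma> s) V = sin (s * B \<alpha> X) *\<^sub>R U + cos (s * B \<alpha> X) *\<^sub>R V"
  using w one_param_scale[OF \<gamma>(1), of s] \<gamma>(2) unfolding weight_def
  by (auto simp: form_simps dest!: spec[of _ "s *\<^sub>R X"] spec[of _ "\<lambda>t. \<gamma> (s * t)"])

text \<open>The infinitesimal form: \<open>X\<close> multiplies \<open>U + i V\<close> by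
  \<open>i * B \<alpha> X\<close>.\<close>

lemma weight_bracket:
  assumes w: "weight \<alpha> U V" and X: "X \<in> \<t>"
  shows "bracket X U = - B \<alpha> X *\<^sub>R V" "bracket X V = B \<alpha> X *\<^sub>R U"
proof -
  obtain \<gamma> where \<gamma>: "one_param G c X \<gamma>" "range \<gamma> \<subseteq> T"
    using torus_one_param[OF X] .
  show "bracket X U = - B \<alpha> X *\<^sub>R V" "bracket X V = B \<alpha> X *\<^sub>R U"
    by (rule bracket_unique[OF one_param_D(5)[OF \<gamma>(1)]],
        auto simp: weight_one_param[OF w \<gamma>] intro!: derivative_eq_intros)+
qed

text \<open>Root vectors are orthogonal: choose \<open>X\<close> such that \<open>exp X\<close> acts on them with opposite signs.\<close>

lemma weight_orthogonal:
  assumes w: "weight \<alpha> U V" "weight \<alpha>' U' V'" and "\<alpha> \<in> \<t>" "\<alpha>' \<in> \<t>" "\<alpha> \<noteq> \<alpha>'"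
  shows "B U U' + B V V' = 0"
proof -
  define X where "X = (pi / B (\<alpha> - \<alpha>') (\<alpha> - \<alpha>')) *\<^sub>R (\<alpha> - \<alpha>')"
  have "X \<in> \<t>"
    using assms subspace_t by (simp add: X_def subspace_diff subspace_scale)
  then obtain \<gamma> where \<gamma>: "one_param G c X \<gamma>" "range \<gamma> \<subseteq> T"
    using torus_one_param by blast
  have "B (\<alpha> - \<alpha>') X = pi"
    using assms(5) by (simp add: X_def scaleR_right)
  then have a: "B \<alpha> X = pi + B \<alpha>' X"
    by (simp add: form_simps)
  define p where "p = cos (B \<alpha>' X)"
  define q where "q = sin (B \<alpha>' X)"
  have "B U U' + B V V' = B (ad_group (\<gamma> 1) U) (ad_group (\<gamma> 1) U') + B (ad_group (\<gamma> 1) V) (ad_group (\<gamma> 1) V')"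
    by (simp add: ad_form)
  also have "\<dots> = B (- p *\<^sub>R U + q *\<^sub>R V) (p *\<^sub>R U' - q *\<^sub>R V') +
      B (- q *\<^sub>R U - p *\<^sub>R V) (q *\<^sub>R U' + p *\<^sub>R V')"
    unfolding weight_one_param[OF w(1) \<gamma>] weight_one_param[OF w(2) \<gamma>] mult_1
    by (simp add: a sin_add cos_add p_def q_def)
  also have "\<dots> = - (q\<^sup>2 + p\<^sup>2) * (B U U' + B V V')"
    by (simp add: form_simps algebra_simps power2_eq_square)
  also have "q\<^sup>2 + p\<^sup>2 = 1"
    by (simp add: p_def q_def)
  finally show ?thesis
    by simp
qed

text \<open>One root vector is chosen for each root; orthogonality makes the choice injective and
  its values independent in a finite-dimensional space.\<close>

lemma finite_roots: "finite \<Delta>"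
proof -
  interpret prod: inner_form "\<lambda>p q. B (fst p) (fst q) + B (snd p) (snd q)"
    by (rule inner_form_prod)
  have "\<forall>\<alpha>\<in>\<Delta>. \<exists>Z. Z \<noteq> 0 \<and> weight \<alpha> (fst Z) (snd Z)"
    by (auto simp: roots_iff zero_prod_def)
  then obtain f where f: "\<And>\<alpha>. \<alpha> \<in> \<Delta> \<Longrightarrow> f \<alpha> \<noteq> 0 \<and> weight \<alpha> (fst (f \<alpha>)) (snd (f \<alpha>))"
    by metis
  have orth: "B (fst (f \<alpha>)) (fst (f \<beta>)) + B (snd (f \<alpha>)) (snd (f \<beta>)) = 0"
    if "\<alpha> \<in> \<Delta>" "\<beta> \<in> \<Delta>" "\<alpha> \<noteq> \<beta>" for \<alpha> \<beta>
    using f that by (intro weight_orthogonal[of \<alpha> _ _ \<beta>]) (auto simp: roots_iff)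
  have "inj_on f \<Delta>"
  proof (rule inj_onI, rule ccontr)
    fix \<alpha> \<beta>
    assume *: "\<alpha> \<in> \<Delta>" "\<beta> \<in> \<Delta>" "f \<alpha> = f \<beta>" "\<alpha> \<noteq> \<beta>"
    show False
      using orth[OF *(1,2,4)] f[OF *(2)] prod.eq_0_iff[of "f \<beta>"] *(3) by simp
  qed
  moreover have "finite (f ` \<Delta>)"
  proof (rule prod.finite_orthogonal)
    show "0 \<notin> f ` \<Delta>"
      using f by force
    show "B (fst x) (fst y) + B (snd x) (snd y) = 0" if "x \<in> f ` \<Delta>" "y \<in> f ` \<Delta>" "x \<noteq> y" for x y
      using that orth by auto
  qed
  ultimately show ?thesis
    by (simp add: finite_image_iff)
qed

text \<open>The complex conjugate \<open>U - i V\<close> of a root vector has the opposite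
  weight.\<close>

lemma uminus_roots: "\<alpha> \<in> \<Delta> \<Longrightarrow> - \<alpha> \<in> \<Delta>"
proof -
  assume "\<alpha> \<in> \<Delta>"
  then obtain U V where "\<alpha> \<in> \<t>" "\<alpha> \<noteq> 0" "(U, V) \<noteq> (0, 0)" "weight \<alpha> U V"
    by (auto simp: roots_iff)
  moreover from this(4) have "weight (- \<alpha>) U (- V)"
    by (auto simp: weight_def form_simps linear_neg[OF linear_ad])
  ultimately show ?thesis
    using subspace_neg[OF subspace_t] unfolding roots_iff by (metis neg_equal_0_iff_equal prod.inject)
qed


lemma weight_D:
  assumes "weight \<alpha> U V" "one_param G c X \<gamma>" "range \<gamma> \<subseteq> T"
  shows "ad_group (\<gamma> 1) U = cos (B \<alpha> X) *\<^sub>R U - sin (B \<alpha> X) *\<^sub>R V"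
    and "ad_group (\<gamma> 1) V = sin (B \<alpha> X) *\<^sub>R U + cos (B \<alpha> X) *\<^sub>R V"
  using assms unfolding weight_def by blast+

lemma subspace_weight: "subspace {z. weight \<alpha> (fst z) (snd z)}"
proof (rule subspaceI)
  note ad = linear_add[OF linear_ad] linear_scale[OF linear_ad] linear_0[OF linear_ad]
  show "0 \<in> {z. weight \<alpha> (fst z) (snd z)}"
    by (simp add: weight_def ad)
  fix x y and k :: real
  assume x: "x \<in> {z. weight \<alpha> (fst z) (snd z)}" and y: "y \<in> {z. weight \<alpha> (fst z) (snd z)}"
  have "weight \<alpha> (fst x + fst y) (snd x + snd y)"
    unfolding weight_def
    using x y by (auto simp: ad weight_D algebra_simps)
  then show "x + y \<in> {z. weight \<alpha> (fst z) (snd z)}"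
    by simp
  have "weight \<alpha> (k *\<^sub>R fst x) (k *\<^sub>R snd x)"
    unfolding weight_def
    using x by (auto simp: ad weight_D scaleR_diff_right scaleR_add_right mult.commute)
  then show "k *\<^sub>R x \<in> {z. weight \<alpha> (fst z) (snd z)}"
    by simp
qed

text \<open>
  The weight space of \<open>\<alpha>\<close> is defined by the action of the exponentials in \<open>T\<close> only. A minimal
  subspace invariant under \<open>T\<close> and the complex structure \<open>J (U, V) = (-V, U)\<close> consists of joint
  eigenvectors of the whole of \<open>T\<close>, since \<open>A + A\<^sup>-\<^sup>1\<close> and \<open>J (A - A\<^sup>-\<^sup>1)\<close> are self-adjoint for isometric \<open>A\<close>.
\<close>

lemma root_vector:
  assumes "\<alpha> \<in> \<Delta>"
  obtains U V where "(U, V) \<noteq> (0, 0)" "weight \<alpha> U V"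
    and "\<And>s. s \<in> T \<Longrightarrow> \<exists>p q. p\<^sup>2 + q\<^sup>2 = 1 \<and>
      ad_group s U = p *\<^sub>R U + q *\<^sub>R V \<and> ad_group s V = p *\<^sub>R V - q *\<^sub>R U"
proof -
  let ?B = "\<lambda>p q. B (fst p) (fst q) + B (snd p) (snd q)"
  interpret prod: inner_form ?B
    by (rule inner_form_prod)
  define J :: "'b \<times> 'b \<Rightarrow> 'b \<times> 'b" where "J z = (- snd z, fst z)" for z
  define Ad2 :: "'a \<Rightarrow> 'b \<times> 'b \<Rightarrow> 'b \<times> 'b" where "Ad2 s z = (ad_group s (fst z), ad_group s (snd z))" for s z
  define F where "F = insert J (Ad2 ` T)"
  define W where "W = {z. weight \<alpha> (fst z) (snd z)}"
  note ad = linear_add[OF linear_ad] linear_scale[OF linear_ad] linear_neg[OF linear_ad]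
    linear_diff[OF linear_ad] linear_0[OF linear_ad]
  have lin: "linear J" "linear (Ad2 s)" for s
    by (auto intro!: linearI simp: J_def Ad2_def ad)
  have "subspace W"
    unfolding W_def by (rule subspace_weight)
  moreover have "W \<noteq> {0}"
  proof -
    obtain U V where "(U, V) \<noteq> (0, 0)" "weight \<alpha> U V"
      using assms by (auto simp: roots_iff)
    then have "(U, V) \<in> W" "(U, V) \<noteq> 0"
      by (simp_all add: W_def zero_prod_def)
    then show ?thesis
      by blast
  qed
  moreover have "f ` W \<subseteq> W" if f: "f \<in> F" for f
  proof (cases "f = J")
    case True
    then show ?thesis
      by (auto simp: W_def J_def weight_def ad algebra_simps)
  next
    case False
    then obtain s where s: "s \<in> T" "f = Ad2 s"
      using f by (auto simp: F_def)
    have "weight \<alpha> (ad_group s U) (ad_group s V)" if w: "weight \<alpha> U V" for U V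
      unfolding weight_def
    proof (intro allI impI)
      fix X \<gamma>
      assume *: "one_param G c X \<gamma> \<and> range \<gamma> \<subseteq> T"
      then have "\<gamma> 1 \<otimes> s = s \<otimes> \<gamma> 1"
        using s T(4) by blast
      then have "ad_group (\<gamma> 1) (ad_group s Y) = ad_group s (ad_group (\<gamma> 1) Y)" for Y
        by (metis ad_mult)
      then show "ad_group (\<gamma> 1) (ad_group s U) = cos (B \<alpha> X) *\<^sub>R ad_group s U - sin (B \<alpha> X) *\<^sub>R ad_group s V \<and>
          ad_group (\<gamma> 1) (ad_group s V) = sin (B \<alpha> X) *\<^sub>R ad_group s U + cos (B \<alpha> X) *\<^sub>R ad_group s V"
        using weight_D[OF w, of X \<gamma>] * by (simp add: ad)
    qed
    then show ?thesis
      by (auto simp: s W_def Ad2_def)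
  qed
  ultimately obtain S where S: "subspace S" "S \<subseteq> W" "S \<noteq> {0}" "\<And>f. f \<in> F \<Longrightarrow> f ` S \<subseteq> S"
    and min: "\<And>S'. subspace S' \<Longrightarrow> S' \<subseteq> S \<Longrightarrow> S' \<noteq> {0} \<Longrightarrow> \<forall>f\<in>F. f ` S' \<subseteq> S' \<Longrightarrow> S' = S"
    by (rule minimal_invariant_subspace[of W F]) (assumption | rule that)+
  have F_lin: "linear f" if "f \<in> F" for f
    using that lin by (auto simp: F_def)
  have JS: "J z \<in> S" and TS: "s \<in> T \<Longrightarrow> Ad2 s z \<in> S" if "z \<in> S" for z s
    using S(4) that by (auto simp: F_def)
  have T_inv: "inv s \<in> T" if "s \<in> T" for s
    using subgroup.m_inv_closed[OF T(1) that] .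
  have swap: "B (ad_group s x) y = B x (ad_group (inv s) y)" for s x y
    using ad_form[of s x "ad_group (inv s) y"] by simp
  have comm: "Ad2 s (f z) = f (Ad2 s z)" if f: "f \<in> F" and s: "s \<in> T" for f s z
  proof (cases "f = J")
    case False
    then obtain r where r: "r \<in> T" "f = Ad2 r"
      using f by (auto simp: F_def)
    then have "ad_group s (ad_group r Y) = ad_group r (ad_group s Y)" for Y
      using s T(4) by (metis ad_mult)
    then show ?thesis
      by (simp add: r Ad2_def)
  qed (simp add: J_def Ad2_def ad)
  have J_comm: "J (f z) = f (J z)" if "f \<in> F" for f z
    using that by (auto simp: F_def J_def Ad2_def ad)
  have scalar: "\<exists>p q. \<forall>z\<in>S. Ad2 s z = p *\<^sub>R z + q *\<^sub>R J z" if s: "s \<in> T" for s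
  proof -
    \<comment> \<open>The adjoint of the isometry \<open>Ad2 s\<close> is
      \<open>Ad2 (inv s)\<close>, and \<open>J\<close> is skew and commutes with both; this makes
      \<open>C\<close> and \<open>K\<close> self-adjoint.\<close>
    define C where "C z = Ad2 s z + Ad2 (inv s) z" for z
    define K where "K z = J (Ad2 s z - Ad2 (inv s) z)" for z
    have lin': "linear C" "linear K"
      by (auto intro!: linearI simp: C_def K_def J_def Ad2_def ad algebra_simps)
    have inS: "C z \<in> S" "K z \<in> S" if "z \<in> S" for z
      using that TS[OF that s] TS[OF that T_inv[OF s]] JS S(1)
      by (auto simp: C_def K_def subspace_add subspace_diff)
    have commC: "C (f z) = f (C z)" if "f \<in> F" for f z
      using comm[OF that s] comm[OF that T_inv[OF s]]
      by (simp add: C_def linear_add[OF F_lin[OF that]])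
    have commK: "K (f z) = f (K z)" if "f \<in> F" for f z
    proof -
      have "Ad2 s (f z) - Ad2 (inv s) (f z) = f (Ad2 s z - Ad2 (inv s) z)"
        using comm[OF that s] comm[OF that T_inv[OF s]] by (simp add: linear_diff[OF F_lin[OF that]])
      then show ?thesis
        by (simp add: K_def J_comm[OF that])
    qed
    have adjC: "?B (C x) y = ?B x (C y)" for x y
      by (simp add: C_def Ad2_def form_simps swap)
    have adjK: "?B (K x) y = ?B x (K y)" for x y
      by (simp add: K_def J_def Ad2_def form_simps swap ad)
    obtain p where p: "\<And>z. z \<in> S \<Longrightarrow> C z = p *\<^sub>R z"
      using prod.self_adjoint_scalar[OF S(1,3) min F_lin S(4) lin'(1) inS(1) adjC commC] by blast
    obtain q where q: "\<And>z. z \<in> S \<Longrightarrow> K z = q *\<^sub>R z"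
      using prod.self_adjoint_scalar[OF S(1,3) min F_lin S(4) lin'(2) inS(2) adjK commK] by blast
    \<comment> \<open>Since \<open>J\<close> squares to -1, \<open>Ad2 s\<close> is half of
      \<open>C - J K\<close>.\<close>
    have "Ad2 s z = (p / 2) *\<^sub>R z + (- q / 2) *\<^sub>R J z" if z: "z \<in> S" for z
    proof -
      have JJ: "J (J x) = - x" for x
        by (simp add: J_def prod_eq_iff)
      have "J (K z) = - (Ad2 s z - Ad2 (inv s) z)"
        by (simp add: K_def JJ)
      moreover have "J (K z) = q *\<^sub>R J z"
        by (simp add: q[OF z] linear_scale[OF lin(1)])
      ultimately have "Ad2 s z - Ad2 (inv s) z = - q *\<^sub>R J z"
        by (metis minus_minus scaleR_minus_left)
      moreover have "Ad2 s z + Ad2 (inv s) z = p *\<^sub>R z"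
        using p[OF z] by (simp add: C_def)
      ultimately have "2 *\<^sub>R Ad2 s z = p *\<^sub>R z + (- q) *\<^sub>R J z"
        by (simp add: scaleR_2 algebra_simps)
      then have "(1/2) *\<^sub>R (2 *\<^sub>R Ad2 s z) = (1/2) *\<^sub>R (p *\<^sub>R z + (- q) *\<^sub>R J z)"
        by simp
      then show ?thesis
        by (simp add: scaleR_add_right scaleR_diff_right)
    qed
    then show ?thesis
      by blast
  qed
  obtain z where z: "z \<in> S" "z \<noteq> 0"
    using S(1,3) subspace_0 by blast
  show thesis
  proof
    show "(fst z, snd z) \<noteq> (0, 0)"
      using z by (simp add: zero_prod_def)
    show "weight \<alpha> (fst z) (snd z)"
      using z S(2) by (auto simp: W_def)
    fix s assume s: "s \<in> T"
    then obtain p q where pq: "Ad2 s z = p *\<^sub>R z + q *\<^sub>R J z"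
      using scalar z by blast
    have "?B (Ad2 s z) (Ad2 s z) = ?B z z"
      by (simp add: Ad2_def ad_form)
    moreover have "?B (Ad2 s z) (Ad2 s z) = (p\<^sup>2 + q\<^sup>2) * ?B z z"
      unfolding pq by (simp add: J_def form_simps sym[of "snd z" "fst z"] algebra_simps power2_eq_square)
    ultimately have "p\<^sup>2 + q\<^sup>2 = 1"
      using prod.eq_0_iff[of z] z by simp
    \<comment> \<open>The sign of \<open>q\<close> changes because the first component of
      \<open>J z\<close> is \<open>- snd z\<close>.\<close>
    then have "p\<^sup>2 + (- q)\<^sup>2 = 1 \<and> ad_group s (fst z) = p *\<^sub>R fst z + (- q) *\<^sub>R snd z \<and>
        ad_group s (snd z) = p *\<^sub>R snd z - (- q) *\<^sub>R fst z"
      using pq by (simp add: prod_eq_iff Ad2_def J_def)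
    then show "\<exists>p q. p\<^sup>2 + q\<^sup>2 = 1 \<and> ad_group s (fst z) = p *\<^sub>R fst z + q *\<^sub>R snd z \<and>
        ad_group s (snd z) = p *\<^sub>R snd z - q *\<^sub>R fst z"
      by blast
  qed
qed

text \<open>
  \<open>\<alpha>\<close>, \<open>U\<close> and \<open>V\<close> span a copy of \<open>su(2)\<close>, in which \<open>Ad (exp (s U))\<close> rotates the plane of \<open>\<alpha>\<close> and \<open>V\<close>;
  rotating by \<open>\<pi>\<close> gives the reflection.
\<close>

lemma reflection_in_group:
  assumes \<alpha>: "\<alpha> \<in> \<Delta>"
  obtains n where "\<And>X. X \<in> \<t> \<Longrightarrow> ad_group n X = reflect \<alpha> X"
proof -
  have \<alpha>t: "\<alpha> \<in> \<t>" and "\<alpha> \<noteq> 0"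
    using \<alpha> by (auto simp: roots_iff)
  then have \<alpha>\<alpha>: "B \<alpha> \<alpha> > 0"
    by (intro pos)
  obtain U V where UV: "(U, V) \<noteq> (0, 0)" and w: "weight \<alpha> U V"
    and T_act: "\<And>s. s \<in> T \<Longrightarrow> \<exists>p q. p\<^sup>2 + q\<^sup>2 = 1 \<and>
      ad_group s U = p *\<^sub>R U + q *\<^sub>R V \<and> ad_group s V = p *\<^sub>R V - q *\<^sub>R U"
    using root_vector[OF \<alpha>] by blast
  note br = weight_bracket[OF w]
  have "V \<noteq> 0"
  proof
    assume "V = 0"
    then have "B \<alpha> \<alpha> *\<^sub>R U = 0"
      using br(2)[OF \<alpha>t] linear_0[OF linear_bracket_right] by simp
    then show False
      using UV \<open>V = 0\<close> \<open>\<alpha> \<noteq> 0\<close> by simp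
  qed
  then have VV: "B V V > 0"
    by (rule pos)
  have "bracket U V \<in> \<t>"
    unfolding torus_dual_def
  proof (intro CollectI conjI ballI)
    fix s assume "s \<in> T"
    then obtain p q where pq: "p\<^sup>2 + q\<^sup>2 = 1"
      "ad_group s U = p *\<^sub>R U + q *\<^sub>R V" "ad_group s V = p *\<^sub>R V - q *\<^sub>R U"
      using T_act by blast
    \<comment> \<open>The bracket is alternating, so \<open>s\<close> scales it by the determinant
      \<open>p\<^sup>2 + q\<^sup>2\<close> of its action on the pair.\<close>
    have "ad_group s (bracket U V) = p *\<^sub>R p *\<^sub>R bracket U V - q *\<^sub>R q *\<^sub>R bracket V U"
      by (simp add: ad_bracket pq bracket_simps bracket_self[of U] bracket_self[of V])
    also have "\<dots> = (p\<^sup>2 + q\<^sup>2) *\<^sub>R bracket U V"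
      by (simp add: bracket_antisym[of V U] scaleR_add_left power2_eq_square)
    finally show "ad_group s (bracket U V) = bracket U V"
      by (simp add: pq)
  qed simp
  then have D: "bracket U V + B V V *\<^sub>R \<alpha> \<in> \<t>" (is "?D \<in> _")
    using subspace_t \<alpha>t by (simp add: subspace_add subspace_scale)
  have UX: "bracket U X = B \<alpha> X *\<^sub>R V" if "X \<in> \<t>" for X
    using br(1)[OF that] bracket_antisym[of U X] by simp
  \<comment> \<open>As \<open>?D\<close> lies in \<open>\<t>\<close>, skewness gives \<open>B
    (bracket U V) ?D = - B V (bracket U ?D) = - B \<alpha> ?D * B V V\<close>, which cancels the
    contribution of the other summand.\<close>
  have "B ?D ?D = 0"
    using bracket_skew[of U V ?D] UX[OF D] by (simp add: add_left scaleR_left scaleR_right)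
  then have UV_eq: "bracket U V = - B V V *\<^sub>R \<alpha>"
    by (simp add: add_eq_0_iff)
  obtain \<gamma> where \<gamma>: "one_param G c U \<gamma>"
    using one_param_exists by blast
  note deriv = one_param_ad_deriv[OF \<gamma>]
  \<comment> \<open>The angular frequency: along \<open>\<gamma>\<close> the image of
    \<open>\<alpha>\<close> changes by \<open>B \<alpha> \<alpha>\<close> times that of
    \<open>V\<close>, and the image of \<open>V\<close> by \<open>- B V V\<close> times that of
    \<open>\<alpha>\<close>. A half turn thus takes time \<open>pi / \<omega>\<close>.\<close>
  define \<omega> where "\<omega> = sqrt (B \<alpha> \<alpha> * B V V)"
  have \<omega>: "\<omega> > 0" "\<omega> * \<omega> = B \<alpha> \<alpha> * B V V"
    using \<alpha>\<alpha> VV by (simp_all add: \<omega>_def)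
  define n where "n = \<gamma> (pi / \<omega>)"
  have fixed: "ad_group n X = X" if X: "X \<in> \<t>" "B \<alpha> X = 0" for X
  proof -
    have "((\<lambda>s. ad_group (\<gamma> s) X) has_vector_derivative 0) (at s within UNIV)" for s
      using deriv[of X s] UX[OF X(1)] X(2) linear_0[OF linear_ad] by simp
    then have "ad_group (\<gamma> (pi / \<omega>)) X = ad_group (\<gamma> 0) X"
      by (metis has_vector_derivative_zero_constant[OF convex_UNIV] UNIV_I)
    then show ?thesis
      by (simp add: n_def one_param_D(2)[OF \<gamma>])
  qed
  have rot: "ad_group n \<alpha> = - \<alpha>"
  proof -
    define k where "k = B \<alpha> \<alpha> / \<omega>"
    have k: "\<omega> * k = B \<alpha> \<alpha>" "k * B V V = \<omega>"
      using \<omega> by (simp_all add: k_def field_simps)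
    \<comment> \<open>The combination that undoes the rotation and is therefore constant;
      \<open>k *\<^sub>R V\<close> has the length of \<open>\<alpha>\<close>. At
      \<open>pi / \<omega>\<close> the sine vanishes and the cosine is -1.\<close>
    define f where "f s = cos (\<omega> * s) *\<^sub>R ad_group (\<gamma> s) \<alpha> - (sin (\<omega> * s) * k) *\<^sub>R ad_group (\<gamma> s) V" for s
    have "(f has_vector_derivative 0) (at s within UNIV)" for s
    proof -
      let ?a = "ad_group (\<gamma> s) \<alpha>" and ?v = "ad_group (\<gamma> s) V"
      have d\<alpha>: "((\<lambda>s. ad_group (\<gamma> s) \<alpha>) has_vector_derivative B \<alpha> \<alpha> *\<^sub>R ?v) (at s)"
        using deriv[of \<alpha> s] UX[OF \<alpha>t] linear_scale[OF linear_ad] by simp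
      have dV: "((\<lambda>s. ad_group (\<gamma> s) V) has_vector_derivative (- B V V) *\<^sub>R ?a) (at s)"
        using deriv[of V s] UV_eq linear_scale[OF linear_ad, of _ "- B V V" \<alpha>] by simp
      have dc: "((\<lambda>s. cos (\<omega> * s)) has_vector_derivative - (\<omega> * sin (\<omega> * s))) (at s)"
        unfolding has_real_derivative_iff_has_vector_derivative[symmetric]
        by (auto intro!: derivative_eq_intros)
      have ds: "((\<lambda>s. sin (\<omega> * s) * k) has_vector_derivative cos (\<omega> * s) * \<omega> * k) (at s)"
        unfolding has_real_derivative_iff_has_vector_derivative[symmetric]
        by (auto intro!: derivative_eq_intros)
      have "(f has_vector_derivative
          (cos (\<omega> * s) *\<^sub>R B \<alpha> \<alpha> *\<^sub>R ?v + (- (\<omega> * sin (\<omega> * s))) *\<^sub>R ?a) -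
          ((sin (\<omega> * s) * k) *\<^sub>R (- B V V) *\<^sub>R ?a + (cos (\<omega> * s) * \<omega> * k) *\<^sub>R ?v)) (at s)"
        unfolding f_def
        by (intro has_vector_derivative_diff
            bounded_bilinear.has_vector_derivative[OF bounded_bilinear_scaleR] d\<alpha> dV dc ds)
      also have "(cos (\<omega> * s) *\<^sub>R B \<alpha> \<alpha> *\<^sub>R ?v + (- (\<omega> * sin (\<omega> * s))) *\<^sub>R ?a) -
          ((sin (\<omega> * s) * k) *\<^sub>R (- B V V) *\<^sub>R ?a + (cos (\<omega> * s) * \<omega> * k) *\<^sub>R ?v) =
          (cos (\<omega> * s) * (B \<alpha> \<alpha> - \<omega> * k)) *\<^sub>R ?v + (sin (\<omega> * s) * (k * B V V - \<omega>)) *\<^sub>R ?a"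
        by (simp add: algebra_simps)
      also have "\<dots> = 0"
        by (simp add: k)
      finally show ?thesis
        by simp
    qed
    then have "f (pi / \<omega>) = f 0"
      by (metis has_vector_derivative_zero_constant[OF convex_UNIV] UNIV_I)
    then have "- ad_group n \<alpha> = \<alpha>"
      using \<omega> by (simp add: f_def n_def one_param_D(2)[OF \<gamma>])
    then show ?thesis
      by (metis minus_minus)
  qed
  show thesis
  proof
    fix X assume X: "X \<in> \<t>"
    define k where "k = B \<alpha> X / B \<alpha> \<alpha>"
    have "ad_group n (X - k *\<^sub>R \<alpha>) = X - k *\<^sub>R \<alpha>"
      using X \<alpha>t \<alpha>\<alpha> subspace_t
      by (intro fixed) (auto simp: subspace_diff subspace_scale form_simps k_def)
    then have "ad_group n X = X - k *\<^sub>R \<alpha> - k *\<^sub>R \<alpha>"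
      by (simp add: linear_diff[OF linear_ad] linear_scale[OF linear_ad] rot algebra_simps)
    also have "\<dots> = X - (2 * k) *\<^sub>R \<alpha>"
      by (simp add: scaleR_2 diff_diff_eq flip: scaleR_scaleR)
    also have "\<dots> = reflect \<alpha> X"
      by (simp add: reflect_def k_def sym[of X \<alpha>])
    finally show "ad_group n X = reflect \<alpha> X" .
  qed
qed

text \<open>The element \<open>n\<close> acts on \<open>\<t>\<close> as the reflection, so
  conjugation by it preserves the family of one-parameter subgroups in \<open>T\<close>, and
  \<open>Ad n\<close> carries a root vector of \<open>\<beta>\<close> to one of the reflected
  root.\<close>

lemma reflect_roots:
  assumes \<alpha>: "\<alpha> \<in> \<Delta>" and \<beta>: "\<beta> \<in> \<Delta>"
  shows "reflect \<alpha> \<beta> \<in> \<Delta>"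
proof -
  obtain n where n: "\<And>X. X \<in> \<t> \<Longrightarrow> ad_group n X = reflect \<alpha> X"
    using reflection_in_group[OF \<alpha>] by blast
  have \<alpha>t: "\<alpha> \<in> \<t>" "\<alpha> \<noteq> 0"
    using \<alpha> by (auto simp: roots_iff)
  have refl_t: "reflect \<alpha> X \<in> \<t>" if "X \<in> \<t>" for X
    using that \<alpha>t subspace_t by (simp add: reflect_def subspace_diff subspace_scale)
  obtain U V where \<beta>t: "\<beta> \<in> \<t>" "\<beta> \<noteq> 0" and UV: "(U, V) \<noteq> (0, 0)" and w: "weight \<beta> U V"
    using \<beta> by (auto simp: roots_iff)
  have "weight (reflect \<alpha> \<beta>) (ad_group n U) (ad_group n V)"
    unfolding weight_def
  proof (intro allI impI)
    fix X \<gamma>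
    assume *: "one_param G c X \<gamma> \<and> range \<gamma> \<subseteq> T"
    then have X: "X \<in> \<t>"
      using one_param_torus by blast
    let ?X = "reflect \<alpha> X" and ?\<delta> = "\<lambda>s. inv n \<otimes> \<gamma> s \<otimes> n"
    have "ad_group n ?X = X"
      using n[OF refl_t[OF X]] reflect_reflect \<alpha>t by simp
    then have "ad_group (inv n) X = ?X"
      by (metis ad_inv(1))
    then have \<delta>: "one_param G c ?X ?\<delta>"
      using one_param_conj[of X \<gamma> "inv n"] * by simp
    \<comment> \<open>The conjugated curve has its velocity in \<open>\<t>\<close>; the
      one-parameter subgroup in \<open>T\<close> with the same velocity must be that curve.\<close>
    moreover obtain \<delta>' where "one_param G c ?X \<delta>'" "range \<delta>' \<subseteq> T"
      using torus_one_param[OF refl_t[OF X]] .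
    ultimately have "range ?\<delta> \<subseteq> T"
      using one_param_unique by metis
    with \<delta> w have act: "ad_group (?\<delta> 1) U = cos (B \<beta> ?X) *\<^sub>R U - sin (B \<beta> ?X) *\<^sub>R V"
      "ad_group (?\<delta> 1) V = sin (B \<beta> ?X) *\<^sub>R U + cos (B \<beta> ?X) *\<^sub>R V"
      unfolding weight_def by blast+
    have conj: "ad_group (\<gamma> 1) (ad_group n Y) = ad_group n (ad_group (?\<delta> 1) Y)" for Y
      by (simp flip: ad_mult add: m_assoc[symmetric])
    have "B \<beta> ?X = B (reflect \<alpha> \<beta>) X"
      by (simp add: reflect_def form_simps sym[of \<alpha> X])
    then show "ad_group (\<gamma> 1) (ad_group n U) = cos (B (reflect \<alpha> \<beta>) X) *\<^sub>R ad_group n U -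
          sin (B (reflect \<alpha> \<beta>) X) *\<^sub>R ad_group n V \<and>
        ad_group (\<gamma> 1) (ad_group n V) = sin (B (reflect \<alpha> \<beta>) X) *\<^sub>R ad_group n U +
          cos (B (reflect \<alpha> \<beta>) X) *\<^sub>R ad_group n V"
      unfolding conj act
      by (simp add: linear_add[OF linear_ad] linear_diff[OF linear_ad] linear_scale[OF linear_ad])
  qed
  moreover have "(ad_group n U, ad_group n V) \<noteq> (0, 0)"
    using UV ad_inv(1)[of n] linear_0[OF linear_ad] by (metis prod.inject)
  moreover have "reflect \<alpha> \<beta> \<noteq> 0"
  proof
    assume "reflect \<alpha> \<beta> = 0"
    then have "reflect \<alpha> (reflect \<alpha> \<beta>) = 0"
      by (simp add: reflect_def form_simps)
    then show False
      using \<beta>t reflect_reflect \<alpha>t by simp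
  qed
  ultimately show ?thesis
    using refl_t[OF \<beta>t(1)] by (auto simp: roots_iff)
qed

end

theorem theorem4p3:
  fixes G :: "('k::t2_space) monoid"
    and E :: "'e::euclidean_space set"
    and A :: "('k, 'e) chart set"
    and c :: "('k, 'e) chart"
    and B :: "'e \<Rightarrow> 'e \<Rightarrow> real"
    and T :: "'k set"
    and \<t> \<Delta> P :: "'e set"
    and lam \<mu> :: 'e
  assumes "lie_group G E A"
    and "compact (UNIV :: 'k set)"
    and "connected (UNIV :: 'k set)"
    and "c \<in> A" and "\<one>\<^bsub>G\<^esub> \<in> chart_dom c"
    and "maximal_torus G T"
    and "invariant_inner_product G E c B"
    and "\<t> = torus_dual G E c T"
    and "\<Delta> = roots G E c B T"
    and "positive_system B \<t> \<Delta> P"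
    and "lam \<in> (\<lambda>\<xi>. rhoK P + \<xi>) ` weyl_chamber B \<t> P"
    and "\<mu> \<in> \<t>"
  shows
    "(norm_wrt B (lam - \<mu>))\<^sup>2 \<ge> (1/2) * (\<Sum>\<alpha>\<in>{\<alpha>\<in>P. B \<alpha> \<mu> = 0}. B lam \<alpha>) \<and>
     (1/2) * (\<Sum>\<alpha>\<in>{\<alpha>\<in>P. B \<alpha> \<mu> = 0}. B lam \<alpha>) \<ge> (norm_wrt B (rhoK_point B P \<mu>))\<^sup>2 \<and>
     ((norm_wrt B (lam - \<mu>))\<^sup>2 = (1/2) * (\<Sum>\<alpha>\<in>{\<alpha>\<in>P. B \<alpha> \<mu> = 0}. B lam \<alpha>) \<or>
      (norm_wrt B (lam - \<mu>))\<^sup>2 = (norm_wrt B (rhoK_point B P \<mu>))\<^sup>2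
      \<longrightarrow>
        \<mu> \<in> weyl_chamber B \<t> P \<and>
        (\<exists>!\<sigma>. \<sigma> \<in> strata B \<t> P \<and> \<mu> \<in> \<sigma>) \<and>
        (\<forall>\<sigma>\<in>strata B \<t> P. \<mu> \<in> \<sigma> \<longrightarrow> lam = \<mu> + rhoK_stratum B P \<sigma>) \<and>
        (norm_wrt B (lam - \<mu>))\<^sup>2 = (1/2) * (\<Sum>\<alpha>\<in>{\<alpha>\<in>P. B \<alpha> \<mu> = 0}. B lam \<alpha>) \<and>
        (1/2) * (\<Sum>\<alpha>\<in>{\<alpha>\<in>P. B \<alpha> \<mu> = 0}. B lam \<alpha>) = (norm_wrt B (rhoK_point B P \<mu>))\<^sup>2 \<and>
        lam - rho_at B \<Delta> lam = \<mu> - rho_at B \<Delta> \<mu>)"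
proof -
  interpret inner_form B
    using assms(7) by unfold_locales (auto simp: invariant_inner_product_def)
  obtain \<zeta> where \<zeta>: "\<And>\<alpha>. \<alpha> \<in> \<Delta> \<Longrightarrow> B \<alpha> \<zeta> \<noteq> 0" "P = {\<alpha>\<in>\<Delta>. B \<alpha> \<zeta> > 0}"
    using assms(10) by (auto simp: positive_system_def)
  have "E = UNIV \<or> E = {0}"
    using assms(1) by (simp add: lie_group_def smooth_atlas_def)
  then have "reflection_system B \<t> \<Delta> P \<zeta>"
  proof
    assume E: "E = UNIV"
    interpret compact_lie G A c B T
      using assms E by unfold_locales (auto simp: invariant_inner_product_def)
    show ?thesis
      unfolding assms(8,9) E
      by unfold_locales
        (use subspace_t finite_roots uminus_roots reflect_roots \<zeta>[unfolded assms(9) E] in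
          \<open>auto simp: roots_iff\<close>)
  next
    assume "E = {0}"
    \<comment> \<open>\<open>\<mu>\<close> witnesses that \<open>\<t>\<close> is nonempty. With no
      nonzero vector there are no roots, and the axioms hold for the empty system.\<close>
    then have "\<t> = {0}" "\<Delta> = {}"
      using assms(8,9,12) by (auto simp: torus_dual_def roots_def)
    then show ?thesis
      using \<zeta> by unfold_locales auto
  qed
  then show ?thesis
    using assms(11,12) by (rule reflection_system.norm_inequalities)
qed

end
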